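(* Let $X$ be a non-empty metrizable space, and let $\mathrm{NI}(X)$ be the set of all non-isolated points of $X$. The following are equivalent: (1) $F_{3}(X)$ is a $k$-space; (2) $F_{3}(X)$ is a $k_{R}$-space; (3) $X$ is locally compact or $\mathrm{NI}(X)$ is compact.
   Context: $F(X)$ denotes the free topological group (in the sense of Markov) over a Tychonoff space $X$, with free basis $X$. For $n\in\mathbb{N}$ (positive integers), $F_n(X)$ denotes the subspace of $F(X)$ consisting of all words of reduced length at most $n$ with respect to the free basis $X$. A topological space $Z$ is a $k$-space if a subset $A\subseteq Z$ is closed in $Z$ whenever $A\cap C$ is closed in $C$ for every compact $C\subseteq Z$. A topological space $Z$ is a $k_{R}$-space if $Z$ is Tychonoff and every function $f:Z\to\mathbb{R}$ whose restriction to each compact subset of $Z$ is continuous is itself continuous on $Z$. *)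

theory Defs
  imports "HOL-Analysis.Analysis" "HOL-Algebra.Group"
begin

text \<open>The library has no free groups. The letter \<open>(x, True)\<close> stands for \<open>x\<close> and
  \<open>(x, False)\<close> for the inverse of \<open>x\<close>; the elements of the free group are the reduced words.\<close>

definition opp :: "'a \<times> bool \<Rightarrow> 'a \<times> bool" where
  "opp a = (fst a, \<not> snd a)"

definition reduced :: "('a \<times> bool) list \<Rightarrow> bool" where
  "reduced w \<longleftrightarrow> successively (\<lambda>a b. b \<noteq> opp a) w"

fun red_Cons :: "'a \<times> bool \<Rightarrow> ('a \<times> bool) list \<Rightarrow> ('a \<times> bool) list" where
  "red_Cons a [] = [a]"
| "red_Cons a (b # w) = (if b = opp a then w else a # b # w)"

definition free_group :: "'a set \<Rightarrow> ('a \<times> bool) list monoid" where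
  "free_group S =
     \<lparr>carrier = {w. reduced w \<and> fst ` set w \<subseteq> S}, mult = foldr red_Cons, one = []\<rparr>"

definition free_gen :: "'a \<Rightarrow> ('a \<times> bool) list" where
  "free_gen x = [(x, True)]"

definition topological_group :: "('g, 'm) monoid_scheme \<Rightarrow> 'g topology \<Rightarrow> bool" where
  "topological_group G T \<longleftrightarrow> group G \<and> topspace T = carrier G \<and>
     continuous_map (prod_topology T T) T (\<lambda>(x, y). x \<otimes>\<^bsub>G\<^esub> y) \<and>
     continuous_map T T (\<lambda>x. inv\<^bsub>G\<^esub> x)"

text \<open>The topology of the Markov free topological group \<open>F(X)\<close>: the supremum of all group
  topologies on the abstract free group for which the inclusion of \<open>X\<close> is continuous. The
  lemmas at the end of this theory show that it is itself a group topology, that it has Markov's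
  universal property, and that it induces the original topology on a completely regular \<open>X\<close>.\<close>

definition free_group_topology :: "'a topology \<Rightarrow> ('a \<times> bool) list topology" where
  "free_group_topology X = topology_generated_by
     {U. \<exists>T. topological_group (free_group (topspace X)) T \<and> continuous_map X T free_gen \<and> openin T U}"

definition free_group_upto :: "nat \<Rightarrow> 'a topology \<Rightarrow> ('a \<times> bool) list topology" where
  "free_group_upto n X = subtopology (free_group_topology X)
     {w \<in> carrier (free_group (topspace X)). length w \<le> n}"

definition kR_space :: "'a topology \<Rightarrow> bool" where
  "kR_space Z \<longleftrightarrow> completely_regular_space Z \<and> Hausdorff_space Z \<and>
     (\<forall>f :: 'a \<Rightarrow> real.
        (\<forall>K. compactin Z K \<longrightarrow> continuous_map (subtopology Z K) euclideanreal f) \<longrightarrow>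
        continuous_map Z euclideanreal f)"

definition non_isolated_points :: "'a topology \<Rightarrow> 'a set" where
  "non_isolated_points X = {x \<in> topspace X. \<not> openin X {x}}"


subsection \<open>The free group\<close>

lemma opp_opp [simp]: "opp (opp a) = a"
  by (simp add: opp_def)

lemma fst_opp [simp]: "fst (opp a) = fst a"
  by (simp add: opp_def)

lemma opp_neq [simp]: "opp a \<noteq> a"
  by (simp add: opp_def prod_eq_iff)

lemma reduced_red_Cons: "reduced w \<Longrightarrow> reduced (red_Cons a w)"
  by (cases w) (auto simp: reduced_def successively_Cons)

lemma set_red_Cons: "set (red_Cons a w) \<subseteq> insert a (set w)"
  by (cases w) auto

lemma red_Cons_opp: "reduced w \<Longrightarrow> red_Cons a (red_Cons (opp a) w) = w"
proof (cases w)
  case (Cons b v)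
  assume "reduced w"
  then show ?thesis
    using Cons by (cases v) (auto simp: reduced_def)
qed auto

lemma red_Cons_reduced: "reduced (a # w) \<Longrightarrow> red_Cons a w = a # w"
  by (cases w) (auto simp: reduced_def)

lemma reduced_foldr: "reduced v \<Longrightarrow> reduced (foldr red_Cons u v)"
  by (induction u) (auto intro: reduced_red_Cons)

lemma set_foldr: "set (foldr red_Cons u v) \<subseteq> set u \<union> set v"
proof (induction u)
  case (Cons a u)
  then show ?case
    using set_red_Cons[of a "foldr red_Cons u v"] by auto
qed auto

lemma foldr_red_Cons:
  assumes "reduced w"
  shows "foldr red_Cons (red_Cons a v) w = red_Cons a (foldr red_Cons v w)"
proof (cases v)
  case (Cons b v')
  then show ?thesis
    using red_Cons_opp[OF reduced_foldr[OF assms, of v'], of a] by auto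
qed auto

lemma foldr_assoc:
  "reduced w \<Longrightarrow>
     foldr red_Cons (foldr red_Cons u v) w = foldr red_Cons u (foldr red_Cons v w)"
  by (induction u) (auto simp: foldr_red_Cons)

lemma foldr_Nil: "reduced u \<Longrightarrow> foldr red_Cons u [] = u"
proof (induction u)
  case (Cons a u)
  then have "reduced u"
    by (auto simp: reduced_def successively_Cons)
  with Cons show ?case
    by (simp add: red_Cons_reduced)
qed auto

lemma foldr_inverse: "reduced w \<Longrightarrow> foldr red_Cons (map opp (rev u)) (foldr red_Cons u w) = w"
proof (induction u arbitrary: w)
  case (Cons a u)
  have "red_Cons (opp a) (red_Cons a (foldr red_Cons u w)) = foldr red_Cons u w"
    using red_Cons_opp[OF reduced_foldr[OF Cons.prems, of u], of "opp a"] by simp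
  with Cons show ?case by simp
qed auto

lemma group_free_group: "group (free_group S)"
proof (rule groupI)
  fix u v assume "u \<in> carrier (free_group S)" "v \<in> carrier (free_group S)"
  then show "u \<otimes>\<^bsub>free_group S\<^esub> v \<in> carrier (free_group S)"
    using set_foldr[of u v] by (fastforce simp: free_group_def reduced_foldr)
next
  fix u assume u: "u \<in> carrier (free_group S)"
  let ?v = "foldr red_Cons (map opp (rev u)) []"
  have "?v \<in> carrier (free_group S)"
    using u set_foldr[of "map opp (rev u)" "[]"]
    by (fastforce simp: free_group_def reduced_def intro!: reduced_foldr[unfolded reduced_def])
  moreover have "foldr red_Cons ?v u = []"
    using u foldr_assoc[of u "map opp (rev u)" "[]"] foldr_inverse[of "[]" u]
    by (simp add: free_group_def foldr_Nil reduced_def)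
  ultimately show "\<exists>v \<in> carrier (free_group S). v \<otimes>\<^bsub>free_group S\<^esub> u = \<one>\<^bsub>free_group S\<^esub>"
    by (auto simp: free_group_def)
qed (auto simp: free_group_def foldr_assoc reduced_def)

lemma free_gen_closed: "x \<in> S \<Longrightarrow> free_gen x \<in> carrier (free_group S)"
  by (simp add: free_group_def free_gen_def reduced_def)

definition letter_val :: "('g, 'm) monoid_scheme \<Rightarrow> ('a \<Rightarrow> 'g) \<Rightarrow> 'a \<times> bool \<Rightarrow> 'g" where
  "letter_val G f a = (if snd a then f (fst a) else inv\<^bsub>G\<^esub> f (fst a))"

definition free_ext :: "('g, 'm) monoid_scheme \<Rightarrow> ('a \<Rightarrow> 'g) \<Rightarrow> ('a \<times> bool) list \<Rightarrow> 'g" where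
  "free_ext G f w = foldr (\<lambda>a g. letter_val G f a \<otimes>\<^bsub>G\<^esub> g) w \<one>\<^bsub>G\<^esub>"

context
  fixes G :: "('g, 'm) monoid_scheme" (structure) and f :: "'a \<Rightarrow> 'g" and S :: "'a set"
  assumes G: "group G" and f: "f \<in> S \<rightarrow> carrier G"
begin

interpretation group G by (rule G)

lemma letter_val_closed: "fst a \<in> S \<Longrightarrow> letter_val G f a \<in> carrier G"
  using f by (auto simp: letter_val_def)

lemma letter_val_opp: "fst a \<in> S \<Longrightarrow> letter_val G f (opp a) = inv (letter_val G f a)"
  using f by (simp add: letter_val_def opp_def Pi_iff)

lemma free_ext_closed: "fst ` set w \<subseteq> S \<Longrightarrow> free_ext G f w \<in> carrier G"
  by (induction w) (auto simp: free_ext_def letter_val_closed)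

lemma free_ext_red_Cons:
  assumes "fst a \<in> S" "fst ` set w \<subseteq> S"
  shows "free_ext G f (red_Cons a w) = letter_val G f a \<otimes> free_ext G f w"
proof (cases w)
  case (Cons b v)
  have "free_ext G f v \<in> carrier G"
    using assms Cons by (intro free_ext_closed) auto
  then have "letter_val G f a \<otimes> (inv (letter_val G f a) \<otimes> free_ext G f v) = free_ext G f v"
    using letter_val_closed[OF assms(1)] by (simp add: m_assoc[symmetric])
  then show ?thesis
    using Cons assms by (auto simp: free_ext_def letter_val_opp)
qed (auto simp: free_ext_def)

lemma free_ext_foldr:
  assumes "fst ` set u \<subseteq> S" "fst ` set v \<subseteq> S"
  shows "free_ext G f (foldr red_Cons u v) = free_ext G f u \<otimes> free_ext G f v"
  using assms(1)
proof (induction u)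
  case Nil
  then show ?case
    using free_ext_closed[OF assms(2)] by (simp add: free_ext_def)
next
  case (Cons a u)
  have "fst ` set (foldr red_Cons u v) \<subseteq> S"
    using set_foldr[of u v] Cons.prems assms(2) by fastforce
  moreover have "free_ext G f (a # u) = letter_val G f a \<otimes> free_ext G f u"
    by (simp add: free_ext_def)
  moreover have "free_ext G f u \<in> carrier G"
    using Cons.prems by (intro free_ext_closed) auto
  ultimately show ?case
    using Cons free_ext_closed[OF assms(2)] letter_val_closed[of a]
    by (simp add: free_ext_red_Cons m_assoc)
qed

lemma free_ext_hom: "free_ext G f \<in> hom (free_group S) G"
  by (auto simp: hom_def free_group_def free_ext_foldr free_ext_closed)

lemma free_ext_gen: "x \<in> S \<Longrightarrow> free_ext G f (free_gen x) = f x"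
  using f by (simp add: free_ext_def free_gen_def letter_val_def Pi_iff)

end

lemma free_group_hom_unique:
  assumes G: "group G" and h: "h \<in> hom (free_group S) G" and k: "k \<in> hom (free_group S) G"
    and eq: "\<And>x. x \<in> S \<Longrightarrow> h (free_gen x) = k (free_gen x)"
    and w: "w \<in> carrier (free_group S)"
  shows "h w = k w"
proof -
  interpret G: group G by (rule G)
  interpret F: group "free_group S" by (rule group_free_group)
  interpret h: group_hom "free_group S" G h
    by (rule group_hom.intro) (use group_free_group G h in \<open>auto simp: group_hom_axioms_def\<close>)
  interpret k: group_hom "free_group S" G k
    by (rule group_hom.intro) (use group_free_group G k in \<open>auto simp: group_hom_axioms_def\<close>)
  have letter: "h [a] = k [a]" "[a] \<in> carrier (free_group S)" if "fst a \<in> S" for a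
  proof -
    obtain x b where a: "a = (x, b)" by (cases a)
    show A: "[a] \<in> carrier (free_group S)"
      using that by (simp add: free_group_def reduced_def)
    show "h [a] = k [a]"
    proof (cases b)
      case True
      then show ?thesis using eq that a by (simp add: free_gen_def)
    next
      case False
      have "[a] \<otimes>\<^bsub>free_group S\<^esub> free_gen x = \<one>\<^bsub>free_group S\<^esub>"
        using a False by (simp add: free_group_def free_gen_def opp_def)
      then have "[a] = inv\<^bsub>free_group S\<^esub> (free_gen x)"
        using A a that F.inv_equality free_gen_closed by fastforce
      then show ?thesis
        using eq that a free_gen_closed[of x S] by simp
    qed
  qed
  show ?thesis using w
  proof (induction w)
    case Nil
    then show ?case using h.hom_one k.hom_one by (simp add: free_group_def)
  next
    case (Cons a w)
    then have a: "fst a \<in> S" and w: "w \<in> carrier (free_group S)" and red: "reduced (a # w)"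
      by (auto simp: free_group_def reduced_def successively_Cons)
    then have "a # w = [a] \<otimes>\<^bsub>free_group S\<^esub> w"
      using red_Cons_reduced[OF red] by (simp add: free_group_def)
    then show ?case
      using letter[OF a] w Cons.IH by simp
  qed
qed


subsection \<open>The free topology\<close>

lemma topological_group_pullback:
  assumes G: "group G" and H: "topological_group H T" and h: "h \<in> hom G H"
  shows "topological_group G (pullback_topology (carrier G) h T)" (is "topological_group G ?P")
proof -
  have grpH: "group H" and topT: "topspace T = carrier H"
    using H by (auto simp: topological_group_def)
  interpret h: group_hom G H h
    by (rule group_hom.intro) (use G grpH h in \<open>auto simp: group_hom_axioms_def\<close>)
  have top: "topspace ?P = carrier G"
    using topT by (auto simp: topspace_pullback_topology)
  have hc: "continuous_map ?P T h"
    using continuous_map_pullback[of T T id "carrier G" h] by simp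
  have mT: "continuous_map (prod_topology T T) T (\<lambda>(x, y). x \<otimes>\<^bsub>H\<^esub> y)"
    and iT: "continuous_map T T (\<lambda>x. inv\<^bsub>H\<^esub> x)"
    using H by (auto simp: topological_group_def)
  have "continuous_map (prod_topology ?P ?P) (prod_topology T T) (\<lambda>p. (h (fst p), h (snd p)))"
    using continuous_map_compose[OF continuous_map_fst hc]
      continuous_map_compose[OF continuous_map_snd hc]
    by (auto simp: continuous_map_pairwise o_def)
  from continuous_map_compose[OF this mT]
  have "continuous_map (prod_topology ?P ?P) T (h \<circ> (\<lambda>(x, y). x \<otimes>\<^bsub>G\<^esub> y))"
    by (rule continuous_map_eq) (auto simp: top)
  then have "continuous_map (prod_topology ?P ?P) ?P (\<lambda>(x, y). x \<otimes>\<^bsub>G\<^esub> y)"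
    by (rule continuous_map_pullback') (auto simp: top)
  moreover have "continuous_map ?P T (h \<circ> (\<lambda>x. inv\<^bsub>G\<^esub> x))"
    using continuous_map_compose[OF hc iT] by (rule continuous_map_eq) (auto simp: top)
  then have "continuous_map ?P ?P (\<lambda>x. inv\<^bsub>G\<^esub> x)"
    by (rule continuous_map_pullback') (auto simp: top)
  ultimately show ?thesis
    using G top by (simp add: topological_group_def)
qed

lemma topspace_free_group_topology:
  "topspace (free_group_topology X) = carrier (free_group (topspace X))"
proof -
  let ?G = "free_group (topspace X)"
  let ?T = "topology_generated_by {carrier ?G}"
  have "topological_group ?G ?T"
    unfolding topological_group_def
  proof (intro conjI)
    interpret group ?G by (rule group_free_group)
    show "Group.group ?G" by (rule group_free_group)
    have "(\<lambda>(x, y). x \<otimes>\<^bsub>?G\<^esub> y) -` carrier ?G \<inter> topspace (prod_topology ?T ?T)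
        = topspace (prod_topology ?T ?T)"
      by auto
    then show "continuous_map (prod_topology ?T ?T) ?T (\<lambda>(x, y). x \<otimes>\<^bsub>?G\<^esub> y)"
      unfolding continuous_on_generated_topo_iff
      by (auto simp: openin_prod_Times_iff topology_generated_by_Basis)
    have "(\<lambda>x. inv\<^bsub>?G\<^esub> x) -` carrier ?G \<inter> topspace ?T = topspace ?T"
      by auto
    then show "continuous_map ?T ?T (\<lambda>x. inv\<^bsub>?G\<^esub> x)"
      unfolding continuous_on_generated_topo_iff by (auto simp del: topology_generated_by_topspace)
  qed simp
  moreover have "free_gen -` carrier ?G \<inter> topspace X = topspace X"
    by (auto simp: free_gen_closed)
  then have "continuous_map X ?T free_gen"
    unfolding continuous_on_generated_topo_iff by (auto simp: free_gen_closed)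
  moreover have "openin ?T (carrier ?G)"
    by (simp add: topology_generated_by_Basis)
  ultimately have "carrier ?G \<subseteq> topspace (free_group_topology X)"
    unfolding free_group_topology_def topology_generated_by_topspace by blast
  moreover have "topspace (free_group_topology X) \<subseteq> carrier ?G"
    unfolding free_group_topology_def topology_generated_by_topspace
    by (auto simp: topological_group_def dest: openin_subset)
  ultimately show ?thesis by blast
qed

lemma free_group_topology_finest:
  assumes "topological_group (free_group (topspace X)) T" "continuous_map X T free_gen"
  shows "continuous_map (free_group_topology X) T id"
proof -
  have "topspace T = carrier (free_group (topspace X))"
    using assms by (auto simp: topological_group_def)
  moreover have "openin (free_group_topology X) U" if "openin T U" for U
    unfolding free_group_topology_def
    using that assms by (intro topology_generated_by_Basis) blast
  ultimately show ?thesis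
    by (simp add: continuous_map_def topspace_free_group_topology Int_def)
       (metis (no_types, lifting) Collect_cong Collect_mem_eq openin_subset subsetD)
qed

lemma continuous_map_into_free_group_topology:
  assumes "f \<in> topspace Y \<rightarrow> carrier (free_group (topspace X))"
    and "\<And>T. topological_group (free_group (topspace X)) T \<Longrightarrow> continuous_map X T free_gen \<Longrightarrow>
           continuous_map Y T f"
  shows "continuous_map Y (free_group_topology X) f"
  unfolding free_group_topology_def
proof (rule continuous_on_generated_topo)
  fix U
  assume "U \<in> {U. \<exists>T. topological_group (free_group (topspace X)) T \<and>
                continuous_map X T free_gen \<and> openin T U}"
  then show "openin Y (f -` U \<inter> topspace Y)"
    using assms(2) by (auto simp: continuous_map_alt)
next
  show "f ` topspace Y \<subseteq> \<Union> {U. \<exists>T. topological_group (free_group (topspace X)) T \<and>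
                continuous_map X T free_gen \<and> openin T U}"
    using assms(1) topspace_free_group_topology[of X]
    unfolding free_group_topology_def topology_generated_by_topspace by auto
qed

lemma topological_group_free_group_topology:
  "topological_group (free_group (topspace X)) (free_group_topology X)"
proof -
  let ?G = "free_group (topspace X)" and ?F = "free_group_topology X"
  interpret group ?G by (rule group_free_group)
  have "continuous_map (prod_topology ?F ?F) ?F (\<lambda>(x, y). x \<otimes>\<^bsub>?G\<^esub> y)"
  proof (rule continuous_map_into_free_group_topology)
    fix T assume T: "topological_group ?G T" "continuous_map X T free_gen"
    note id = free_group_topology_finest[OF T]
    have "continuous_map (prod_topology ?F ?F) (prod_topology T T) (\<lambda>p. (fst p, snd p))"
      using continuous_map_compose[OF continuous_map_fst id]
        continuous_map_compose[OF continuous_map_snd id]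
      by (auto simp: continuous_map_pairwise o_def)
    moreover have "continuous_map (prod_topology T T) T (\<lambda>(x, y). x \<otimes>\<^bsub>?G\<^esub> y)"
      using T by (simp add: topological_group_def)
    ultimately show "continuous_map (prod_topology ?F ?F) T (\<lambda>(x, y). x \<otimes>\<^bsub>?G\<^esub> y)"
      using continuous_map_compose by (fastforce simp: o_def)
  qed (auto simp: topspace_free_group_topology)
  moreover have "continuous_map ?F ?F (\<lambda>x. inv\<^bsub>?G\<^esub> x)"
  proof (rule continuous_map_into_free_group_topology)
    fix T assume T: "topological_group ?G T" "continuous_map X T free_gen"
    have "continuous_map T T (\<lambda>x. inv\<^bsub>?G\<^esub> x)"
      using T by (simp add: topological_group_def)
    with free_group_topology_finest[OF T] show "continuous_map ?F T (\<lambda>x. inv\<^bsub>?G\<^esub> x)"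
      using continuous_map_compose by fastforce
  qed (auto simp: topspace_free_group_topology)
  ultimately show ?thesis
    by (simp add: topological_group_def topspace_free_group_topology group_free_group)
qed

lemma continuous_map_free_gen: "continuous_map X (free_group_topology X) free_gen"
  by (rule continuous_map_into_free_group_topology) (auto simp: free_gen_closed)

lemma continuous_map_free_ext:
  assumes H: "topological_group H T" and f: "continuous_map X T f"
  shows "continuous_map (free_group_topology X) T (free_ext H f)"
proof -
  let ?G = "free_group (topspace X)"
  let ?P = "pullback_topology (carrier ?G) (free_ext H f) T"
  have grpH: "group H" and fS: "f \<in> topspace X \<rightarrow> carrier H"
    using H f by (auto simp: topological_group_def continuous_map_def)
  have "topological_group ?G ?P"
    by (rule topological_group_pullback[OF group_free_group H free_ext_hom[OF grpH fS]])
  moreover have "continuous_map X T (free_ext H f \<circ> free_gen)"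
    using f by (rule continuous_map_eq) (simp add: free_ext_gen[OF grpH fS])
  then have "continuous_map X ?P free_gen"
    by (rule continuous_map_pullback') (auto simp: free_gen_closed)
  ultimately have "continuous_map (free_group_topology X) ?P id"
    by (rule free_group_topology_finest)
  moreover have "continuous_map ?P T (free_ext H f)"
    using continuous_map_pullback[of T T id "carrier ?G" "free_ext H f"] by simp
  ultimately show ?thesis
    using continuous_map_compose by fastforce
qed

lemma free_group_topology_universal:
  assumes H: "topological_group H T" and f: "continuous_map X T f"
  shows "\<exists>h \<in> hom (free_group (topspace X)) H.
           continuous_map (free_group_topology X) T h \<and> (\<forall>x \<in> topspace X. h (free_gen x) = f x) \<and>
           (\<forall>k \<in> hom (free_group (topspace X)) H. (\<forall>x \<in> topspace X. k (free_gen x) = f x) \<longrightarrow>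
              (\<forall>w \<in> carrier (free_group (topspace X)). k w = h w))"
proof -
  have grpH: "group H" and fS: "f \<in> topspace X \<rightarrow> carrier H"
    using H f by (auto simp: topological_group_def continuous_map_def)
  show ?thesis
  proof (intro bexI[of _ "free_ext H f"] conjI ballI impI)
    fix k w
    assume "k \<in> hom (free_group (topspace X)) H" "\<forall>x \<in> topspace X. k (free_gen x) = f x"
      "w \<in> carrier (free_group (topspace X))"
    then show "k w = free_ext H f w"
      using free_group_hom_unique[OF grpH _ free_ext_hom[OF grpH fS]]
      by (simp add: free_ext_gen[OF grpH fS])
  qed (use continuous_map_free_ext[OF H f] free_ext_hom[OF grpH fS] free_ext_gen[OF grpH fS] in auto)
qed

lemma embedding_map_free_gen:
  assumes "completely_regular_space X"
  shows "embedding_map X (free_group_topology X) free_gen"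
proof -
  let ?F = "free_group_topology X" and ?H = "\<lparr>carrier = UNIV, mult = (+), one = 0 :: real\<rparr>"
  have grpH: "group ?H"
    by (rule groupI) (auto intro: exI[of _ "- _"])
  have inv: "inv\<^bsub>?H\<^esub> x = - x" for x
    using group.inv_equality[OF grpH, of "- x" x] by simp
  have H: "topological_group ?H euclideanreal"
  proof -
    have "continuous_map (prod_topology euclideanreal euclideanreal) euclideanreal
            (\<lambda>p. fst p + snd p)"
      by (intro continuous_map_add continuous_map_fst continuous_map_snd)
    moreover have "continuous_map euclideanreal euclideanreal (\<lambda>x. - x)"
      by (intro continuous_map_minus continuous_map_id[unfolded id_def])
    ultimately show ?thesis
      using grpH by (simp add: topological_group_def inv case_prod_unfold)
  qed
  have "\<exists>V. openin ?F V \<and> free_gen x \<in> V \<and> free_gen -` V \<inter> topspace X \<subseteq> U"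
    if "openin X U" "x \<in> U" for U x
  proof -
    have "closedin X (topspace X - U)" "x \<in> topspace X - (topspace X - U)"
      using that openin_subset by auto
    then obtain f :: "_ \<Rightarrow> real" where
      f: "continuous_map X (top_of_set {0..1}) f" "f x = 0" "f ` (topspace X - U) \<subseteq> {1}"
      using assms unfolding completely_regular_space_def by meson
    then have fc: "continuous_map X euclideanreal f"
      by (simp add: continuous_map_in_subtopology)
    have fS: "f \<in> topspace X \<rightarrow> carrier ?H" by simp
    define V where "V = {w \<in> topspace ?F. free_ext ?H f w \<in> {..<1}}"
    have "openin ?F V"
      unfolding V_def by (rule openin_continuous_map_preimage[OF continuous_map_free_ext[OF H fc]]) auto
    moreover have "x \<in> topspace X"
      using that openin_subset by blast
    ultimately show ?thesis
      using f free_ext_gen[OF grpH fS] 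
      by (intro exI[of _ V]) (force simp: V_def topspace_free_group_topology free_gen_closed)
  qed
  note ex = this
  have op: "\<exists>V. openin ?F V \<and> free_gen ` U = V \<inter> free_gen ` topspace X" if U: "openin X U" for U
  proof -
    let ?V = "\<Union>{V. openin ?F V \<and> free_gen -` V \<inter> topspace X \<subseteq> U}"
    have "openin ?F ?V" by blast
    moreover have "free_gen ` U = ?V \<inter> free_gen ` topspace X"
      using ex[OF U] openin_subset[OF U] by blast
    ultimately show ?thesis by blast
  qed
  have "open_map X (subtopology ?F (free_gen ` topspace X)) free_gen"
    unfolding open_map_def openin_subtopology using op by blast
  moreover have "inj_on free_gen (topspace X)"
    by (auto simp: inj_on_def free_gen_def)
  ultimately show ?thesis
    unfolding embedding_map_def
    by (intro bijective_open_imp_homeomorphic_map)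
       (auto simp: continuous_map_in_subtopology continuous_map_free_gen
          topspace_free_group_topology free_gen_closed)
qed

end

theory Submission
  imports Defs
begin

text \<open>A continuous pseudometric \<open>D\<close> on \<open>X\<close> extends to Graev's invariant norm on the free group: the
  norm of a word is the least cost of a non-crossing matching of its letters, where two letters of
  opposite sign are matched at the cost of the \<open>D\<close>-distance of their base points. For words of length
  at most 3 the matchings of \<open>w g\<^sup>-\<^sup>1\<close> can be listed, so the Graev neighbourhoods of \<open>g\<close> are explicit.
  The critical case is a single letter \<open>x\<close>, whose neighbourhood consists of the letters \<open>v\<close>
  near \<open>x\<close> together with the words \<open>v u\<close> and \<open>u v\<close>, where \<open>u\<close> is a short word of length 2. If \<open>X\<close> is
  locally compact or \<open>NI(X)\<close> is compact, the tube lemma places such a neighbourhood inside every set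
  whose preimages under the word maps \<open>X\<^sup>2 \<rightarrow> F\<^sub>3(X)\<close> and \<open>X\<^sup>3 \<rightarrow> F\<^sub>3(X)\<close> are open. Hence
  \<open>F\<^sub>3(X)\<close> carries the quotient topology, which makes it a k-space, and the norms make it
  completely regular.

  Otherwise some \<open>x\<close> has no compact neighbourhood, and there are a closed discrete sequence \<open>y\<^sub>k\<close>
  in \<open>NI(X)\<close>, points \<open>z\<^sub>k\<^sub>n \<rightarrow> y\<^sub>k\<close> and, in the ball of radius \<open>1/k\<close> around \<open>x\<close>, closed discrete
  sequences \<open>x\<^sub>k\<^sub>n\<close>. The words \<open>x\<^sub>k\<^sub>n y\<^sub>k\<^sup>-\<^sup>1 z\<^sub>k\<^sub>n\<close> accumulate at \<open>x\<close>, but every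
  compact set meets only finitely many of suitable neighbourhoods of them; a sum of bump functions is
  therefore continuous on every compact set and discontinuous at \<open>x\<close>. The bump functions are corner
  entries of homomorphisms into the unitriangular \<open>4 \<times> 4\<close> matrices.\<close>


subsection \<open>Non-crossing matchings\<close>

lemma inv_free_group:
  assumes "g \<in> carrier (free_group S)"
  shows "inv\<^bsub>free_group S\<^esub> g = map opp (rev g)"
    and "map opp (rev g) \<in> carrier (free_group S)"
proof -
  have "reduced (map opp (rev g))"
    using assms unfolding free_group_def reduced_def successively_map successively_rev
    by (auto elim!: successively_mono)
  then show c: "map opp (rev g) \<in> carrier (free_group S)"
    using assms by (auto simp: free_group_def)
  have "map opp (rev g) \<otimes>\<^bsub>free_group S\<^esub> g = \<one>\<^bsub>free_group S\<^esub>"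
    using foldr_inverse[of "[]" g] assms
    by (simp add: free_group_def foldr_Nil reduced_def)
  then show "inv\<^bsub>free_group S\<^esub> g = map opp (rev g)"
    using assms c group.inv_equality[OF group_free_group] by metis
qed

lemma snd_opp [simp]: "snd (opp a) \<longleftrightarrow> \<not> snd a"
  by (simp add: opp_def)

locale pseudometric =
  fixes D :: "'a \<Rightarrow> 'a \<Rightarrow> real"
  assumes D_refl [simp]: "D x x = 0"
    and D_sym: "D x y = D y x"
    and D_tri: "D x z \<le> D x y + D y z"
begin

lemma D_nonneg [simp]: "0 \<le> D x y"
  using D_tri[of x x y] D_sym[of x y] by simp

text \<open>The partner \<open>b\<close> of the first letter splits a non-crossing matching into the
  part \<open>u\<close> under the arc and the part \<open>v\<close> after it, so every matching is
  built in exactly one way. The words need not be reduced, which allows matchings to be followed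
  through each single cancellation.\<close>

inductive pairing :: "('a \<times> bool) list \<Rightarrow> real \<Rightarrow> bool" where
  Nil: "pairing [] 0"
| pair: "pairing u r \<Longrightarrow> pairing v s \<Longrightarrow> snd a \<noteq> snd b \<Longrightarrow>
    pairing (a # u @ b # v) (r + s + D (fst a) (fst b))"

lemma pairing_nonneg: "pairing w r \<Longrightarrow> 0 \<le> r"
  by (induction rule: pairing.induct) auto

lemma pairing_even: "pairing w r \<Longrightarrow> even (length w)"
  by (induction rule: pairing.induct) auto

lemma pairing_append: "pairing u r \<Longrightarrow> pairing v s \<Longrightarrow> pairing (u @ v) (r + s)"
proof (induction rule: pairing.induct)
  case (pair u r u' r' a b)
  then show ?case
    using pairing.pair[OF pair.hyps(1) pair.IH(2)[OF pair.prems] pair.hyps(3)]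
    by (simp add: add.assoc add.commute add.left_commute)
qed simp

lemma pairing_wrap:
  assumes "pairing u r" "snd a \<noteq> snd b"
  shows "pairing (a # u @ [b]) (r + D (fst a) (fst b))"
  using pairing.pair[OF assms(1) pairing.Nil assms(2)] by simp

text \<open>Each letter of \<open>v\<close> is joined to its own inverse at cost 0, in arcs nested
  around \<open>u\<close>. This yields the conjugation invariance of the norm.\<close>

lemma pairing_conjugate: "pairing u r \<Longrightarrow> pairing (v @ u @ map opp (rev v)) r"
proof (induction v)
  case (Cons a v)
  then show ?case
    using pairing_wrap[of "v @ u @ map opp (rev v)" r a "opp a"] by simp
qed simp

lemma pairing_inverse: "pairing u r \<Longrightarrow> pairing (map opp (rev u)) r"
proof (induction rule: pairing.induct)
  case (pair u r v s a b)
  have "pairing (opp b # map opp (rev u) @ [opp a]) (r + D (fst b) (fst a))"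
    using pairing_wrap[OF pair.IH(1), of "opp b" "opp a"] pair.hyps(3) by simp
  from pairing_append[OF pair.IH(2) this] show ?case
    by (simp add: D_sym add.assoc add.commute add.left_commute)
qed (simp add: pairing.Nil)

lemma pairing_Cons:
  assumes "pairing (a # w) r"
  obtains u b v s t where "w = u @ b # v" "pairing u s" "pairing v t" "snd a \<noteq> snd b"
    "r = s + t + D (fst a) (fst b)"
  using assms by (cases rule: pairing.cases) auto

text \<open>The mirror image of \<open>pairing_Cons\<close>. The inductive rule exposes only the
  partner of the first letter; that of the last letter is found by moving along the outermost arcs
  to the last one.\<close>

lemma pairing_snoc:
  assumes "pairing w' r" "w' = w @ [b]"
  shows "\<exists>u a v s t. w = u @ a # v \<and> pairing u s \<and> pairing v t \<and> snd a \<noteq> snd b \<and>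
    r = s + t + D (fst a) (fst b)"
  using assms
proof (induction arbitrary: w rule: pairing.induct)
  case (pair u r v s a c)
  show ?case
  proof (cases v rule: rev_cases)
    case Nil
    then have "s = 0" using pair.hyps(2) by (auto elim: pairing.cases)
    moreover have "w = [] @ a # u" "c = b" using Nil pair.prems by auto
    ultimately show ?thesis
      using pair.hyps(1,3) pairing.Nil
      by (intro exI[of _ "[]"] exI[of _ a] exI[of _ u] exI[of _ 0] exI[of _ r]) auto
  next
    case (snoc v' b')
    then have eq: "b' = b" "w = a # u @ c # v'" using pair.prems by auto
    obtain v1 e v2 s1 s2 where "v' = v1 @ e # v2" "pairing v1 s1" "pairing v2 s2"
      "snd e \<noteq> snd b" "s = s1 + s2 + D (fst e) (fst b)"
      using pair.IH(2) snoc eq by blast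
    moreover from this have "pairing (a # u @ c # v1) (r + s1 + D (fst a) (fst c))"
      using pairing.pair[OF pair.hyps(1)] pair.hyps(3) by blast
    ultimately show ?thesis
      using eq by (intro exI[of _ "a # u @ c # v1"] exI[of _ e] exI[of _ v2]
          exI[of _ "r + s1 + D (fst a) (fst c)"] exI[of _ s2]) auto
  qed
qed simp

text \<open>Deleting \<open>a\<close> and its inverse leaves their partners to be matched with each other;
  the triangle inequality through \<open>fst a\<close> bounds the new cost.\<close>

lemma pairing_delete:
  assumes "pairing w r" "w = u @ a # opp a # v"
  shows "\<exists>r' \<le> r. pairing (u @ v) r'"
  using assms
proof (induction arbitrary: u v rule: pairing.induct)
  case (pair x r y s c e)
  have nn: "0 \<le> r" "0 \<le> s" "0 \<le> D (fst c) (fst e)"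
    using pairing_nonneg pair.hyps by auto
  show ?case
  proof (cases u)
    case Nil
    \<comment> \<open>Here \<open>c\<close> is the first deleted letter. Either its partner
      \<open>e\<close> is the second one and their arc disappears, or the partners \<open>e\<close>
      and \<open>f\<close> of the two deleted letters are joined.\<close>
    show ?thesis
    proof (cases x)
      case Nil
      with \<open>u = []\<close> pair.prems pair.hyps(2) nn show ?thesis
        by (intro exI[of _ s]) auto
    next
      case (Cons b x')
      then have ca: "c = a" "b = opp a" "v = x' @ e # y"
        using \<open>u = []\<close> pair.prems by auto
      obtain x1 f x2 r1 r2 where x: "x' = x1 @ f # x2" "pairing x1 r1" "pairing x2 r2"
        "snd b \<noteq> snd f" "r = r1 + r2 + D (fst b) (fst f)"
        using pairing_Cons pair.hyps(1) Cons by metis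
      have "snd f \<noteq> snd e"
        using x(4) ca pair.hyps(3) by auto
      from pairing_append[OF x(2) pairing.pair[OF x(3) pair.hyps(2) this]]
      have "pairing (u @ v) (r1 + (r2 + s + D (fst f) (fst e)))"
        using ca x(1) \<open>u = []\<close> by simp
      moreover have "D (fst f) (fst e) \<le> D (fst b) (fst f) + D (fst c) (fst e)"
        using D_tri[of "fst f" "fst e" "fst b"] D_sym[of "fst f"] ca by simp
      ultimately show ?thesis using x(5) by (intro exI conjI) auto
    qed
  next
    case (Cons c' u')
    then have cc: "c' = c" and eq: "x @ e # y = u' @ a # opp a # v"
      using pair.prems by auto
    \<comment> \<open>Position of the deleted pair relative to the arc from \<open>c\<close> to
      \<open>e\<close>: under it, ending at \<open>e\<close>, starting at \<open>e\<close>, or after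
      it. In the two middle cases \<open>e\<close> is deleted, and \<open>c\<close> is joined to the
      partner of the other deleted letter.\<close>
    consider
      (1) x' where "x = u' @ a # opp a # x'" "v = x' @ e # y"
    | (2) "x = u' @ [a]" "e = opp a" "y = v"
    | (3) "x = u'" "e = a" "y = opp a # v"
    | (4) u'' where "u' = x @ e # u''" "y = u'' @ a # opp a # v"
    proof -
      from eq obtain us where "x = u' @ us \<and> us @ e # y = a # opp a # v \<or>
          x @ us = u' \<and> e # y = us @ a # opp a # v"
        unfolding append_eq_append_conv2 by blast
      then show thesis
      proof (elim disjE conjE)
        assume "x = u' @ us" "us @ e # y = a # opp a # v"
        then show thesis using that(1-3) by (cases us; cases "tl us") auto
      next
        assume "x @ us = u'" "e # y = us @ a # opp a # v"
        then show thesis using that(3,4) by (cases us) auto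
      qed
    qed
    then show ?thesis
    proof cases
      case 1
      from pair.IH(1)[OF this(1)] obtain r' where r': "r' \<le> r" "pairing (u' @ x') r'" by blast
      show ?thesis
        using pairing.pair[OF r'(2) pair.hyps(2,3)] r'(1) Cons cc 1
        by (intro exI[of _ "r' + s + D (fst c) (fst e)"]) auto
    next
      case 2
      obtain u1 f u2 r1 r2 where x: "u' = u1 @ f # u2" "pairing u1 r1" "pairing u2 r2"
        "snd f \<noteq> snd a" "r = r1 + r2 + D (fst f) (fst a)"
        using pairing_snoc[OF pair.hyps(1) 2(1)] by blast
      have "snd c \<noteq> snd f" using x(4) 2 pair.hyps(3) by auto
      from pairing.pair[OF x(2) pairing_append[OF x(3) pair.hyps(2)] this]
      have "pairing (u @ v) (r1 + (r2 + s) + D (fst c) (fst f))"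
        using Cons cc x 2 by simp
      moreover have "D (fst c) (fst f) \<le> D (fst c) (fst e) + D (fst f) (fst a)"
        using D_tri[of "fst c" "fst f" "fst e"] D_sym[of "fst f"] 2 by simp
      ultimately show ?thesis using x(5) by (intro exI conjI) auto
    next
      case 3
      obtain u1 f u2 r1 r2 where x: "v = u1 @ f # u2" "pairing u1 r1" "pairing u2 r2"
        "snd (opp a) \<noteq> snd f" "s = r1 + r2 + D (fst (opp a)) (fst f)"
        using pairing_Cons pair.hyps(2) 3(3) by metis
      have "snd c \<noteq> snd f" using x(4) 3 pair.hyps(3) by auto
      from pairing.pair[OF pairing_append[OF pair.hyps(1) x(2)] x(3) this]
      have "pairing (u @ v) ((r + r1) + r2 + D (fst c) (fst f))"
        using Cons cc x 3 by simp
      moreover have "D (fst c) (fst f) \<le> D (fst c) (fst e) + D (fst a) (fst f)"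
        using D_tri[of "fst c" "fst f" "fst e"] 3 by simp
      ultimately show ?thesis using x(5) by (intro exI conjI) auto
    next
      case 4
      from pair.IH(2)[OF this(2)] obtain s' where s': "s' \<le> s" "pairing (u'' @ v) s'" by blast
      show ?thesis
        using pairing.pair[OF pair.hyps(1) s'(2) pair.hyps(3)] s'(1) Cons cc 4
        by (intro exI[of _ "r + s' + D (fst c) (fst e)"]) auto
    qed
  qed
qed simp

text \<open>Converse of \<open>pairing_delete\<close>: the two new letters are joined to each other
  at cost 0, and being adjacent they cross no arc.\<close>

lemma pairing_insert:
  assumes "pairing w r" "w = u @ v"
  shows "pairing (u @ a # opp a # v) r"
  using assms
proof (induction arbitrary: u v rule: pairing.induct)
  case Nil
  then show ?case using pairing.pair[OF pairing.Nil pairing.Nil, of a "opp a"] by simp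
next
  case (pair x r y s c e)
  have ins: "pairing [a, opp a] 0"
    using pairing.pair[OF pairing.Nil pairing.Nil, of a "opp a"] by simp
  show ?case
  proof (cases u)
    case Nil
    then show ?thesis
      using pairing_append[OF ins pairing.pair[OF pair.hyps]] pair.prems by simp
  next
    case (Cons c' u')
    then have cc: "c' = c" and eq: "x @ e # y = u' @ v"
      using pair.prems by auto
    from eq consider
      (1) x' where "x = u' @ x'" "v = x' @ e # y"
    | (2) u'' where "u' = x @ e # u''" "y = u'' @ v"
      unfolding append_eq_append_conv2 by (auto simp: Cons_eq_append_conv)
    then show ?thesis
    proof cases
      case 1
      from pairing.pair[OF pair.IH(1)[OF this(1)] pair.hyps(2,3)] show ?thesis
        using 1 Cons cc by simp
    next
      case 2
      from pairing.pair[OF pair.hyps(1) pair.IH(2)[OF this(2)] pair.hyps(3)] show ?thesis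
        using 2 Cons cc by simp
    qed
  qed
qed

text \<open>Each \<open>red_Cons\<close> cancels at most one adjacent pair, so
  \<open>pairing_delete\<close> applies step by step. The prefix \<open>p\<close> takes up the
  letters of \<open>u\<close> that the induction has yet to multiply back.\<close>

lemma pairing_reduce: "pairing (p @ u @ v) r \<Longrightarrow> \<exists>r' \<le> r. pairing (p @ foldr red_Cons u v) r'"
proof (induction u arbitrary: p r)
  case (Cons a u)
  from Cons.IH[of "p @ [a]" r] Cons.prems obtain r' where
    r': "r' \<le> r" "pairing (p @ a # foldr red_Cons u v) r'" by auto
  show ?case
  proof (cases "\<exists>z. foldr red_Cons u v = opp a # z")
    case True
    then obtain z where z: "foldr red_Cons u v = opp a # z" by blast
    with r' obtain r'' where "r'' \<le> r'" "pairing (p @ z) r''"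
      using pairing_delete[of "p @ a # foldr red_Cons u v" r' p a z] by auto
    then show ?thesis using r' z by (intro exI[of _ r'']) auto
  next
    case False
    then have "red_Cons a (foldr red_Cons u v) = a # foldr red_Cons u v"
      by (cases "foldr red_Cons u v") auto
    then show ?thesis using r' by auto
  qed
qed auto

text \<open>With \<open>pairing_reduce\<close> this shows that a product may be replaced by the
  plain concatenation when small matchings are sought; the concatenation \<open>w\<close> with the
  inverse of \<open>g\<close> is what gets analysed later.\<close>

lemma pairing_expand: "pairing (p @ foldr red_Cons u v) r \<Longrightarrow> pairing (p @ u @ v) r"
proof (induction u arbitrary: p)
  case (Cons a u)
  have "pairing (p @ a # foldr red_Cons u v) r"
  proof (cases "\<exists>z. foldr red_Cons u v = opp a # z")
    case True
    then obtain z where z: "foldr red_Cons u v = opp a # z" by blast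
    then show ?thesis
      using pairing_insert[of "p @ z" r p z a] Cons.prems by simp
  next
    case False
    then have "red_Cons a (foldr red_Cons u v) = a # foldr red_Cons u v"
      by (cases "foldr red_Cons u v") auto
    then show ?thesis using Cons.prems by simp
  qed
  then show ?case using Cons.IH[of "p @ [a]"] by simp
qed simp

text \<open>An innermost arc has nothing under it, so it joins neighbours, and its cost is at most
  the total.\<close>

lemma pairing_adjacent:
  "pairing w r \<Longrightarrow> w \<noteq> [] \<Longrightarrow>
     \<exists>u a b v. w = u @ a # b # v \<and> snd a \<noteq> snd b \<and> D (fst a) (fst b) \<le> r"
proof (induction rule: pairing.induct)
  case (pair u r v s a b)
  have nn: "0 \<le> r" "0 \<le> s" "0 \<le> D (fst a) (fst b)"
    using pairing_nonneg pair.hyps by auto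
  show ?case
  proof (cases "u = []")
    case True
    then show ?thesis using pair.hyps(3) nn by (intro exI[of _ "[]"] exI[of _ a] exI[of _ b] exI[of _ v]) auto
  next
    case False
    then obtain u1 c d u2 where "u = u1 @ c # d # u2" "snd c \<noteq> snd d" "D (fst c) (fst d) \<le> r"
      using pair.IH(1) by blast
    moreover have "r \<le> r + s + D (fst a) (fst b)"
      using nn by linarith
    ultimately show ?thesis
      by (intro exI[of _ "a # u1"] exI[of _ c] exI[of _ d] exI[of _ "u2 @ b # v"])
        (auto intro: order_trans)
  qed
qed simp

text \<open>Comparing neighbours is enough: by \<open>pairing_adjacent\<close> it excludes every
  matching of a non-empty factor at cost below \<open>R\<close>.\<close>

definition separated :: "real \<Rightarrow> ('a \<times> bool) list \<Rightarrow> bool" where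
  "separated R g \<longleftrightarrow> successively (\<lambda>a b. snd a \<noteq> snd b \<longrightarrow> R \<le> D (fst a) (fst b)) g"

lemma separated_inverse: "separated R (map opp (rev g)) \<longleftrightarrow> separated R g"
  unfolding separated_def successively_map successively_rev
  by (intro arg_cong[of _ _ "\<lambda>P. successively P g"] ext) (auto simp: D_sym)

lemma not_separated:
  assumes "snd a \<noteq> snd b" "D (fst a) (fst b) < R"
  shows "\<not> separated R (u @ a # b # v)"
  using assms by (auto simp: separated_def successively_append_iff)

text \<open>At a scale below the gaps of \<open>g\<close> no two letters of \<open>g\<^sup>-\<^sup>1\<close> are matched with each other,
  so each of them is matched with a letter of \<open>u\<close>.\<close>

lemma pairing_separated:
  assumes "pairing (u @ map opp (rev (c # g))) r" "separated R (c # g)" "r < R"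
  obtains u1 f u2 s t where "u = u1 @ f # u2" "pairing u1 s" "pairing (u2 @ map opp (rev g)) t"
    "snd f = snd c" "r = s + t + D (fst f) (fst c)"
proof -
  let ?g = "map opp (rev g)"
  obtain w1 f w2 s t where w: "u @ ?g = w1 @ f # w2" "pairing w1 s" "pairing w2 t"
    "snd f \<noteq> snd (opp c)" "r = s + t + D (fst f) (fst (opp c))"
    using pairing_snoc[OF assms(1), of "u @ ?g" "opp c"] by auto
  have nn: "0 \<le> s" "0 \<le> t" "0 \<le> D (fst f) (fst c)" using pairing_nonneg w by auto
  consider (1) u2 where "u = w1 @ f # u2" "w2 = u2 @ ?g"
    | (2) g1 where "?g = g1 @ f # w2"
  proof -
    from w(1) obtain us where "u = w1 @ us \<and> us @ ?g = f # w2 \<or> u @ us = w1 \<and> ?g = us @ f # w2"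
      unfolding append_eq_append_conv2 by blast
    then show thesis
    proof (elim disjE conjE)
      assume "u = w1 @ us" "us @ ?g = f # w2"
      then show thesis using that(1) that(2)[of "[]"] by (cases us) auto
    next
      assume "?g = us @ f # w2"
      then show thesis using that(2) by blast
    qed
  qed
  then show ?thesis
  proof cases
    case 1
    with w show ?thesis by (intro that[of w1 f u2 s t]) auto
  next
    case 2
    \<comment> \<open>The partner \<open>f\<close> would lie in the inverse word. Then either
      \<open>f\<close> and \<open>opp c\<close> are neighbours, or the matched word
      \<open>w2\<close> between them contains a cheap arc between neighbours; both contradict the
      separation.\<close>
    have sep: "separated R (g1 @ f # w2 @ [opp c])"
      using assms(2) separated_inverse[of R "c # g"] 2 by simp
    show ?thesis
    proof (cases "w2 = []")
      case True
      then show ?thesis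
        using sep not_separated[of f "opp c" R g1 "[]"] w nn assms(3) by auto
    next
      case False
      then obtain v1 a b v2 where "w2 = v1 @ a # b # v2" "snd a \<noteq> snd b" "D (fst a) (fst b) \<le> t"
        using pairing_adjacent w(3) by blast
      moreover from this have "D (fst a) (fst b) < R"
        using w(5) nn assms(3) D_nonneg[of "fst f" "fst (opp c)"] by linarith
      ultimately show ?thesis
        using sep not_separated[of a b R "g1 @ f # v1" "v2 @ [opp c]"] by auto
    qed
  qed
qed

text \<open>\<open>pairing_separated\<close> splits off the letters of \<open>g\<close> one by one,
  each with its partner in \<open>u\<close>. The blocks of \<open>u\<close> between these partners
  have even length, so a surplus of at most one letter forces them to be empty.\<close>

lemma pairing_close:
  assumes "pairing (u @ map opp (rev g)) r" "separated R g" "r < R" "length u \<le> length g + 1"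
  shows "list_all2 (\<lambda>f c. snd f = snd c \<and> D (fst f) (fst c) \<le> r) u g"
  using assms
proof (induction g arbitrary: u r)
  case Nil
  then show ?case using pairing_even[of u r] by (cases u) auto
next
  case (Cons c g)
  obtain u1 f u2 s t where u: "u = u1 @ f # u2" "pairing u1 s" "pairing (u2 @ map opp (rev g)) t"
    "snd f = snd c" "r = s + t + D (fst f) (fst c)"
    using pairing_separated[OF Cons.prems(1-3)] by metis
  have nn: "0 \<le> s" "0 \<le> t" "0 \<le> D (fst f) (fst c)" using pairing_nonneg u by auto
  then have "t \<le> r" "D (fst f) (fst c) \<le> r"
    using u(5) D_nonneg[of "fst f" "fst c"] by linarith+
  have "separated R g" using Cons.prems(2) by (cases g) (auto simp: separated_def)
  then have *: "list_all2 (\<lambda>f c. snd f = snd c \<and> D (fst f) (fst c) \<le> t) u2 g"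
    using Cons.IH[OF u(3)] Cons.prems u nn by auto
  then have "length u2 = length g" by (rule list_all2_lengthD)
  then have "length u1 \<le> 1" using u Cons.prems by simp
  then have "u1 = []" using pairing_even[OF u(2)] by (cases u1) auto
  moreover have "list_all2 (\<lambda>f c. snd f = snd c \<and> D (fst f) (fst c) \<le> r) u2 g"
    using * by (rule list_all2_mono) (use \<open>t \<le> r\<close> in auto)
  ultimately show ?case using u \<open>D (fst f) (fst c) \<le> r\<close> by auto
qed

end


subsection \<open>The Graev norm\<close>

text \<open>The norm may vanish away from the identity: \<open>N (h \<otimes> inv g)\<close> is an
  invariant pseudometric, and its topology is a group topology that may fail to be
  Hausdorff.\<close>

locale invariant_norm = group G for G :: "('g, 'm) monoid_scheme" (structure) +
  fixes N :: "'g \<Rightarrow> real"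
  assumes N_one: "N \<one> = 0"
    and N_mult: "x \<in> carrier G \<Longrightarrow> y \<in> carrier G \<Longrightarrow> N (x \<otimes> y) \<le> N x + N y"
    and N_inv: "x \<in> carrier G \<Longrightarrow> N (inv x) \<le> N x"
    and N_conj: "x \<in> carrier G \<Longrightarrow> y \<in> carrier G \<Longrightarrow> N (x \<otimes> y \<otimes> inv x) \<le> N y"
begin

definition norm_topology :: "'g topology" where
  "norm_topology = topology (\<lambda>U. U \<subseteq> carrier G \<and>
     (\<forall>g \<in> U. \<exists>r > 0. \<forall>h \<in> carrier G. N (h \<otimes> inv g) < r \<longrightarrow> h \<in> U))"

lemma openin_norm_topology:
  "openin norm_topology U \<longleftrightarrow> U \<subseteq> carrier G \<and>
     (\<forall>g \<in> U. \<exists>r > 0. \<forall>h \<in> carrier G. N (h \<otimes> inv g) < r \<longrightarrow> h \<in> U)"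
proof -
  have "istopology (\<lambda>U. U \<subseteq> carrier G \<and>
     (\<forall>g \<in> U. \<exists>r > 0. \<forall>h \<in> carrier G. N (h \<otimes> inv g) < r \<longrightarrow> h \<in> U))"
    unfolding istopology_def
  proof (intro conjI allI impI)
    fix A B
    assume A: "A \<subseteq> carrier G \<and> (\<forall>g \<in> A. \<exists>r > 0. \<forall>h \<in> carrier G. N (h \<otimes> inv g) < r \<longrightarrow> h \<in> A)"
      and B: "B \<subseteq> carrier G \<and> (\<forall>g \<in> B. \<exists>r > 0. \<forall>h \<in> carrier G. N (h \<otimes> inv g) < r \<longrightarrow> h \<in> B)"
    show "A \<inter> B \<subseteq> carrier G" using A by blast
    show "\<forall>g \<in> A \<inter> B. \<exists>r > 0. \<forall>h \<in> carrier G. N (h \<otimes> inv g) < r \<longrightarrow> h \<in> A \<inter> B"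
    proof
      fix g assume "g \<in> A \<inter> B"
      then obtain r s where "r > 0" "\<forall>h \<in> carrier G. N (h \<otimes> inv g) < r \<longrightarrow> h \<in> A"
        and "s > 0" "\<forall>h \<in> carrier G. N (h \<otimes> inv g) < s \<longrightarrow> h \<in> B"
        using A B by fast
      then show "\<exists>r > 0. \<forall>h \<in> carrier G. N (h \<otimes> inv g) < r \<longrightarrow> h \<in> A \<inter> B"
        by (intro exI[of _ "min r s"]) auto
    qed
  next
    fix \<K>
    assume *: "\<forall>K \<in> \<K>. K \<subseteq> carrier G \<and> (\<forall>g \<in> K. \<exists>r > 0. \<forall>h \<in> carrier G. N (h \<otimes> inv g) < r \<longrightarrow> h \<in> K)"
    show "\<Union>\<K> \<subseteq> carrier G" using * by blast
    show "\<forall>g \<in> \<Union>\<K>. \<exists>r > 0. \<forall>h \<in> carrier G. N (h \<otimes> inv g) < r \<longrightarrow> h \<in> \<Union>\<K>"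
      using * by (meson Union_iff)
  qed
  then show ?thesis
    unfolding norm_topology_def by (simp add: topology_inverse')
qed

lemma topspace_norm_topology [simp]: "topspace norm_topology = carrier G"
proof -
  have "openin norm_topology (carrier G)"
    unfolding openin_norm_topology by (auto intro: exI[of _ 1])
  then show ?thesis
    using openin_norm_topology[of "topspace norm_topology"] openin_subset by blast
qed

lemma N_dist_tri:
  assumes "x \<in> carrier G" "y \<in> carrier G" "z \<in> carrier G"
  shows "N (x \<otimes> inv z) \<le> N (x \<otimes> inv y) + N (y \<otimes> inv z)"
proof -
  have "(x \<otimes> inv y) \<otimes> (y \<otimes> inv z) = x \<otimes> inv z"
    using assms by (simp add: m_assoc inv_solve_left)
      (simp add: m_assoc[symmetric])
  then show ?thesis using N_mult[of "x \<otimes> inv y" "y \<otimes> inv z"] assms by simp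
qed

lemma N_dist_sym:
  assumes "x \<in> carrier G" "y \<in> carrier G"
  shows "N (x \<otimes> inv y) = N (y \<otimes> inv x)"
proof -
  have "inv (x \<otimes> inv y) = y \<otimes> inv x" "inv (y \<otimes> inv x) = x \<otimes> inv y"
    using assms by (simp_all add: inv_mult_group)
  then show ?thesis
    using N_inv[of "x \<otimes> inv y"] N_inv[of "y \<otimes> inv x"] assms by simp
qed

lemma continuous_map_N:
  assumes g: "g \<in> carrier G"
  shows "continuous_map norm_topology euclideanreal (\<lambda>h. N (h \<otimes> inv g))"
  unfolding continuous_map_def
proof (intro conjI allI impI)
  fix U :: "real set" assume "openin euclidean U"
  then have U: "open U" by simp
  let ?P = "{h \<in> topspace norm_topology. N (h \<otimes> inv g) \<in> U}"
  show "openin norm_topology ?P"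
    unfolding openin_norm_topology
  proof (intro conjI ballI)
    fix h assume h: "h \<in> ?P"
    then obtain e where e: "e > 0" "\<And>t. \<bar>t - N (h \<otimes> inv g)\<bar> < e \<Longrightarrow> t \<in> U"
      using U unfolding open_dist dist_real_def by blast
    show "\<exists>r > 0. \<forall>k \<in> carrier G. N (k \<otimes> inv h) < r \<longrightarrow> k \<in> ?P"
    proof (intro exI[of _ e] conjI ballI impI e(1))
      fix k assume k: "k \<in> carrier G" "N (k \<otimes> inv h) < e"
      have "\<bar>N (k \<otimes> inv g) - N (h \<otimes> inv g)\<bar> < e"
        using N_dist_tri[of k h g] N_dist_tri[of h k g] N_dist_sym[of h k] h g k by auto
      then show "k \<in> ?P" using e(2) k by simp
    qed
  qed auto
qed simp

lemma topological_group_norm_topology: "topological_group G norm_topology"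
  unfolding topological_group_def
proof (intro conjI)
  let ?T = norm_topology
  have ball: "openin ?T {h \<in> topspace ?T. N (h \<otimes> inv g) \<in> {..<r}}" if "g \<in> carrier G" for g r
    by (rule openin_continuous_map_preimage[OF continuous_map_N[OF that]]) simp
  have centre: "N (g \<otimes> inv g) = 0" if "g \<in> carrier G" for g
    using that by (simp add: N_one)
  show "continuous_map (prod_topology ?T ?T) ?T (\<lambda>(x, y). x \<otimes> y)"
    unfolding continuous_map_def
  proof (intro conjI allI impI)
    fix U assume U: "openin ?T U"
    let ?P = "{p \<in> topspace (prod_topology ?T ?T). (\<lambda>(x, y). x \<otimes> y) p \<in> U}"
    show "openin (prod_topology ?T ?T) ?P"
      unfolding openin_prod_topology_alt
    proof (intro allI impI)
      fix x y assume "(x, y) \<in> ?P"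
      then have xy: "x \<in> carrier G" "y \<in> carrier G" "x \<otimes> y \<in> U" by auto
      then obtain r where r: "r > 0" "\<And>h. h \<in> carrier G \<Longrightarrow> N (h \<otimes> inv (x \<otimes> y)) < r \<Longrightarrow> h \<in> U"
        using U unfolding openin_norm_topology by blast
      have "u \<otimes> v \<in> U" if uv: "u \<in> carrier G" "v \<in> carrier G"
        "N (u \<otimes> inv x) < r / 2" "N (v \<otimes> inv y) < r / 2" for u v
      proof -
        \<comment> \<open>The error of the product is the error of \<open>u\<close> times a
          conjugate of the error of \<open>v\<close>; conjugation invariance bounds its norm by the
          sum of the two errors.\<close>
        have "(u \<otimes> v) \<otimes> inv (x \<otimes> y) = (u \<otimes> inv x) \<otimes> (x \<otimes> (v \<otimes> inv y) \<otimes> inv x)"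
        proof -
          have "(u \<otimes> inv x) \<otimes> (x \<otimes> (v \<otimes> inv y) \<otimes> inv x) = u \<otimes> (inv x \<otimes> x) \<otimes> (v \<otimes> inv y) \<otimes> inv x"
            using uv xy by (simp only: m_assoc inv_closed m_closed)
          then show ?thesis using uv xy by (simp add: m_assoc inv_mult_group)
        qed
        moreover have "N ((u \<otimes> inv x) \<otimes> (x \<otimes> (v \<otimes> inv y) \<otimes> inv x)) \<le>
            N (u \<otimes> inv x) + N (x \<otimes> (v \<otimes> inv y) \<otimes> inv x)"
          using uv xy by (intro N_mult) auto
        moreover have "N (x \<otimes> (v \<otimes> inv y) \<otimes> inv x) \<le> N (v \<otimes> inv y)"
          using uv xy by (intro N_conj) auto
        ultimately show ?thesis using uv xy r by auto
      qed
      then show "\<exists>A B. openin ?T A \<and> openin ?T B \<and> x \<in> A \<and> y \<in> B \<and> A \<times> B \<subseteq> ?P"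
        using ball[OF xy(1), of "r/2"] ball[OF xy(2), of "r/2"] xy r(1) centre
        by (intro exI[of _ "{h \<in> topspace ?T. N (h \<otimes> inv x) \<in> {..<r/2}}"]
            exI[of _ "{h \<in> topspace ?T. N (h \<otimes> inv y) \<in> {..<r/2}}"]) auto
    qed
  qed auto
  show "continuous_map ?T ?T (\<lambda>x. inv x)"
    unfolding continuous_map_def
  proof (intro conjI allI impI)
    fix U assume U: "openin ?T U"
    show "openin ?T {x \<in> topspace ?T. inv x \<in> U}"
      unfolding openin_norm_topology
    proof (intro conjI ballI)
      fix x assume "x \<in> {x \<in> topspace ?T. inv x \<in> U}"
      then have x: "x \<in> carrier G" "inv x \<in> U" by auto
      then obtain r where r: "r > 0" "\<And>h. h \<in> carrier G \<Longrightarrow> N (h \<otimes> inv (inv x)) < r \<Longrightarrow> h \<in> U"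
        using U unfolding openin_norm_topology by blast
      have "N (inv h \<otimes> inv (inv x)) \<le> N (h \<otimes> inv x)" if "h \<in> carrier G" for h
      proof -
        have "inv h \<otimes> inv (inv x) = inv x \<otimes> (x \<otimes> inv h) \<otimes> inv (inv x)"
          using x that by (simp add: m_assoc[symmetric])
        also have "N \<dots> \<le> N (x \<otimes> inv h)" using x that by (intro N_conj) auto
        finally show ?thesis using N_dist_sym x that by simp
      qed
      then have "inv h \<in> U" if "h \<in> carrier G" "N (h \<otimes> inv x) < r" for h
        using r(2)[of "inv h"] that by fastforce
      then show "\<exists>r > 0. \<forall>h \<in> carrier G. N (h \<otimes> inv x) < r \<longrightarrow> h \<in> {x \<in> topspace ?T. inv x \<in> U}"
        using r(1) by (intro exI[of _ r]) auto
    qed auto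
  qed auto
qed (auto simp: is_group)

end

context pseudometric
begin

text \<open>The cap 1 gives a value to words that have no matching, such as those of odd length.
  Below 1 the norm sees matchings only.\<close>

definition graev :: "('a \<times> bool) list \<Rightarrow> real" where
  "graev g = Inf (insert 1 {r. pairing g r})"

lemma graev_less_iff: "graev g < e \<longleftrightarrow> 1 < e \<or> (\<exists>r. pairing g r \<and> r < e)"
proof -
  have "bdd_below (insert 1 {r. pairing g r})"
    by (rule bdd_belowI[of _ 0]) (auto dest: pairing_nonneg)
  then show ?thesis unfolding graev_def by (subst cInf_less_iff) auto
qed

lemma graev_nonneg: "0 \<le> graev g"
  unfolding graev_def by (rule cInf_greatest) (auto dest: pairing_nonneg)

lemma graev_le:
  assumes "\<And>r. pairing g r \<Longrightarrow> \<exists>s \<le> r. pairing h s"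
  shows "graev h \<le> graev g"
proof (rule dense_ge)
  fix e assume "graev g < e"
  then have "1 < e \<or> (\<exists>s. pairing h s \<and> s < e)"
    unfolding graev_less_iff using assms by (meson le_less_trans)
  then show "graev h \<le> e" using graev_less_iff[of h e] by simp
qed

lemma graev_mult: "graev (foldr red_Cons x y) \<le> graev x + graev y"
proof (rule field_le_epsilon)
  fix e :: real assume "0 < e"
  then have x: "graev x < graev x + e / 2" and y: "graev y < graev y + e / 2" by auto
  have "graev (foldr red_Cons x y) < graev x + graev y + e"
  proof (cases "1 < graev x + e / 2 \<or> 1 < graev y + e / 2")
    case True
    then show ?thesis
      unfolding graev_less_iff[of "foldr red_Cons x y"]
      using graev_nonneg[of x] graev_nonneg[of y] \<open>0 < e\<close> by linarith
  next
    case False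
    then obtain r s where rs: "pairing x r" "r < graev x + e / 2" "pairing y s" "s < graev y + e / 2"
      using x y unfolding graev_less_iff by blast
    obtain t where "t \<le> r + s" "pairing (foldr red_Cons x y) t"
      using pairing_reduce[of "[]" x y "r + s"] pairing_append rs by auto
    then show ?thesis
      unfolding graev_less_iff[of "foldr red_Cons x y"] using rs by (intro disjI2 exI[of _ t]) auto
  qed
  then show "graev (foldr red_Cons x y) \<le> graev x + graev y + e" by simp
qed

text \<open>The axioms mirror operations on matchings: concatenation for products, reversal for
  inverses, nesting for conjugates, each followed by a reduction that does not raise the
  cost.\<close>

lemma invariant_norm_graev: "invariant_norm (free_group S) graev"
proof -
  let ?G = "free_group S"
  interpret group ?G by (rule group_free_group)
  have mult: "x \<otimes>\<^bsub>?G\<^esub> y = foldr red_Cons x y" for x y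
    by (simp add: free_group_def)
  show ?thesis
  proof unfold_locales
    have "graev [] \<le> e" if "0 < e" for e
      using graev_less_iff[of "[]" e] pairing.Nil that by (metis less_imp_le)
    then have "graev [] \<le> 0" by (rule dense_ge)
    then show "graev \<one>\<^bsub>?G\<^esub> = 0" using graev_nonneg[of "[]"] by (simp add: free_group_def)
  next
    fix x y assume "x \<in> carrier ?G" "y \<in> carrier ?G"
    then show "graev (x \<otimes>\<^bsub>?G\<^esub> y) \<le> graev x + graev y" by (simp add: mult graev_mult)
  next
    fix x assume "x \<in> carrier ?G"
    then show "graev (inv\<^bsub>?G\<^esub> x) \<le> graev x"
      by (auto simp: inv_free_group intro!: graev_le dest: pairing_inverse)
  next
    fix x y assume xy: "x \<in> carrier ?G" "y \<in> carrier ?G"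
    have "x \<otimes>\<^bsub>?G\<^esub> y \<otimes>\<^bsub>?G\<^esub> inv\<^bsub>?G\<^esub> x = foldr red_Cons (x @ y) (map opp (rev x))"
      using xy by (simp only: m_assoc inv_closed m_closed) (simp add: mult inv_free_group)
    moreover have "\<exists>s \<le> r. pairing (foldr red_Cons (x @ y) (map opp (rev x))) s" if "pairing y r" for r
      using pairing_reduce[of "[]" "x @ y" "map opp (rev x)" r] pairing_conjugate[OF that, of x] by simp
    ultimately show "graev (x \<otimes>\<^bsub>?G\<^esub> y \<otimes>\<^bsub>?G\<^esub> inv\<^bsub>?G\<^esub> x) \<le> graev y"
      by (simp add: graev_le)
  qed
qed

lemma graev_quotient_less:
  assumes "g \<in> carrier (free_group S)" "graev (w \<otimes>\<^bsub>free_group S\<^esub> inv\<^bsub>free_group S\<^esub> g) < r" "r \<le> 1"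
  obtains s where "pairing (w @ map opp (rev g)) s" "s < r"
proof -
  obtain s where "pairing (foldr red_Cons w (map opp (rev g))) s" "s < r"
    using assms unfolding graev_less_iff by (auto simp: inv_free_group) (auto simp: free_group_def)
  then show ?thesis using pairing_expand[of "[]"] that by auto
qed

text \<open>The norm topology of \<open>graev\<close> is a group topology, and the inclusion of
  \<open>X\<close> is continuous into it because \<open>[(y, True), (x, False)]\<close> is matched
  at cost \<open>D y x\<close>. The free topology is finer than every such topology.\<close>

lemma continuous_map_graev:
  assumes cont: "\<And>x r. x \<in> topspace X \<Longrightarrow> 0 < r \<Longrightarrow> \<exists>U. openin X U \<and> x \<in> U \<and> (\<forall>y \<in> U. D x y < r)"
    and g: "g \<in> carrier (free_group (topspace X))"
  shows "continuous_map (free_group_topology X) euclideanreal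
           (\<lambda>w. graev (w \<otimes>\<^bsub>free_group (topspace X)\<^esub> inv\<^bsub>free_group (topspace X)\<^esub> g))"
proof -
  let ?G = "free_group (topspace X)"
  interpret N: invariant_norm ?G graev by (rule invariant_norm_graev)
  have "continuous_map X N.norm_topology free_gen"
    unfolding continuous_map_def
  proof (intro conjI allI impI)
    fix U assume U: "openin N.norm_topology U"
    show "openin X {x \<in> topspace X. free_gen x \<in> U}"
    proof (subst openin_subopen, intro ballI)
      fix x assume x: "x \<in> {x \<in> topspace X. free_gen x \<in> U}"
      then obtain r where r: "r > 0"
        "\<And>h. h \<in> carrier ?G \<Longrightarrow> graev (h \<otimes>\<^bsub>?G\<^esub> inv\<^bsub>?G\<^esub> free_gen x) < r \<Longrightarrow> h \<in> U"
        using U unfolding N.openin_norm_topology by blast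
      obtain V where V: "openin X V" "x \<in> V" "\<forall>y \<in> V. D x y < r"
        using cont r(1) x by blast
      have "free_gen y \<in> U" if y: "y \<in> V" "y \<in> topspace X" for y
      proof (rule r(2))
        show "free_gen y \<in> carrier ?G" using y by (simp add: free_gen_closed)
        have "free_gen y \<otimes>\<^bsub>?G\<^esub> inv\<^bsub>?G\<^esub> free_gen x = foldr red_Cons [(y, True)] [(x, False)]"
          using x free_gen_closed[of x "topspace X"] by (simp add: inv_free_group)
            (simp add: free_group_def free_gen_def opp_def)
        moreover have "pairing [(y, True), (x, False)] (D y x)"
          using pairing.pair[OF pairing.Nil pairing.Nil, of "(y, True)" "(x, False)"] by simp
        then obtain s where "s \<le> D y x" "pairing (foldr red_Cons [(y, True)] [(x, False)]) s"
          using pairing_reduce[of "[]" "[(y, True)]" "[(x, False)]"] by auto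
        moreover have "D y x < r" using V(3) y(1) D_sym[of x y] by metis
        ultimately show "graev (free_gen y \<otimes>\<^bsub>?G\<^esub> inv\<^bsub>?G\<^esub> free_gen x) < r"
          unfolding graev_less_iff by fastforce
      qed
      then show "\<exists>T. openin X T \<and> x \<in> T \<and> T \<subseteq> {x \<in> topspace X. free_gen x \<in> U}"
        using V openin_subset by blast
    qed
  qed (auto simp: free_gen_closed)
  with N.topological_group_norm_topology
  have "continuous_map (free_group_topology X) N.norm_topology id"
    by (rule free_group_topology_finest)
  from continuous_map_compose[OF this N.continuous_map_N[OF g]] show ?thesis
    by (simp add: o_def)
qed

end


subsection \<open>Neighbourhoods of the diagonal\<close>

context Metric_space
begin

lemma openin_mball_subset:
  assumes "openin mtopology U" "x \<in> U"
  obtains e where "e > 0" "mball x e \<subseteq> U"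
  using assms unfolding openin_mtopology by metis

lemma openin_prod_mball_subset:
  assumes "openin (prod_topology Y mtopology) N" "(y, x) \<in> N"
  obtains U e where "openin Y U" "y \<in> U" "e > 0" "U \<times> mball x e \<subseteq> N"
proof -
  obtain U W where UW: "openin Y U" "openin mtopology W" "y \<in> U" "x \<in> W" "U \<times> W \<subseteq> N"
    using assms unfolding openin_prod_topology_alt by metis
  then show thesis
    using openin_mball_subset[OF UW(2,4)] that[OF UW(1,3)] by (metis Sigma_mono order.refl order.trans)
qed

text \<open>Around \<open>x\<close> there is a radius \<open>\<delta> x\<close> such that any two
  points within it form a pair in \<open>N\<close>. This radius is positive and 1-Lipschitz, so
  distances can be measured in units of \<open>\<delta>\<close> by a continuous metric; a multiple
  of \<open>d\<close> is added to control the ball around \<open>a\<close>.\<close>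

lemma pseudometric_of_diagonal_neighbourhood:
  assumes N: "openin (prod_topology mtopology mtopology) N" and diag: "\<And>x. x \<in> M \<Longrightarrow> (x, x) \<in> N"
    and V: "openin mtopology V" "a \<in> V"
  obtains D where "pseudometric D"
    and "\<And>x r. x \<in> M \<Longrightarrow> 0 < r \<Longrightarrow> \<exists>U. openin mtopology U \<and> x \<in> U \<and> (\<forall>y \<in> U. D x y < r)"
    and "\<And>x y. x \<in> M \<Longrightarrow> y \<in> M \<Longrightarrow> D x y < 1 \<Longrightarrow> (x, y) \<in> N"
    and "\<And>y. y \<in> M \<Longrightarrow> D a y < 1 \<Longrightarrow> y \<in> V"
proof -
  \<comment> \<open>The extra element 1 keeps the infimum meaningful when no pair lies outside
    \<open>N\<close>.\<close>
  define \<delta> where "\<delta> x = Inf (insert 1 {max (d x u) (d x v) | u v. u \<in> M \<and> v \<in> M \<and> (u, v) \<notin> N})" for x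
  have bdd: "bdd_below (insert 1 {max (d x u) (d x v) | u v. u \<in> M \<and> v \<in> M \<and> (u, v) \<notin> N})" for x
    by (rule bdd_belowI[of _ 0]) (auto simp: le_max_iff_disj)
  have \<delta>_le1: "\<delta> x \<le> 1" for x
    unfolding \<delta>_def by (rule cInf_lower[OF _ bdd]) simp
  have \<delta>_le: "\<delta> x \<le> max (d x u) (d x v)" if "u \<in> M" "v \<in> M" "(u, v) \<notin> N" for x u v
    unfolding \<delta>_def by (rule cInf_lower[OF _ bdd]) (use that in blast)
  have \<delta>_ge: "e \<le> \<delta> x" if "e \<le> 1" "\<And>u v. u \<in> M \<Longrightarrow> v \<in> M \<Longrightarrow> (u, v) \<notin> N \<Longrightarrow> e \<le> max (d x u) (d x v)" for e x
    unfolding \<delta>_def by (rule cInf_greatest) (use that in auto)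
  have \<delta>_lip: "\<delta> x \<le> \<delta> y + d x y" if "x \<in> M" "y \<in> M" for x y
  proof -
    have "\<delta> x - d x y \<le> \<delta> y"
    proof (rule \<delta>_ge)
      show "\<delta> x - d x y \<le> 1" using \<delta>_le1[of x] nonneg[of x y] by linarith
      fix u v assume uv: "u \<in> M" "v \<in> M" "(u, v) \<notin> N"
      then show "\<delta> x - d x y \<le> max (d y u) (d y v)"
        using \<delta>_le[OF uv, of x] triangle[of x y u] triangle[of x y v] that by auto
    qed
    then show ?thesis by simp
  qed
  have \<delta>_pos: "0 < \<delta> x" if x: "x \<in> M" for x
  proof -
    obtain U e' where U: "openin mtopology U" "x \<in> U" and e': "e' > 0" "U \<times> mball x e' \<subseteq> N"
      using openin_prod_mball_subset[OF N diag[OF x]] by metis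
    obtain e where e: "e > 0" "mball x e \<subseteq> U" using openin_mball_subset[OF U] by metis
    have "min 1 (min e e') \<le> \<delta> x"
    proof (rule \<delta>_ge)
      fix u v assume uv: "u \<in> M" "v \<in> M" "(u, v) \<notin> N"
      then have "u \<notin> mball x e \<or> v \<notin> mball x e'" using e e' by blast
      then show "min 1 (min e e') \<le> max (d x u) (d x v)" using uv x by auto
    qed simp
    then show ?thesis using e e' by linarith
  qed
  have \<delta>_N: "(x, y) \<in> N" if "x \<in> M" "y \<in> M" "d x y < \<delta> x" for x y
  proof (rule ccontr)
    assume "(x, y) \<notin> N"
    then show False using \<delta>_le[of x y x] that nonneg[of x y] by (simp add: max_def)
  qed
  have aM: "a \<in> M" using V openin_subset[OF V(1)] by auto
  obtain \<rho> where \<rho>: "\<rho> > 0" "mball a \<rho> \<subseteq> V" using openin_mball_subset[OF V] by metis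
  \<comment> \<open>A \<open>pseudometric\<close> lives on the whole type, so points outside
    \<open>M\<close> are identified with \<open>a\<close>.\<close>
  define \<pi> where "\<pi> x = (if x \<in> M then x else a)" for x
  have \<pi>M [simp]: "\<pi> x \<in> M" for x using aM by (simp add: \<pi>_def)
  \<comment> \<open>\<open>ln (j x y)\<close> is the Gehring-Osgood metric of the 1-Lipschitz function \<open>\<delta>\<close>.\<close>
  define j where "j x y = 1 + d x y / min (\<delta> x) (\<delta> y)" for x y
  have j_ge1: "1 \<le> j x y" if "x \<in> M" "y \<in> M" for x y
    using \<delta>_pos that by (simp add: j_def less_imp_le)
  have j_sym: "j x y = j y x" for x y by (simp add: j_def commute min.commute)
  have j_tri_aux: "j x z \<le> j x y * j y z" if M: "x \<in> M" "y \<in> M" "z \<in> M" and le: "\<delta> x \<le> \<delta> z" for x y z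
  proof -
    have p: "0 < \<delta> x" "0 < \<delta> y" "0 < \<delta> z" using \<delta>_pos M by auto
    have "j x z = 1 + d x z / \<delta> x" using le by (simp add: j_def min_def)
    also have "\<dots> \<le> 1 + (d x y + d y z) / \<delta> x"
      using p triangle M by (simp add: divide_right_mono)
    \<comment> \<open>The factorisation is chosen so that the second denominator is
      \<open>\<delta> x + d x y\<close>, which is at least \<open>\<delta> y\<close> by the
      Lipschitz property.\<close>
    also have "\<dots> = (1 + d x y / \<delta> x) * (1 + d y z / (\<delta> x + d x y))"
    proof -
      have "\<delta> x + d x y > 0" using p nonneg[of x y] by linarith
      then have "1 + d x y / \<delta> x = (\<delta> x + d x y) / \<delta> x"
        "1 + d y z / (\<delta> x + d x y) = (\<delta> x + d x y + d y z) / (\<delta> x + d x y)"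
        "1 + (d x y + d y z) / \<delta> x = (\<delta> x + d x y + d y z) / \<delta> x"
        using p by (simp_all add: add_divide_distrib)
      then show ?thesis using \<open>\<delta> x + d x y > 0\<close> by simp
    qed
    also have "\<dots> \<le> j x y * j y z"
    proof (rule mult_mono)
      show "1 + d x y / \<delta> x \<le> j x y"
        unfolding j_def using p by (auto intro!: divide_left_mono)
      have "min (\<delta> y) (\<delta> z) \<le> \<delta> x + d x y"
        using \<delta>_lip[of y x] M commute[of x y] by linarith
      then show "1 + d y z / (\<delta> x + d x y) \<le> j y z"
        unfolding j_def using p nonneg[of x y] by (auto intro!: divide_left_mono mult_pos_pos)
      show "0 \<le> 1 + d y z / (\<delta> x + d x y)" using p by auto
      show "0 \<le> j x y" using j_ge1[OF M(1,2)] by simp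
    qed
    finally show ?thesis .
  qed
  have j_tri: "j x z \<le> j x y * j y z" if M: "x \<in> M" "y \<in> M" "z \<in> M" for x y z
  proof (cases "\<delta> x \<le> \<delta> z")
    case False
    then show ?thesis using j_tri_aux[of z y x] M by (simp add: j_sym mult.commute)
  qed (use j_tri_aux M in auto)
  \<comment> \<open>Base 2 turns \<open>D x y < 1\<close> into \<open>j x y < 2\<close>, that is,
    \<open>d x y\<close> below both radii; the second summand turns \<open>D a y < 1\<close> into
    \<open>d a y < \<rho>\<close>.\<close>
  define D where "D x y = log 2 (j (\<pi> x) (\<pi> y)) + d (\<pi> x) (\<pi> y) / \<rho>" for x y
  have log_nn: "0 \<le> log 2 (j (\<pi> x) (\<pi> y))" for x y
    using j_ge1[OF \<pi>M[of x] \<pi>M[of y]] by (simp add: zero_le_log_cancel_iff)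
  show ?thesis
  proof (rule that)
    show "pseudometric D"
    proof
      fix x y z
      show "D x x = 0" by (simp add: D_def j_def)
      show "D x y = D y x" by (simp add: D_def j_sym commute)
      have "log 2 (j (\<pi> x) (\<pi> z)) \<le> log 2 (j (\<pi> x) (\<pi> y) * j (\<pi> y) (\<pi> z))"
        using j_tri[of "\<pi> x" "\<pi> y" "\<pi> z"] j_ge1[of "\<pi> x" "\<pi> z"] by simp
      also have "\<dots> = log 2 (j (\<pi> x) (\<pi> y)) + log 2 (j (\<pi> y) (\<pi> z))"
        using j_ge1[of "\<pi> x" "\<pi> y"] j_ge1[of "\<pi> y" "\<pi> z"] by (subst log_mult) auto
      finally have "log 2 (j (\<pi> x) (\<pi> z)) \<le> \<dots>" .
      moreover have "d (\<pi> x) (\<pi> z) / \<rho> \<le> d (\<pi> x) (\<pi> y) / \<rho> + d (\<pi> y) (\<pi> z) / \<rho>"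
        using triangle[of "\<pi> x" "\<pi> y" "\<pi> z"] \<rho> by (simp add: add_divide_distrib[symmetric] divide_right_mono)
      ultimately show "D x z \<le> D x y + D y z" by (simp add: D_def)
    qed
  next
    fix x y assume xy: "x \<in> M" "y \<in> M" "D x y < 1"
    have "0 \<le> d x y / \<rho>" using \<rho> by simp
    moreover have "D x y = log 2 (j x y) + d x y / \<rho>" using xy by (simp add: D_def \<pi>_def)
    ultimately have "log 2 (j x y) < 1" using xy(3) by linarith
    then have "j x y < 2" using j_ge1[of x y] xy by (subst (asm) log_less_iff) auto
    then have "d x y < \<delta> x" using \<delta>_pos xy by (simp add: j_def)
    then show "(x, y) \<in> N" using \<delta>_N xy by blast
  next
    fix y assume y: "y \<in> M" "D a y < 1"
    have "D a y = log 2 (j (\<pi> a) (\<pi> y)) + d a y / \<rho>" using y aM by (simp add: D_def \<pi>_def)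
    then have "d a y / \<rho> < 1" using log_nn[of a y] y(2) by linarith
    then show "y \<in> V" using y \<rho> aM by auto
  next
    fix x and r :: real assume x: "x \<in> M" and r: "0 < r"
    \<comment> \<open>Within distance \<open>\<delta> x / 2\<close> of \<open>x\<close> both radii
      are at least \<open>\<delta> x / 2\<close>, so \<open>ln (1 + t) \<le> t\<close> makes
      \<open>c\<close> a Lipschitz constant of \<open>D x\<close> at \<open>x\<close>.\<close>
    define c where "c = 2 / (\<delta> x * ln 2) + 1 / \<rho>"
    have c: "0 < c" using \<rho> \<delta>_pos[OF x] by (simp add: c_def add_pos_pos)
    define t where "t = min (\<delta> x / 2) (r / c)"
    have t: "0 < t" using c r \<delta>_pos[OF x] by (simp add: t_def)
    have "D x y < r" if y: "y \<in> mball x t" for y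
    proof -
      have yM: "y \<in> M" and dxy: "d x y < \<delta> x / 2" "d x y < r / c"
        using y by (auto simp: t_def)
      have \<delta>: "\<delta> x / 2 \<le> min (\<delta> x) (\<delta> y)"
        using \<delta>_lip[OF x yM] dxy \<delta>_pos[OF x] by auto
      have "log 2 (j x y) = ln (j x y) / ln 2" by (simp add: log_def)
      also have "\<dots> \<le> (d x y / min (\<delta> x) (\<delta> y)) / ln 2"
        unfolding j_def using \<delta> \<delta>_pos[OF x]
        by (intro divide_right_mono ln_add_one_self_le_self) auto
      also have "\<dots> \<le> (d x y / (\<delta> x / 2)) / ln 2"
        using \<delta> \<delta>_pos[OF x] \<delta>_pos[OF yM] by (intro divide_right_mono divide_left_mono) auto
      finally have "D x y \<le> d x y * c"
        using x yM by (simp add: D_def \<pi>_def c_def algebra_simps)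
      also have "\<dots> < r" using dxy c by (simp add: pos_less_divide_eq)
      finally show ?thesis .
    qed
    then show "\<exists>U. openin mtopology U \<and> x \<in> U \<and> (\<forall>y \<in> U. D x y < r)"
      using t x by (intro exI[of _ "mball x t"]) auto
  qed
qed

end

text \<open>One \<open>V\<close> has to serve all \<open>y\<close> at once, and this is where the
  positive direction uses its topological condition. The tube lemma needs a compact factor: a
  compact neighbourhood of \<open>a\<close>, or else the diagonal over the non-isolated points. For
  isolated \<open>y\<close> the set \<open>{y} \<times> {y}\<close> is itself open. Then
  \<open>N\<close> is the union of all admissible \<open>W\<close>.\<close>

lemma neighbourhood_of_fibre_diagonal:
  assumes X: "Hausdorff_space X"
    and *: "locally_compact_space X \<or> compactin X (non_isolated_points X)"
    and A: "openin (prod_topology X (prod_topology X X)) A"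
    and S: "openin X S" "a \<in> S" "\<And>v y. v \<in> S \<Longrightarrow> y \<in> topspace X \<Longrightarrow> (v, y, y) \<in> A"
  obtains V N where "openin X V" "a \<in> V" "V \<subseteq> S" "openin (prod_topology X X) N"
    "\<And>y. y \<in> topspace X \<Longrightarrow> (y, y) \<in> N" "V \<times> N \<subseteq> A"
proof -
  note result = that
  have suff: thesis
    if V: "openin X V" "a \<in> V" "V \<subseteq> S"
      and ex: "\<And>y. y \<in> topspace X \<Longrightarrow> \<exists>W. openin (prod_topology X X) W \<and> (y, y) \<in> W \<and> V \<times> W \<subseteq> A" for V
  proof (rule result[OF V])
    let ?N = "\<Union>{W. openin (prod_topology X X) W \<and> V \<times> W \<subseteq> A}"
    show "openin (prod_topology X X) ?N" by blast
    show "\<And>y. y \<in> topspace X \<Longrightarrow> (y, y) \<in> ?N" using ex by blast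
    show "V \<times> ?N \<subseteq> A" by blast
  qed
  from * show thesis
  proof
    assume "locally_compact_space X"
    then have "neighbourhood_base_of (compactin X) X"
      using X locally_compact_space_neighbourhood_base by blast
    then obtain V C where V: "openin X V" "compactin X C" "a \<in> V" "V \<subseteq> C" "C \<subseteq> S"
      using S unfolding neighbourhood_base_of by metis
    show thesis
    proof (rule suff[of V])
      fix y assume y: "y \<in> topspace X"
      then have "compactin (prod_topology X X) {(y, y)}" by simp
      moreover have "C \<times> {(y, y)} \<subseteq> A" using S(3) V y by auto
      ultimately obtain U W where "openin X U" "openin (prod_topology X X) W" "C \<subseteq> U" "{(y, y)} \<subseteq> W" "U \<times> W \<subseteq> A"
        using Wallace_theorem_prod_topology[OF V(2) _ A] by metis
      then show "\<exists>W. openin (prod_topology X X) W \<and> (y, y) \<in> W \<and> V \<times> W \<subseteq> A"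
        using V by (intro exI[of _ W]) auto
    qed (use V in auto)
  next
    assume NI: "compactin X (non_isolated_points X)"
    let ?d = "\<lambda>y. (y, y)"
    have "continuous_map X (prod_topology X X) ?d"
      by (simp add: continuous_map_pairwise o_def)
    from image_compactin[OF NI this]
    have K: "compactin (prod_topology X X) (?d ` non_isolated_points X)" .
    have a: "compactin X {a}" using S openin_subset[OF S(1)] by auto
    have sub: "{a} \<times> ?d ` non_isolated_points X \<subseteq> A"
      using S by (auto simp: non_isolated_points_def)
    obtain U W where UW: "openin X U" "openin (prod_topology X X) W" "{a} \<subseteq> U"
      "?d ` non_isolated_points X \<subseteq> W" "U \<times> W \<subseteq> A"
      by (rule Wallace_theorem_prod_topology[OF a K A sub])
    show thesis
    proof (rule suff[of "U \<inter> S"])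
      fix y assume y: "y \<in> topspace X"
      show "\<exists>W. openin (prod_topology X X) W \<and> (y, y) \<in> W \<and> (U \<inter> S) \<times> W \<subseteq> A"
      proof (cases "y \<in> non_isolated_points X")
        case True
        then show ?thesis using UW by (intro exI[of _ W]) auto
      next
        case False
        then have "openin X {y}" using y by (simp add: non_isolated_points_def)
        then have "openin (prod_topology X X) ({y} \<times> {y})" by (metis openin_prod_Times_iff)
        then show ?thesis using S(3) y by (intro exI[of _ "{y} \<times> {y}"]) auto
      qed
    qed (use UW S in auto)
  qed
qed

section \<open>Word maps from powers of X into the free group\<close>

definition word2 :: "bool \<Rightarrow> bool \<Rightarrow> 'a \<times> 'a \<Rightarrow> ('a \<times> bool) list" where
  "word2 s t = (\<lambda>(x, y). red_Cons (x, s) [(y, t)])"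

text \<open>\<open>red_Cons\<close> carries out the cancellations, so these maps are products in the
  free group and are continuous on all of \<open>X^2\<close> and \<open>X^3\<close>, including the
  points where letters cancel.\<close>

definition word3 :: "bool \<Rightarrow> bool \<Rightarrow> bool \<Rightarrow> 'a \<times> 'a \<times> 'a \<Rightarrow> ('a \<times> bool) list" where
  "word3 s t u = (\<lambda>(x, p). red_Cons (x, s) (word2 t u p))"

lemma length_red_Cons: "length (red_Cons a w) \<le> Suc (length w)"
  by (cases w) auto

lemma topspace_free_group_upto:
  "topspace (free_group_upto n X) = {w \<in> carrier (free_group (topspace X)). length w \<le> n}"
  by (auto simp: free_group_upto_def topspace_free_group_topology)

lemma continuous_map_letter: "continuous_map X (free_group_topology X) (\<lambda>x. [(x, s)])"
proof (cases s)
  case True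
  then show ?thesis using continuous_map_free_gen[of X] by (simp add: free_gen_def[abs_def])
next
  case False
  let ?F = "free_group_topology X" and ?G = "free_group (topspace X)"
  have "continuous_map ?F ?F (\<lambda>x. inv\<^bsub>?G\<^esub> x)"
    using topological_group_free_group_topology by (auto simp: topological_group_def)
  from continuous_map_compose[OF continuous_map_free_gen this] show ?thesis
  proof (rule continuous_map_eq)
    fix x assume "x \<in> topspace X"
    then have "free_gen x \<in> carrier ?G" by (rule free_gen_closed)
    then show "((\<lambda>x. inv\<^bsub>?G\<^esub> x) \<circ> free_gen) x = [(x, s)]"
      using False by (simp add: inv_free_group) (simp add: free_gen_def opp_def)
  qed
qed

lemma continuous_map_red_Cons:
  assumes "continuous_map Y X f" "continuous_map Y (free_group_topology X) h"
  shows "continuous_map Y (free_group_topology X) (\<lambda>y. red_Cons (f y, s) (h y))"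
proof -
  let ?F = "free_group_topology X" and ?G = "free_group (topspace X)"
  have "continuous_map Y ?F (\<lambda>y. [(f y, s)])"
    using continuous_map_compose[OF assms(1) continuous_map_letter[of X s]] by (simp add: o_def)
  then have "continuous_map Y (prod_topology ?F ?F) (\<lambda>y. ([(f y, s)], h y))"
    using assms(2) by (simp add: continuous_map_pairwise o_def)
  moreover have "continuous_map (prod_topology ?F ?F) ?F (\<lambda>(x, y). x \<otimes>\<^bsub>?G\<^esub> y)"
    using topological_group_free_group_topology by (auto simp: topological_group_def)
  ultimately have "continuous_map Y ?F ((\<lambda>(x, y). x \<otimes>\<^bsub>?G\<^esub> y) \<circ> (\<lambda>y. ([(f y, s)], h y)))"
    by (rule continuous_map_compose)
  then show ?thesis by (simp add: o_def free_group_def)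
qed

lemma continuous_map_free_group_upto:
  "continuous_map Y (free_group_upto n X) h \<longleftrightarrow>
     continuous_map Y (free_group_topology X) h \<and> (\<forall>y \<in> topspace Y. length (h y) \<le> n)"
  unfolding free_group_upto_def continuous_map_in_subtopology
  using topspace_free_group_topology[of X]
  by (auto simp: image_subset_iff continuous_map_def Pi_iff)

lemma continuous_map_word2: "continuous_map (prod_topology X X) (free_group_topology X) (word2 s t)"
proof -
  have "continuous_map (prod_topology X X) (free_group_topology X) (\<lambda>p. [(snd p, t)])"
    using continuous_map_compose[OF continuous_map_snd continuous_map_letter] by (fastforce simp: o_def)
  from continuous_map_red_Cons[OF continuous_map_fst this, of s] show ?thesis
    by (simp add: word2_def case_prod_unfold)
qed

lemma continuous_map_word3:
  "continuous_map (prod_topology X (prod_topology X X)) (free_group_topology X) (word3 s t u)"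
proof -
  have "continuous_map (prod_topology X (prod_topology X X)) (free_group_topology X)
          (\<lambda>p. word2 t u (snd p))"
    using continuous_map_compose[OF continuous_map_snd continuous_map_word2] by (fastforce simp: o_def)
  from continuous_map_red_Cons[OF continuous_map_fst this, of s] show ?thesis
    by (simp add: word3_def case_prod_unfold)
qed

lemma length_word2: "length (word2 s t p) \<le> 2"
  using length_red_Cons by (auto simp: word2_def case_prod_unfold)

lemma length_word3: "length (word3 s t u p) \<le> 3"
  using length_red_Cons[of "(fst p, s)" "word2 t u (snd p)"] length_word2[of t u "snd p"]
  by (auto simp: word3_def case_prod_unfold)


subsection \<open>Graev neighbourhoods in words of length at most 3\<close>

context Metric_space
begin

lemma openin_prod_mball_pair:
  assumes "openin (prod_topology mtopology mtopology) A" "(x, y) \<in> A"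
  obtains e where "e > 0" "\<And>x' y'. x' \<in> mball x e \<Longrightarrow> y' \<in> mball y e \<Longrightarrow> (x', y') \<in> A"
proof -
  obtain U e where U: "openin mtopology U" "x \<in> U" and e: "e > 0" "U \<times> mball y e \<subseteq> A"
    using openin_prod_mball_subset[OF assms] by metis
  obtain e' where e': "e' > 0" "mball x e' \<subseteq> U"
    using openin_mball_subset[OF U] by metis
  show thesis
  proof (rule that[of "min e e'"])
    fix x' y' assume "x' \<in> mball x (min e e')" "y' \<in> mball y (min e e')"
    then have "x' \<in> U" "y' \<in> mball y e" using e' by auto
    then show "(x', y') \<in> A" using e by blast
  qed (use e e' in simp)
qed

lemma openin_prod_mball_triple:
  assumes "openin (prod_topology mtopology (prod_topology mtopology mtopology)) A" "(x, y, z) \<in> A"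
  obtains e where "e > 0"
    "\<And>x' y' z'. x' \<in> mball x e \<Longrightarrow> y' \<in> mball y e \<Longrightarrow> z' \<in> mball z e \<Longrightarrow> (x', y', z') \<in> A"
proof -
  obtain U W where U: "openin mtopology U" "x \<in> U" and W: "openin (prod_topology mtopology mtopology) W"
    "(y, z) \<in> W" and UW: "U \<times> W \<subseteq> A"
    using assms unfolding openin_prod_topology_alt[of mtopology "prod_topology mtopology mtopology"] by metis
  obtain e where e: "e > 0" "mball x e \<subseteq> U"
    using openin_mball_subset[OF U] by metis
  obtain e' where e': "e' > 0" "\<And>y' z'. y' \<in> mball y e' \<Longrightarrow> z' \<in> mball z e' \<Longrightarrow> (y', z') \<in> W"
    using openin_prod_mball_pair[OF W] by metis
  show thesis
  proof (rule that[of "min e e'"])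
    fix x' y' z' assume "x' \<in> mball x (min e e')" "y' \<in> mball y (min e e')" "z' \<in> mball z (min e e')"
    then have "x' \<in> U" "(y', z') \<in> W" using e e' by auto
    then show "(x', y', z') \<in> A" using UW by blast
  qed (use e e' in simp)
qed

lemma pseudometric_of_scale:
  assumes "0 < e"
  obtains D where "pseudometric D"
    and "\<And>x r. x \<in> M \<Longrightarrow> 0 < r \<Longrightarrow> \<exists>U. openin mtopology U \<and> x \<in> U \<and> (\<forall>y \<in> U. D x y < r)"
    and "\<And>x y. x \<in> M \<Longrightarrow> y \<in> M \<Longrightarrow> D x y < 1 \<Longrightarrow> d x y < e"
proof (cases "M = {}")
  case True
  have "pseudometric (\<lambda>(x::'a) (y::'a). 0)" by unfold_locales auto
  then show thesis by (rule that) (use True in auto)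
next
  case False
  then obtain a where a: "a \<in> M" by blast
  \<comment> \<open>The uniform entourage of size \<open>e\<close> is a neighbourhood of the
    diagonal; taking the whole of \<open>M\<close> as the neighbourhood of \<open>a\<close> makes
    the remaining conclusion trivial.\<close>
  let ?N = "{(x, y). x \<in> M \<and> y \<in> M \<and> d x y < e}"
  have N: "openin (prod_topology mtopology mtopology) ?N"
    unfolding openin_prod_topology_alt
  proof (intro allI impI)
    fix x y assume "(x, y) \<in> ?N"
    then have xy: "x \<in> M" "y \<in> M" "d x y < e" by auto
    define t where "t = (e - d x y) / 2"
    have "d u v < e" if "u \<in> mball x t" "v \<in> mball y t" for u v
      using that triangle[of u x v] triangle[of x y v] commute[of u x] by (auto simp: t_def)
    then show "\<exists>U V. openin mtopology U \<and> openin mtopology V \<and> x \<in> U \<and> y \<in> V \<and> U \<times> V \<subseteq> ?N"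
      using xy by (intro exI[of _ "mball x t"] exI[of _ "mball y t"]) (auto simp: t_def)
  qed
  have "openin mtopology M" using openin_topspace[of mtopology] by simp
  then obtain D where "pseudometric D"
    "\<And>x r. x \<in> M \<Longrightarrow> 0 < r \<Longrightarrow> \<exists>U. openin mtopology U \<and> x \<in> U \<and> (\<forall>y \<in> U. D x y < r)"
    "\<And>x y. x \<in> M \<Longrightarrow> y \<in> M \<Longrightarrow> D x y < 1 \<Longrightarrow> (x, y) \<in> ?N"
    using pseudometric_of_diagonal_neighbourhood[OF N _ _ a] assms by auto
  then show thesis using that by blast
qed

lemma finite_scale:
  assumes "finite Q" "Q \<subseteq> M"
  obtains e where "e > 0" "\<And>x y. x \<in> Q \<Longrightarrow> y \<in> Q \<Longrightarrow> d x y < e \<Longrightarrow> x = y"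
proof -
  let ?E = "insert 1 ((\<lambda>(x, y). d x y) ` {p \<in> Q \<times> Q. fst p \<noteq> snd p})"
  have fin: "finite ?E" using assms(1) by simp
  have "0 < Min ?E" using fin assms(2) by (auto intro!: mdist_pos_less)
  moreover have "x = y" if "x \<in> Q" "y \<in> Q" "d x y < Min ?E" for x y
  proof (rule ccontr)
    assume "x \<noteq> y"
    then have "Min ?E \<le> d x y" using that fin by (intro Min_le) force+
    then show False using that by simp
  qed
  ultimately show thesis using that by blast
qed

end

text \<open>Neighbours of opposite sign in a reduced word have different base points, and different
  base points are at least \<open>R\<close> apart.\<close>

lemma (in pseudometric) separated_of_reduced:
  assumes "reduced g" "\<And>x y. x \<in> fst ` set g \<Longrightarrow> y \<in> fst ` set g \<Longrightarrow> D x y < R \<Longrightarrow> x = y"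
  shows "separated R g"
proof -
  have "snd a \<noteq> snd b \<longrightarrow> R \<le> D (fst a) (fst b)"
    if "a \<in> set g" "b \<in> set g" "b \<noteq> opp a" for a b
  proof
    assume "snd a \<noteq> snd b"
    then have "fst a \<noteq> fst b" using that by (auto simp: opp_def prod_eq_iff)
    then show "R \<le> D (fst a) (fst b)" using assms(2)[of "fst a" "fst b"] that by force
  qed
  then show ?thesis
    using assms(1) unfolding reduced_def separated_def by (auto elim!: successively_mono)
qed

lemma (in pseudometric) pairing_pair: "pairing [a, b] r \<Longrightarrow> snd a \<noteq> snd b \<and> r = D (fst a) (fst b)"
proof -
  assume "pairing [a, b] r"
  then obtain u c v s t where *: "[b] = u @ c # v" "pairing u s" "pairing v t" "snd a \<noteq> snd c"
    "r = s + t + D (fst a) (fst c)"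
    by (rule pairing_Cons)
  then have "u = []" "v = []" "c = b" by (auto simp: Cons_eq_append_conv)
  moreover have "s = 0" "t = 0" using * \<open>u = []\<close> \<open>v = []\<close> by (auto elim: pairing.cases)
  ultimately show ?thesis using * by simp
qed

lemma word2_reduced: "reduced [a, b] \<Longrightarrow> word2 (snd a) (snd b) (fst a, fst b) = [a, b]"
  by (simp add: word2_def reduced_def)

lemma word3_reduced:
  "reduced [a, b, c] \<Longrightarrow> word3 (snd a) (snd b) (snd c) (fst a, fst b, fst c) = [a, b, c]"
  by (simp add: word3_def word2_def reduced_def)

lemma word3_cancel_right: "word3 s t (\<not> t) (x, y, y) = [(x, s)]"
  by (simp add: word3_def word2_def opp_def)

lemma word3_cancel_left: "word3 t (\<not> t) s (y, y, x) = [(x, s)]"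
  by (auto simp: word3_def word2_def opp_def)

lemma word2_cancel: "word2 t (\<not> t) (y, y) = []"
  by (simp add: word2_def opp_def)

lemma list_length_le3_cases:
  assumes "length w \<le> 3"
  obtains "w = []" | a where "w = [a]" | a b where "w = [a, b]" | a b c where "w = [a, b, c]"
proof (cases w)
  case (Cons a u)
  show thesis
  proof (cases u)
    case (Cons b v)
    show thesis
      using assms that \<open>w = a # u\<close> \<open>u = b # v\<close> by (cases v) auto
  qed (use that \<open>w = a # u\<close> in auto)
qed (use that in auto)

text \<open>The Graev unit ball around \<open>g\<close> is put inside \<open>S\<close> by cases on
  the length of \<open>g\<close>. For length at least 2 closeness is letterwise. For the empty word
  the ball contains short pairs, and for a single letter also triples made of a nearby letter and a
  short pair.\<close>

lemma graev_neighbourhood: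
  fixes X :: "'a topology"
  defines "G \<equiv> free_group (topspace X)"
  assumes X: "metrizable_space X"
    and cond: "locally_compact_space X \<or> compactin X (non_isolated_points X)"
    and o1: "\<And>s. openin X {x \<in> topspace X. [(x, s)] \<in> S}"
    and o2: "\<And>s t. openin (prod_topology X X) {p \<in> topspace (prod_topology X X). word2 s t p \<in> S}"
    and o3: "\<And>s t u. openin (prod_topology X (prod_topology X X))
      {p \<in> topspace (prod_topology X (prod_topology X X)). word3 s t u p \<in> S}"
    and g: "g \<in> topspace (free_group_upto 3 X)" "g \<in> S"
  obtains D where "pseudometric D"
    and "\<And>x r. x \<in> topspace X \<Longrightarrow> 0 < r \<Longrightarrow> \<exists>U. openin X U \<and> x \<in> U \<and> (\<forall>y \<in> U. D x y < r)"
    and "\<And>w. w \<in> topspace (free_group_upto 3 X) \<Longrightarrow>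
      pseudometric.graev D (w \<otimes>\<^bsub>G\<^esub> inv\<^bsub>G\<^esub> g) < 1 \<Longrightarrow> w \<in> S"
proof -
  note result = that
  obtain M d where "Metric_space M d" and Xeq: "X = Metric_space.mtopology M d"
    using X unfolding metrizable_space_def by blast
  then interpret Metric_space M d by blast
  have top [simp]: "topspace X = M" by (simp add: Xeq)
  have gG: "g \<in> carrier G" and gM: "fst ` set g \<subseteq> M" and gred: "reduced g" and glen: "length g \<le> 3"
    using g by (auto simp: topspace_free_group_upto G_def free_group_def)
  have wM: "fst ` set w \<subseteq> M" and wred: "reduced w" and wlen: "length w \<le> 3"
    if "w \<in> topspace (free_group_upto 3 X)" for w
    using that by (auto simp: topspace_free_group_upto free_group_def)
  \<comment> \<open>Since \<open>length w \<le> 3 \<le> length g + 1\<close>,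
    \<open>pairing_close\<close> applies once \<open>D\<close> separates the base points of
    \<open>g\<close>; nearby words then have the signs of \<open>g\<close> and letters close to
    those of \<open>g\<close>.\<close>
  have long: thesis if len: "2 \<le> length g" and e: "0 < e" and
    close: "\<And>w. w \<in> topspace (free_group_upto 3 X) \<Longrightarrow>
      list_all2 (\<lambda>f c. snd f = snd c \<and> d (fst c) (fst f) < e) w g \<Longrightarrow> w \<in> S" for e
  proof -
    obtain q where q: "q > 0" "\<And>x y. x \<in> fst ` set g \<Longrightarrow> y \<in> fst ` set g \<Longrightarrow> d x y < q \<Longrightarrow> x = y"
      using finite_scale[of "fst ` set g"] gM by auto
    obtain D where D: "pseudometric D"
      "\<And>x r. x \<in> M \<Longrightarrow> 0 < r \<Longrightarrow> \<exists>U. openin mtopology U \<and> x \<in> U \<and> (\<forall>y \<in> U. D x y < r)"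
      "\<And>x y. x \<in> M \<Longrightarrow> y \<in> M \<Longrightarrow> D x y < 1 \<Longrightarrow> d x y < min e q"
      using pseudometric_of_scale[of "min e q"] e q(1) by auto
    interpret D: pseudometric D by (rule D(1))
    have sep: "D.separated 1 g"
    proof (rule D.separated_of_reduced[OF gred])
      fix x y assume xy: "x \<in> fst ` set g" "y \<in> fst ` set g" "D x y < 1"
      then show "x = y" using D(3)[of x y] gM by (intro q(2)) auto
    qed
    show thesis
    proof (rule result[OF D(1)])
      fix w assume w: "w \<in> topspace (free_group_upto 3 X)" "D.graev (w \<otimes>\<^bsub>G\<^esub> inv\<^bsub>G\<^esub> g) < 1"
      obtain r where r: "D.pairing (w @ map opp (rev g)) r" "r < 1"
        using D.graev_quotient_less[OF gG[unfolded G_def] w(2)[unfolded G_def]] by auto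
      have *: "list_all2 (\<lambda>f c. snd f = snd c \<and> D (fst f) (fst c) \<le> r) w g"
        using D.pairing_close[OF r(1) sep r(2)] wlen[OF w(1)] len by auto
      have "list_all2 (\<lambda>f c. snd f = snd c \<and> d (fst c) (fst f) < e) w g"
        unfolding list_all2_conv_all_nth
      proof (intro conjI allI impI)
        show "length w = length g" using * by (rule list_all2_lengthD)
        fix i assume i: "i < length w"
        show "snd (w ! i) = snd (g ! i)" using list_all2_nthD[OF * i] by simp
        have "fst (w ! i) \<in> M" using wM[OF w(1)] i by fastforce
        moreover have "fst (g ! i) \<in> M" using gM i \<open>length w = length g\<close> by fastforce
        moreover have "D (fst (g ! i)) (fst (w ! i)) < 1"
          using list_all2_nthD[OF * i] r(2) D.D_sym[of "fst (g ! i)"] by simp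
        ultimately show "d (fst (g ! i)) (fst (w ! i)) < e" using D(3) by fastforce
      qed
      then show "w \<in> S" using close w(1) by blast
    qed (use D(2) in \<open>auto simp: Xeq\<close>)
  qed
  from glen show thesis
  proof (cases g rule: list_length_le3_cases)
    case 1
    show thesis
    proof (cases "M = {}")
      case True
      have "pseudometric (\<lambda>(x::'a) (y::'a). 0)" by unfold_locales auto
      moreover have "w \<in> S" if "w \<in> topspace (free_group_upto 3 X)" for w
        using wM[OF that] True g(2) 1 by auto
      ultimately show thesis using result True by auto
    next
      case False
      then obtain a where a: "a \<in> M" by blast
      let ?P = "\<lambda>t. {p \<in> topspace (prod_topology X X). word2 t (\<not> t) p \<in> S}"
      \<comment> \<open>Both sign patterns of a pair are imposed at once. The diagonal belongs to
        \<open>?N\<close> because there the pair cancels to the empty word \<open>g\<close>.\<close>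
      let ?N = "?P True \<inter> ?P False"
      have N: "openin (prod_topology mtopology mtopology) ?N"
        using o2[of True False] o2[of False True] by (simp only: Xeq[symmetric] openin_Int not_True_eq_False not_False_eq_True)
      have diag: "(x, x) \<in> ?N" if "x \<in> M" for x
        using that word2_cancel[of True x] word2_cancel[of False x] g(2) 1 by auto
      have oM: "openin mtopology M" using openin_topspace[of mtopology] by simp
      show thesis
      proof (rule pseudometric_of_diagonal_neighbourhood[OF N diag oM a])
        fix D assume D: "pseudometric D"
          "\<And>x r. x \<in> M \<Longrightarrow> 0 < r \<Longrightarrow> \<exists>U. openin mtopology U \<and> x \<in> U \<and> (\<forall>y \<in> U. D x y < r)"
          "\<And>x y. x \<in> M \<Longrightarrow> y \<in> M \<Longrightarrow> D x y < 1 \<Longrightarrow> (x, y) \<in> ?N"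
          "\<And>y. y \<in> M \<Longrightarrow> D a y < 1 \<Longrightarrow> y \<in> M"
        interpret D: pseudometric D by (rule D(1))
        show thesis
        proof (rule result[OF D(1)])
          fix w assume w: "w \<in> topspace (free_group_upto 3 X)" "D.graev (w \<otimes>\<^bsub>G\<^esub> inv\<^bsub>G\<^esub> g) < 1"
          obtain r where r: "D.pairing w r" "r < 1"
            using D.graev_quotient_less[OF gG[unfolded G_def] w(2)[unfolded G_def]] 1 by auto
          from wlen[OF w(1)] show "w \<in> S"
          proof (cases w rule: list_length_le3_cases)
            case (3 p q)
            then have pq: "snd p \<noteq> snd q" "D (fst p) (fst q) < 1" "fst p \<in> M" "fst q \<in> M"
              using D.pairing_pair r wM[OF w(1)] by auto
            then have "word2 (snd p) (snd q) (fst p, fst q) \<in> S"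
              using D(3)[of "fst p" "fst q"] by (cases "snd p") auto
            then show ?thesis using word2_reduced[of p q] wred[OF w(1)] 3 by simp
          qed (use g(2) 1 D.pairing_even[OF r(1)] in auto)
        qed (use D(2) in \<open>auto simp: Xeq\<close>)
      qed
    qed
  next
    case (2 a)
    obtain x0 s where a: "a = (x0, s)" by (cases a)
    define V0 where "V0 = {x \<in> topspace X. [(x, s)] \<in> S}"
    let ?X3 = "prod_topology X (prod_topology X X)"
    \<comment> \<open>The rotation moves the letter near \<open>x0\<close> to the last place. Thus
      \<open>A\<close> collects the triples whose words lie in \<open>S\<close> with the pair on
      either side and in either sign pattern.\<close>
    let ?rot = "\<lambda>p :: 'a \<times> 'a \<times> 'a. (fst (snd p), snd (snd p), fst p)"
    let ?R = "\<lambda>t. {p \<in> topspace ?X3. word3 s t (\<not> t) p \<in> S}"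
    let ?L = "\<lambda>t. {p \<in> topspace ?X3. ?rot p \<in> {p \<in> topspace ?X3. word3 t (\<not> t) s p \<in> S}}"
    define A where "A = ?R True \<inter> ?R False \<inter> ?L True \<inter> ?L False"
    have "continuous_map ?X3 ?X3 ?rot"
      using continuous_map_compose[OF continuous_map_snd[of X "prod_topology X X"] continuous_map_fst]
        continuous_map_compose[OF continuous_map_snd[of X "prod_topology X X"] continuous_map_snd]
        continuous_map_fst[of X "prod_topology X X"]
      by (simp add: continuous_map_pairwise o_def)
    then have "openin ?X3 (?L t)" for t
      by (rule openin_continuous_map_preimage) (rule o3)
    then have A: "openin ?X3 A"
      unfolding A_def using o3 by (intro openin_Int) blast+
    have A_word: "word3 s t (\<not> t) (x, y, z) \<in> S \<and> word3 t (\<not> t) s (y, z, x) \<in> S"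
      if "(x, y, z) \<in> A" for t x y z
      using that by (cases t) (auto simp: A_def)
    have V0: "openin X V0" "x0 \<in> V0"
      using o1 2 a g(2) gM by (auto simp: V0_def)
    \<comment> \<open>Over the diagonal the pair cancels and leaves the letter \<open>v\<close>,
      whose word lies in \<open>S\<close> by the choice of \<open>V0\<close>.\<close>
    have "(v, y, y) \<in> A" if "v \<in> V0" "y \<in> topspace X" for v y
      using that word3_cancel_right[of s True v y] word3_cancel_right[of s False v y]
        word3_cancel_left[of True s y v] word3_cancel_left[of False s y v]
      by (auto simp: A_def V0_def)
    note fibre = this
    show thesis
    proof (rule neighbourhood_of_fibre_diagonal[OF metrizable_imp_Hausdorff_space[OF X] cond A V0 fibre])
      fix V N assume VN: "openin X V" "x0 \<in> V" "V \<subseteq> V0" "openin (prod_topology X X) N"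
        "\<And>y. y \<in> topspace X \<Longrightarrow> (y, y) \<in> N" "V \<times> N \<subseteq> A"
      have diag: "(x, x) \<in> N" if "x \<in> M" for x using VN(5) that by simp
      show thesis
      proof (rule pseudometric_of_diagonal_neighbourhood[OF VN(4)[unfolded Xeq] diag VN(1)[unfolded Xeq] VN(2)])
        fix D assume D: "pseudometric D"
          "\<And>x r. x \<in> M \<Longrightarrow> 0 < r \<Longrightarrow> \<exists>U. openin mtopology U \<and> x \<in> U \<and> (\<forall>y \<in> U. D x y < r)"
          "\<And>x y. x \<in> M \<Longrightarrow> y \<in> M \<Longrightarrow> D x y < 1 \<Longrightarrow> (x, y) \<in> N"
          "\<And>y. y \<in> M \<Longrightarrow> D x0 y < 1 \<Longrightarrow> y \<in> V"
        interpret D: pseudometric D by (rule D(1))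
        show thesis
        proof (rule result[OF D(1)])
          fix w assume w: "w \<in> topspace (free_group_upto 3 X)" "D.graev (w \<otimes>\<^bsub>G\<^esub> inv\<^bsub>G\<^esub> g) < 1"
          obtain r where r: "D.pairing (w @ map opp (rev g)) r" "r < 1"
            using D.graev_quotient_less[OF gG[unfolded G_def] w(2)[unfolded G_def]] by auto
          have sep: "D.separated 1 [a]" by (simp add: D.separated_def)
          obtain u1 f u2 q t where u: "w = u1 @ f # u2" "D.pairing u1 q" "D.pairing (u2 @ map opp (rev [])) t"
            "snd f = snd a" "r = q + t + D (fst f) (fst a)"
            by (rule D.pairing_separated[OF r(1)[unfolded 2] sep r(2)])
          then have u2: "D.pairing u2 t" by simp
          have nn: "0 \<le> q" "0 \<le> t" "0 \<le> D (fst f) (fst a)"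
            using D.pairing_nonneg u(2) u2 by auto
          have "D (fst f) (fst a) < 1" "q < 1" "t < 1" using nn u(5) r(2) by linarith+
          then have fV: "fst f \<in> V" using D(4)[of "fst f"] wM[OF w(1)] u a D.D_sym[of x0] by auto
          have small: "(fst p, fst p') \<in> N \<and> snd p' = (\<not> snd p)"
            if "D.pairing [p, p'] c" "c < 1" "p \<in> set w" "p' \<in> set w" for p p' c
            using D.pairing_pair[OF that(1)] that D(3)[of "fst p" "fst p'"] wM[OF w(1)] by auto
          \<comment> \<open>The letter \<open>f\<close> matched with \<open>a\<close> leaves at most
            two letters, in blocks of even length: hence \<open>w\<close> is one letter, or one
            letter with a single matched pair before or after it.\<close>
          have "length u1 + length u2 \<le> 2" using wlen[OF w(1)] u by simp
          moreover have "even (length u1)" "even (length u2)" using D.pairing_even u(2) u2 by auto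
          ultimately have "length u1 = 0 \<and> length u2 = 0 \<or> length u1 = 2 \<and> length u2 = 0 \<or>
              length u1 = 0 \<and> length u2 = 2"
            by presburger
          then consider "length u1 = 0" "length u2 = 0" | "length u1 = 2" "length u2 = 0"
            | "length u1 = 0" "length u2 = 2"
            by blast
          then show "w \<in> S"
          proof cases
            case 1
            then have "w = [f]" "f = (fst f, s)" using u a by (auto simp: prod_eq_iff)
            then show ?thesis using fV VN(3) unfolding V0_def by (metis (mono_tags, lifting) mem_Collect_eq subsetD)
          next
            case 2
            then obtain p p' where p: "u1 = [p, p']" "u2 = []"
              by (auto simp: length_Suc_conv numeral_2_eq_2)
            then have "(fst p, fst p') \<in> N" "snd p' = (\<not> snd p)"
              using small[of p p' q] u \<open>q < 1\<close> by auto
            then have "(fst f, fst p, fst p') \<in> A" using VN(6) fV by blast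
            then have "word3 (snd p) (snd p') (snd f) (fst p, fst p', fst f) \<in> S"
              using A_word[of "fst f" "fst p" "fst p'" "snd p"] \<open>snd p' = _\<close> u(4) a by auto
            then show ?thesis using word3_reduced[of p p' f] wred[OF w(1)] u(1) p by simp
          next
            case 3
            then obtain p p' where p: "u2 = [p, p']" "u1 = []"
              by (auto simp: length_Suc_conv numeral_2_eq_2)
            then have "(fst p, fst p') \<in> N" "snd p' = (\<not> snd p)"
              using small[of p p' t] u u2 \<open>t < 1\<close> by auto
            then have "(fst f, fst p, fst p') \<in> A" using VN(6) fV by blast
            then have "word3 (snd f) (snd p) (snd p') (fst f, fst p, fst p') \<in> S"
              using A_word[of "fst f" "fst p" "fst p'" "snd p"] \<open>snd p' = _\<close> u(4) a by auto
            then show ?thesis using word3_reduced[of f p p'] wred[OF w(1)] u(1) p by simp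
          qed
        qed (use D(2) in \<open>auto simp: Xeq\<close>)
      qed
    qed
  next
    case (3 a b)
    have "(fst a, fst b) \<in> {p \<in> topspace (prod_topology X X). word2 (snd a) (snd b) p \<in> S}"
      using 3 g(2) gM gred word2_reduced[of a b] by simp
    note centre = this
    show thesis
    proof (rule openin_prod_mball_pair[OF o2[unfolded Xeq] centre[unfolded Xeq]])
      fix e assume e: "e > 0" "\<And>x' y'. x' \<in> mball (fst a) e \<Longrightarrow> y' \<in> mball (fst b) e \<Longrightarrow>
          (x', y') \<in> {p \<in> topspace (prod_topology mtopology mtopology). word2 (snd a) (snd b) p \<in> S}"
      show thesis
      proof (rule long[OF _ e(1)])
        fix w assume w: "w \<in> topspace (free_group_upto 3 X)"
          "list_all2 (\<lambda>f c. snd f = snd c \<and> d (fst c) (fst f) < e) w g"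
        then obtain a' b' where ab: "w = [a', b']" "snd a' = snd a" "snd b' = snd b"
          "d (fst a) (fst a') < e" "d (fst b) (fst b') < e"
          using 3 by (auto simp: list_all2_Cons2)
        then have "word2 (snd a') (snd b') (fst a', fst b') \<in> S"
          using e(2)[of "fst a'" "fst b'"] wM[OF w(1)] gM 3 by auto
        then show "w \<in> S" using word2_reduced[of a' b'] wred[OF w(1)] ab by simp
      qed (use 3 in simp)
    qed
  next
    case (4 a b c)
    have "(fst a, fst b, fst c) \<in>
        {p \<in> topspace (prod_topology X (prod_topology X X)). word3 (snd a) (snd b) (snd c) p \<in> S}"
      using 4 g(2) gM gred word3_reduced[of a b c] by simp
    note centre = this
    show thesis
    proof (rule openin_prod_mball_triple[OF o3[unfolded Xeq] centre[unfolded Xeq]])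
      fix e assume e: "e > 0" "\<And>x' y' z'. x' \<in> mball (fst a) e \<Longrightarrow> y' \<in> mball (fst b) e \<Longrightarrow>
          z' \<in> mball (fst c) e \<Longrightarrow>
          (x', y', z') \<in> {p \<in> topspace (prod_topology mtopology (prod_topology mtopology mtopology)).
            word3 (snd a) (snd b) (snd c) p \<in> S}"
      show thesis
      proof (rule long[OF _ e(1)])
        fix w assume w: "w \<in> topspace (free_group_upto 3 X)"
          "list_all2 (\<lambda>f c. snd f = snd c \<and> d (fst c) (fst f) < e) w g"
        then obtain a' b' c' where ab: "w = [a', b', c']" "snd a' = snd a" "snd b' = snd b" "snd c' = snd c"
          "d (fst a) (fst a') < e" "d (fst b) (fst b') < e" "d (fst c) (fst c') < e"
          using 4 by (auto simp: list_all2_Cons2)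
        then have "word3 (snd a') (snd b') (snd c') (fst a', fst b', fst c') \<in> S"
          using e(2)[of "fst a'" "fst b'" "fst c'"] wM[OF w(1)] gM 4 by auto
        then show "w \<in> S" using word3_reduced[of a' b' c'] wred[OF w(1)] ab by simp
      qed (use 4 in simp)
    qed
  qed
qed

section \<open>Quotient topology, k-space property and separation of the free group\<close>

lemma openin_preimage_if_compactly_open:
  assumes Z: "metrizable_space Z" and h: "continuous_map Z Y h"
    and S: "\<And>K. compactin Y K \<Longrightarrow> openin (subtopology Y K) (K \<inter> S)"
  shows "openin Z {z \<in> topspace Z. h z \<in> S}"
proof -
  \<comment> \<open>The metrizable space \<open>Z\<close> is a k-space, so compact \<open>L\<close>
    suffice as test sets; the image of \<open>L\<close> is compact in \<open>Y\<close>, where the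
    assumption on \<open>S\<close> applies.\<close>
  have "openin (subtopology Z L) (L \<inter> {z \<in> topspace Z. h z \<in> S})" if L: "compactin Z L" for L
  proof -
    have "continuous_map (subtopology Z L) (subtopology Y (h ` L)) h"
      using h by (simp add: continuous_map_in_subtopology continuous_map_from_subtopology)
    then have "openin (subtopology Z L) {z \<in> topspace (subtopology Z L). h z \<in> h ` L \<inter> S}"
      using S[OF image_compactin[OF L h]] by (rule openin_continuous_map_preimage)
    moreover have "{z \<in> topspace (subtopology Z L). h z \<in> h ` L \<inter> S} = L \<inter> {z \<in> topspace Z. h z \<in> S}"
      by auto
    ultimately show ?thesis by simp
  qed
  then show ?thesis
    by (intro k_space_open[THEN iffD1, OF metrizable_imp_k_space[OF Z], rule_format]) auto
qed

lemma continuous_map_graev_upto: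
  assumes "pseudometric D"
    and "\<And>x r. x \<in> topspace X \<Longrightarrow> 0 < r \<Longrightarrow> \<exists>U. openin X U \<and> x \<in> U \<and> (\<forall>y \<in> U. D x y < r)"
    and "g \<in> carrier (free_group (topspace X))"
  shows "continuous_map (free_group_upto n X) euclideanreal
    (\<lambda>w. pseudometric.graev D (w \<otimes>\<^bsub>free_group (topspace X)\<^esub> inv\<^bsub>free_group (topspace X)\<^esub> g))"
  unfolding free_group_upto_def
  by (rule continuous_map_from_subtopology[OF pseudometric.continuous_map_graev[OF assms]])

lemma graev_centre:
  assumes "pseudometric D" "g \<in> carrier (free_group S)"
  shows "pseudometric.graev D (g \<otimes>\<^bsub>free_group S\<^esub> inv\<^bsub>free_group S\<^esub> g) = 0"
proof -
  interpret N: invariant_norm "free_group S" "pseudometric.graev D"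
    by (rule pseudometric.invariant_norm_graev[OF assms(1)])
  show ?thesis using assms(2) by (simp add: N.N_one)
qed

lemma continuous_map_letter_upto: "continuous_map X (free_group_upto 3 X) (\<lambda>x. [(x, s)])"
  by (simp add: continuous_map_free_group_upto continuous_map_letter)

lemma continuous_map_word2_upto:
  "continuous_map (prod_topology X X) (free_group_upto 3 X) (word2 s t)"
  by (auto simp: continuous_map_free_group_upto continuous_map_word2 intro: order_trans[OF length_word2])

lemma continuous_map_word3_upto:
  "continuous_map (prod_topology X (prod_topology X X)) (free_group_upto 3 X) (word3 s t u)"
  by (simp add: continuous_map_free_group_upto continuous_map_word3 length_word3)

context
  fixes X :: "'a topology"
  assumes X: "metrizable_space X"
    and cond: "locally_compact_space X \<or> compactin X (non_isolated_points X)"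
begin

text \<open>\<open>F_3(X)\<close> has the quotient topology of its word maps: the Graev unit ball
  around each point of \<open>S\<close> is open in the free topology and lies in
  \<open>S\<close>.\<close>

lemma openin_free_group_upto_3:
  assumes "S \<subseteq> topspace (free_group_upto 3 X)"
    and "\<And>s. openin X {x \<in> topspace X. [(x, s)] \<in> S}"
    and "\<And>s t. openin (prod_topology X X) {p \<in> topspace (prod_topology X X). word2 s t p \<in> S}"
    and "\<And>s t u. openin (prod_topology X (prod_topology X X))
      {p \<in> topspace (prod_topology X (prod_topology X X)). word3 s t u p \<in> S}"
  shows "openin (free_group_upto 3 X) S"
proof (subst openin_subopen, intro ballI)
  fix g assume g: "g \<in> S"
  then have gF: "g \<in> topspace (free_group_upto 3 X)" using assms(1) by blast
  then have gG: "g \<in> carrier (free_group (topspace X))" by (simp add: topspace_free_group_upto)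
  show "\<exists>T. openin (free_group_upto 3 X) T \<and> g \<in> T \<and> T \<subseteq> S"
  proof (rule graev_neighbourhood[OF X cond assms(2-4) gF g])
    fix D
    let ?f = "\<lambda>w. pseudometric.graev D
      (w \<otimes>\<^bsub>free_group (topspace X)\<^esub> inv\<^bsub>free_group (topspace X)\<^esub> g)"
    assume D: "pseudometric D"
      "\<And>x r. x \<in> topspace X \<Longrightarrow> 0 < r \<Longrightarrow> \<exists>U. openin X U \<and> x \<in> U \<and> (\<forall>y \<in> U. D x y < r)"
      "\<And>w. w \<in> topspace (free_group_upto 3 X) \<Longrightarrow> ?f w < 1 \<Longrightarrow> w \<in> S"
    let ?T = "{w \<in> topspace (free_group_upto 3 X). ?f w \<in> {..<1}}"
    have "openin (free_group_upto 3 X) ?T"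
      by (rule openin_continuous_map_preimage[OF continuous_map_graev_upto[OF D(1,2) gG]]) auto
    moreover have "g \<in> ?T" using gF graev_centre[OF D(1) gG] by simp
    moreover have "?T \<subseteq> S" using D(3) by auto
    ultimately show ?thesis by blast
  qed
qed

lemma k_space_free_group_upto_3: "k_space (free_group_upto 3 X)"
  unfolding k_space_open
proof (intro allI impI, elim conjE)
  fix S
  assume S: "S \<subseteq> topspace (free_group_upto 3 X)"
    and K: "\<forall>K. compactin (free_group_upto 3 X) K \<longrightarrow>
      openin (subtopology (free_group_upto 3 X) K) (K \<inter> S)"
  have X2: "metrizable_space (prod_topology X X)"
    and X3: "metrizable_space (prod_topology X (prod_topology X X))"
    using X by (simp_all add: metrizable_space_prod_topology)
  show "openin (free_group_upto 3 X) S"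
    using K
    by (intro openin_free_group_upto_3[OF S]
        openin_preimage_if_compactly_open[OF X continuous_map_letter_upto]
        openin_preimage_if_compactly_open[OF X2 continuous_map_word2_upto]
        openin_preimage_if_compactly_open[OF X3 continuous_map_word3_upto]) auto
qed

text \<open>The complement of \<open>C\<close> contains a Graev unit ball around \<open>g\<close>,
  so the norm of the quotient by \<open>g\<close> vanishes at \<open>g\<close> and is at least 1 on
  \<open>C\<close>.\<close>

lemma completely_regular_space_free_group_upto_3: "completely_regular_space (free_group_upto 3 X)"
  unfolding completely_regular_space_def
proof (intro allI impI, elim conjE)
  let ?F = "free_group_upto 3 X"
  fix C g assume C: "closedin ?F C" and g: "g \<in> topspace ?F - C"
  let ?S = "topspace ?F - C"
  have S: "openin ?F ?S" using C by blast
  have gF: "g \<in> topspace ?F" using g by blast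
  then have gG: "g \<in> carrier (free_group (topspace X))" by (simp add: topspace_free_group_upto)
  note o1 = openin_continuous_map_preimage[OF continuous_map_letter_upto S]
    and o2 = openin_continuous_map_preimage[OF continuous_map_word2_upto S]
    and o3 = openin_continuous_map_preimage[OF continuous_map_word3_upto S]
  show "\<exists>f::_ \<Rightarrow> real. continuous_map ?F (top_of_set {0..1}) f \<and> f g = 0 \<and> f ` C \<subseteq> {1}"
  proof (rule graev_neighbourhood[OF X cond o1 o2 o3 gF g])
    fix D
    let ?f = "\<lambda>w. pseudometric.graev D
      (w \<otimes>\<^bsub>free_group (topspace X)\<^esub> inv\<^bsub>free_group (topspace X)\<^esub> g)"
    assume D: "pseudometric D"
      "\<And>x r. x \<in> topspace X \<Longrightarrow> 0 < r \<Longrightarrow> \<exists>U. openin X U \<and> x \<in> U \<and> (\<forall>y \<in> U. D x y < r)"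
      "\<And>w. w \<in> topspace ?F \<Longrightarrow> ?f w < 1 \<Longrightarrow> w \<in> ?S"
    have "continuous_map ?F euclideanreal (\<lambda>w. min 1 (?f w))"
      by (intro continuous_map_real_min continuous_map_graev_upto[OF D(1,2) gG]) auto
    then have "continuous_map ?F (top_of_set {0..1}) (\<lambda>w. min 1 (?f w))"
      using pseudometric.graev_nonneg[OF D(1)] by (auto simp: continuous_map_in_subtopology)
    moreover have "min 1 (?f g) = 0" using graev_centre[OF D(1) gG] by simp
    moreover have "min 1 (?f w) = 1" if "w \<in> C" for w
      using D(3)[of w] that closedin_subset[OF C] by force
    ultimately show ?thesis by (intro exI[of _ "\<lambda>w. min 1 (?f w)"]) auto
  qed
qed

end

text \<open>At a scale below the distances between the base points of \<open>g\<close> and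
  \<open>h\<close>, \<open>pairing_close\<close> lets \<open>h\<close> be near \<open>g\<close> only
  if they are equal. Its length bound holds after exchanging \<open>g\<close> and \<open>h\<close>
  if necessary.\<close>

lemma Hausdorff_space_free_group_topology:
  assumes X: "metrizable_space X"
  shows "Hausdorff_space (free_group_topology X)"
proof -
  obtain M d where "Metric_space M d" and Xeq: "X = Metric_space.mtopology M d"
    using X unfolding metrizable_space_def by blast
  then interpret Metric_space M d by blast
  let ?F = "free_group_topology X" and ?G = "free_group (topspace X)"
  have top [simp]: "topspace X = M" by (simp add: Xeq)
  have sep: "\<exists>f. continuous_map ?F euclideanreal f \<and> f g = 0 \<and> f h \<ge> (1::real)"
    if g: "g \<in> carrier ?G" and h: "h \<in> carrier ?G" and "g \<noteq> h" and len: "length h \<le> length g + 1" for g h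
  proof -
    let ?Q = "fst ` set g \<union> fst ` set h"
    have "finite ?Q" "?Q \<subseteq> M" using g h by (auto simp: free_group_def)
    note Q = this
    show ?thesis
    proof (rule finite_scale[OF Q])
      fix e assume e: "e > 0" "\<And>x y. x \<in> ?Q \<Longrightarrow> y \<in> ?Q \<Longrightarrow> d x y < e \<Longrightarrow> x = y"
      show ?thesis
      proof (rule pseudometric_of_scale[OF e(1)])
        fix D assume D: "pseudometric D"
          "\<And>x r. x \<in> M \<Longrightarrow> 0 < r \<Longrightarrow> \<exists>U. openin mtopology U \<and> x \<in> U \<and> (\<forall>y \<in> U. D x y < r)"
          "\<And>x y. x \<in> M \<Longrightarrow> y \<in> M \<Longrightarrow> D x y < 1 \<Longrightarrow> d x y < e"
        interpret D: pseudometric D by (rule D(1))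
        have eq: "x = y" if "x \<in> ?Q" "y \<in> ?Q" "D x y < 1" for x y
          using e(2)[OF that(1,2)] D(3)[of x y] that \<open>?Q \<subseteq> M\<close> by blast
        have cont: "continuous_map ?F euclideanreal (\<lambda>w. D.graev (w \<otimes>\<^bsub>?G\<^esub> inv\<^bsub>?G\<^esub> g))"
          using D(2) by (intro D.continuous_map_graev g) (simp add: Xeq)
        have "1 \<le> D.graev (h \<otimes>\<^bsub>?G\<^esub> inv\<^bsub>?G\<^esub> g)"
        proof (rule ccontr)
          assume "\<not> 1 \<le> D.graev (h \<otimes>\<^bsub>?G\<^esub> inv\<^bsub>?G\<^esub> g)"
          then obtain r where r: "D.pairing (h @ map opp (rev g)) r" "r < 1"
            using D.graev_quotient_less[OF g, of h 1] by auto
          have "D.separated 1 g"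
          proof (rule D.separated_of_reduced)
            show "reduced g" using g by (simp add: free_group_def)
            show "x = y" if "x \<in> fst ` set g" "y \<in> fst ` set g" "D x y < 1" for x y
              using eq[of x y] that by blast
          qed
          from D.pairing_close[OF r(1) this r(2) len]
          have *: "list_all2 (\<lambda>f c. snd f = snd c \<and> D (fst f) (fst c) \<le> r) h g" .
          have "h = g"
          proof (rule nth_equalityI)
            show "length h = length g" using * by (rule list_all2_lengthD)
            fix i assume i: "i < length h"
            have "fst (h ! i) = fst (g ! i)"
              using list_all2_nthD[OF * i] i r(2) \<open>length h = length g\<close> by (intro eq) auto
            then show "h ! i = g ! i" using list_all2_nthD[OF * i] by (simp add: prod_eq_iff)
          qed
          then show False using \<open>g \<noteq> h\<close> by simp
        qed
        then show ?thesis using cont graev_centre[OF D(1) g] by blast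
      qed
    qed
  qed
  have disj: "\<exists>U V. openin ?F U \<and> openin ?F V \<and> g \<in> U \<and> h \<in> V \<and> disjnt U V"
    if g: "g \<in> carrier ?G" and h: "h \<in> carrier ?G" and "g \<noteq> h" and len: "length h \<le> length g + 1" for g h
  proof -
    obtain f where f: "continuous_map ?F euclideanreal f" "f g = 0" "f h \<ge> (1::real)"
      using sep[OF g h \<open>g \<noteq> h\<close> len] by blast
    have "openin ?F {w \<in> topspace ?F. f w \<in> {..<1/2}}" "openin ?F {w \<in> topspace ?F. f w \<in> {1/2<..}}"
      by (rule openin_continuous_map_preimage[OF f(1)], simp)+
    moreover have "disjnt {w \<in> topspace ?F. f w \<in> {..<1/2}} {w \<in> topspace ?F. f w \<in> {1/2<..}}"
      by (auto simp: disjnt_iff)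
    ultimately show ?thesis
      using f g h by (intro exI conjI) (auto simp: topspace_free_group_topology)
  qed
  show ?thesis
    unfolding Hausdorff_space_def topspace_free_group_topology
  proof (intro allI impI, elim conjE)
    fix g h assume gh: "g \<in> carrier ?G" "h \<in> carrier ?G" "g \<noteq> h"
    show "\<exists>U V. openin ?F U \<and> openin ?F V \<and> g \<in> U \<and> h \<in> V \<and> disjnt U V"
    proof (cases "length h \<le> length g + 1")
      case False
      then obtain U V where "openin ?F U" "openin ?F V" "h \<in> U" "g \<in> V" "disjnt U V"
        using disj[OF gh(2,1) gh(3)[symmetric]] by (metis nat_le_linear le_add1 order_trans)
      then show ?thesis by (meson disjnt_sym)
    next
      case True
      then show ?thesis by (rule disj[OF gh])
    qed
  qed
qed

lemma k_space_imp_continuous_map: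
  assumes Z: "k_space Z"
    and f: "\<And>K. compactin Z K \<Longrightarrow> continuous_map (subtopology Z K) euclideanreal f"
  shows "continuous_map Z euclideanreal f"
  unfolding continuous_map_def
proof (intro conjI allI impI)
  fix U :: "real set" assume U: "openin euclidean U"
  have "openin (subtopology Z K) (K \<inter> {z \<in> topspace Z. f z \<in> U})" if K: "compactin Z K" for K
  proof -
    have "openin (subtopology Z K) {z \<in> topspace (subtopology Z K). f z \<in> U}"
      by (rule openin_continuous_map_preimage[OF f[OF K] U])
    moreover have "{z \<in> topspace (subtopology Z K). f z \<in> U} = K \<inter> {z \<in> topspace Z. f z \<in> U}"
      by auto
    ultimately show ?thesis by simp
  qed
  then show "openin Z {z \<in> topspace Z. f z \<in> U}"
    by (intro k_space_open[THEN iffD1, OF Z, rule_format]) auto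
qed simp


subsection \<open>Homomorphisms into unitriangular matrices\<close>

text \<open>The tuple \<open>(a, b, c, p, q, r)\<close> stands for the matrix with entries \<open>a, b, c\<close> on the first
  superdiagonal, \<open>p, q\<close> on the second one, and \<open>r\<close> in the corner.\<close>

definition unitriangular :: "(real \<times> real \<times> real \<times> real \<times> real \<times> real) monoid" where
  "unitriangular = \<lparr>carrier = UNIV,
     mult = (\<lambda>(a, b, c, p, q, r) (a', b', c', p', q', r').
       (a + a', b + b', c + c', p + p' + a * b', q + q' + b * c', r + r' + a * q' + p * c')),
     one = (0, 0, 0, 0, 0, 0)\<rparr>"

text \<open>For a matrix \<open>I + A\<close> with \<open>A\<close> strictly upper triangular, these
  are the entries of \<open>I - A + A^2 - A^3\<close>.\<close>

definition uni_inv :: "real \<times> real \<times> real \<times> real \<times> real \<times> real \<Rightarrow> real \<times> real \<times> real \<times> real \<times> real \<times> real" where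
  "uni_inv = (\<lambda>(a, b, c, p, q, r).
     (- a, - b, - c, - p + a * b, - q + b * c, - r + a * q + p * c - a * b * c))"

lemma group_unitriangular: "group unitriangular"
proof (rule groupI)
  fix x assume "x \<in> carrier unitriangular"
  have "uni_inv x \<otimes>\<^bsub>unitriangular\<^esub> x = \<one>\<^bsub>unitriangular\<^esub>"
    by (cases x) (simp add: unitriangular_def uni_inv_def algebra_simps)
  then show "\<exists>y \<in> carrier unitriangular. y \<otimes>\<^bsub>unitriangular\<^esub> x = \<one>\<^bsub>unitriangular\<^esub>"
    by (rule bexI) (simp add: unitriangular_def)
qed (auto simp: unitriangular_def algebra_simps)

lemma inv_unitriangular: "inv\<^bsub>unitriangular\<^esub> x = uni_inv x"
proof -
  have "uni_inv x \<otimes>\<^bsub>unitriangular\<^esub> x = \<one>\<^bsub>unitriangular\<^esub>"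
    by (cases x) (simp add: unitriangular_def uni_inv_def algebra_simps)
  then show ?thesis
    using group.inv_equality[OF group_unitriangular] by (auto simp: unitriangular_def)
qed

lemma topological_group_unitriangular: "topological_group unitriangular euclidean"
proof -
  have carrier: "topspace euclidean = carrier unitriangular" by (simp add: unitriangular_def)
  have "continuous_on UNIV (\<lambda>(x, y). x \<otimes>\<^bsub>unitriangular\<^esub> y)"
    unfolding unitriangular_def case_prod_unfold by (simp, intro continuous_intros)
  moreover have "continuous_on UNIV uni_inv"
    unfolding uni_inv_def case_prod_unfold by (intro continuous_intros)
  ultimately show ?thesis
    unfolding topological_group_def inv_unitriangular prod_topology_euclidean continuous_map_iff_continuous2
    using group_unitriangular carrier by (intro conjI) blast+
qed

definition sign :: "bool \<Rightarrow> real" where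
  "sign s = (if s then 1 else - 1)"

lemma abs_sign [simp]: "\<bar>sign s\<bar> = 1"
  by (simp add: sign_def)

definition uni_gen :: "('a \<Rightarrow> real) \<Rightarrow> ('a \<Rightarrow> real) \<Rightarrow> ('a \<Rightarrow> real) \<Rightarrow> 'a \<Rightarrow>
    real \<times> real \<times> real \<times> real \<times> real \<times> real" where
  "uni_gen \<alpha> \<beta> \<gamma> x = (\<alpha> x, \<beta> x, \<gamma> x, 0, 0, 0)"

definition corner :: "('a \<Rightarrow> real) \<Rightarrow> ('a \<Rightarrow> real) \<Rightarrow> ('a \<Rightarrow> real) \<Rightarrow> ('a \<times> bool) list \<Rightarrow> real" where
  "corner \<alpha> \<beta> \<gamma> w = snd (snd (snd (snd (snd (free_ext unitriangular (uni_gen \<alpha> \<beta> \<gamma>) w)))))"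

text \<open>The first superdiagonal entry is additive, so this is the homomorphism into the reals
  that extends \<open>\<phi>\<close>; its continuity comes with that of the matrix
  homomorphism.\<close>

definition letter_sum :: "('a \<Rightarrow> real) \<Rightarrow> ('a \<times> bool) list \<Rightarrow> real" where
  "letter_sum \<phi> w = fst (free_ext unitriangular (uni_gen \<phi> (\<lambda>_. 0) (\<lambda>_. 0)) w)"

lemma continuous_map_uni:
  assumes "continuous_map X euclideanreal \<alpha>" "continuous_map X euclideanreal \<beta>"
    "continuous_map X euclideanreal \<gamma>"
  shows "continuous_map (free_group_upto n X) euclidean (free_ext unitriangular (uni_gen \<alpha> \<beta> \<gamma>))"
proof -
  have "continuous_map X euclidean (uni_gen \<alpha> \<beta> \<gamma>)"
    unfolding uni_gen_def[abs_def] prod_topology_euclidean[symmetric]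
    using assms by (intro continuous_map_pairedI) auto
  then show ?thesis
    unfolding free_group_upto_def
    by (intro continuous_map_from_subtopology continuous_map_free_ext topological_group_unitriangular)
qed

lemma continuous_map_corner:
  assumes "continuous_map X euclideanreal \<alpha>" "continuous_map X euclideanreal \<beta>"
    "continuous_map X euclideanreal \<gamma>"
  shows "continuous_map (free_group_upto n X) euclideanreal (corner \<alpha> \<beta> \<gamma>)"
proof -
  have "continuous_map euclidean euclideanreal
      (\<lambda>x :: real \<times> real \<times> real \<times> real \<times> real \<times> real. snd (snd (snd (snd (snd x)))))"
    unfolding continuous_map_iff_continuous2 by (intro continuous_intros)
  from continuous_map_compose[OF continuous_map_uni[OF assms] this] show ?thesis
    by (simp add: o_def corner_def[abs_def])
qed

lemma continuous_map_letter_sum: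
  assumes "continuous_map X euclideanreal \<phi>"
  shows "continuous_map (free_group_upto n X) euclideanreal (letter_sum \<phi>)"
proof -
  have "continuous_map euclidean euclideanreal
      (\<lambda>x :: real \<times> real \<times> real \<times> real \<times> real \<times> real. fst x)"
    unfolding continuous_map_iff_continuous2 by (intro continuous_intros)
  from continuous_map_compose[OF continuous_map_uni[OF assms] this] show ?thesis
    by (simp add: o_def letter_sum_def[abs_def])
qed

text \<open>If \<open>\<alpha> \<beta> = \<beta> \<gamma> = 0\<close>, the nilpotent part of the matrix of a generator squares to 0, so passing to
  the inverse only changes its sign.\<close>

lemma letter_val_uni:
  assumes "\<And>x. \<alpha> x * \<beta> x = 0" "\<And>x. \<beta> x * \<gamma> x = 0"
  shows "letter_val unitriangular (uni_gen \<alpha> \<beta> \<gamma>) a =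
    (sign (snd a) * \<alpha> (fst a), sign (snd a) * \<beta> (fst a), sign (snd a) * \<gamma> (fst a), 0, 0, 0)"
  using assms[of "fst a"]
  by (auto simp: letter_val_def inv_unitriangular uni_inv_def uni_gen_def sign_def)

lemma uni_mult:
  "(a, b, c, p, q, r) \<otimes>\<^bsub>unitriangular\<^esub> (a', b', c', p', q', r') =
    (a + a', b + b', c + c', p + p' + a * b', q + q' + b * c', r + r' + a * q' + p * c')"
  "\<one>\<^bsub>unitriangular\<^esub> = (0, 0, 0, 0, 0, 0)"
  by (simp_all add: unitriangular_def)

text \<open>Off the diagonal each factor has entries only on the first superdiagonal. The corner is
  three steps away from the diagonal, so it collects exactly one step from each of three factors,
  and is out of reach for fewer.\<close>

lemma corner_triple:
  assumes "\<And>x. \<alpha> x * \<beta> x = 0" "\<And>x. \<beta> x * \<gamma> x = 0"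
  shows "corner \<alpha> \<beta> \<gamma> [a, b, c] =
    sign (snd a) * sign (snd b) * sign (snd c) * (\<alpha> (fst a) * \<beta> (fst b) * \<gamma> (fst c))"
  by (simp add: corner_def free_ext_def letter_val_uni[OF assms] uni_mult)

lemma corner_short:
  assumes "\<And>x. \<alpha> x * \<beta> x = 0" "\<And>x. \<beta> x * \<gamma> x = 0" "length w \<le> 2"
  shows "corner \<alpha> \<beta> \<gamma> w = 0"
proof -
  have "length w \<le> 3" using assms(3) by simp
  then show ?thesis
    by (cases w rule: list_length_le3_cases)
      (use assms(3) in \<open>auto simp: corner_def free_ext_def letter_val_uni[OF assms(1,2)] uni_mult\<close>)
qed

lemma letter_sum_triple:
  "letter_sum \<phi> [a, b, c] = sign (snd a) * \<phi> (fst a) + sign (snd b) * \<phi> (fst b) + sign (snd c) * \<phi> (fst c)"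
  by (simp add: letter_sum_def free_ext_def letter_val_uni uni_mult)


subsection \<open>Closed discrete sequences\<close>

lemma compactin_imp_not_unbounded:
  assumes K: "compactin Z K" and h: "continuous_map Z euclideanreal h"
    and J: "infinite J" and w: "\<And>k. k \<in> J \<Longrightarrow> w k \<in> K" "\<And>k. k \<in> J \<Longrightarrow> \<bar>h (w k)\<bar> = real k"
  shows False
proof -
  have "compact (h ` K)" using image_compactin[OF K h] by simp
  then have "bounded (h ` K)" by (rule compact_imp_bounded)
  then obtain B where B: "\<And>t. t \<in> h ` K \<Longrightarrow> \<bar>t\<bar> \<le> B"
    unfolding bounded_iff by auto
  obtain m :: nat where m: "B < real m" using reals_Archimedean2 by blast
  obtain k where k: "k \<in> J" "m < k" using J unfolding infinite_nat_iff_unbounded by blast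
  then have "real k \<le> B" using B[of "h (w k)"] w[OF k(1)] by auto
  then show False using m k(2) by simp
qed

context Metric_space
begin

text \<open>A tent of height 1. The value 0 outside \<open>M\<close> lets the orthogonality
  relations between bumps hold on the whole type, as the corner lemmas demand.\<close>

definition bump :: "'a \<Rightarrow> real \<Rightarrow> 'a \<Rightarrow> real" where
  "bump a e x = (if x \<in> M then max 0 (1 - d a x / e) else 0)"

lemma bump_nonneg: "0 \<le> bump a e x"
  by (simp add: bump_def)

lemma bump_centre: "a \<in> M \<Longrightarrow> bump a e a = 1"
  by (simp add: bump_def)

lemma bump_neq_0: "a \<in> M \<Longrightarrow> 0 < e \<Longrightarrow> bump a e x \<noteq> 0 \<Longrightarrow> x \<in> mball a e"
  by (auto simp: bump_def max_def field_simps split: if_splits)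

lemma continuous_map_bump:
  assumes "a \<in> M"
  shows "continuous_map mtopology euclideanreal (bump a e)"
proof -
  have "continuous_map mtopology euclideanreal (\<lambda>x. d a x)"
    using assms continuous_map_mdist[of mtopology Self "\<lambda>_. a" "\<lambda>x. x"]
    by (simp add: mtopology_of_def continuous_map_id[unfolded id_def])
  then have "continuous_map mtopology euclideanreal (\<lambda>x. max 0 (1 + d a x * (- 1 / e)))"
    by (intro continuous_map_real_max continuous_map_add continuous_map_real_mult) auto
  then show ?thesis
    by (rule continuous_map_eq) (simp add: bump_def)
qed

text \<open>The bound \<open>1 / Suc k\<close> on the radii ensures that points chosen from the balls are again
  closed and discrete.\<close>

definition spread :: "(nat \<Rightarrow> 'a) \<Rightarrow> (nat \<Rightarrow> real) \<Rightarrow> bool" where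
  "spread t e \<longleftrightarrow> (\<forall>k. t k \<in> M \<and> 0 < e k \<and> e k \<le> 1 / Suc k) \<and>
     (\<forall>j k. j \<noteq> k \<longrightarrow> disjnt (mball (t j) (e j)) (mball (t k) (e k))) \<and>
     (\<forall>a \<in> M. \<exists>\<eta> > 0. finite {k. d a (t k) < \<eta>})"

text \<open>By Bolzano-Weierstrass some infinite subset of \<open>C\<close> has no accumulation
  point in \<open>C\<close>, hence none at all since \<open>C\<close> is closed. Halving the
  isolation radii makes the balls disjoint.\<close>

lemma noncompact_imp_spread:
  assumes C: "closedin mtopology C" and nc: "\<not> compactin mtopology C"
  obtains t e where "spread t e" "range t \<subseteq> C"
proof -
  have CM: "C \<subseteq> M" using closedin_subset[OF C] by simp
  then obtain T where T: "T \<subseteq> C" "infinite T" "C \<inter> mtopology derived_set_of T = {}"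
    using nc unfolding compactin_eq_Bolzano_Weierstrass by blast
  have "mtopology derived_set_of T \<subseteq> C"
    using C T(1) derived_set_of_mono[of T C mtopology] unfolding closedin_contains_derived_set by blast
  then have der: "mtopology derived_set_of T = {}" using T(3) by blast
  have iso: "\<exists>r > 0. \<forall>u \<in> T. d a u < r \<longrightarrow> u = a" if aM: "a \<in> M" for a
  proof -
    have "a \<notin> mtopology derived_set_of T" using der by simp
    then obtain U where U: "a \<in> U" "openin mtopology U" "\<And>u. u \<in> T \<Longrightarrow> u \<in> U \<Longrightarrow> u = a"
      using aM unfolding in_derived_set_of by auto
    then obtain r where "r > 0" "mball a r \<subseteq> U" using openin_mball_subset by metis
    moreover have "u \<in> M" if "u \<in> T" for u using that T(1) CM by blast
    ultimately have "u = a" if "u \<in> T" "d a u < r" for u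
      using U(3)[of u] aM that by (meson in_mball subsetD)
    then show ?thesis using \<open>r > 0\<close> by blast
  qed
  obtain t :: "nat \<Rightarrow> 'a" where t: "inj t" "range t \<subseteq> T"
    using infinite_countable_subset[OF T(2)] by blast
  have tM: "t k \<in> M" for k using t T(1) CM by blast
  have "\<forall>k. \<exists>r > 0. \<forall>u \<in> T. d (t k) u < r \<longrightarrow> u = t k" using iso tM by blast
  then obtain r where r: "\<And>k. r k > 0" "\<And>k u. u \<in> T \<Longrightarrow> d (t k) u < r k \<Longrightarrow> u = t k"
    by metis
  define e where "e k = min (r k / 2) (1 / Suc k)" for k
  have "disjnt (mball (t j) (e j)) (mball (t k) (e k))" if "j \<noteq> k" for j k
  proof (rule ccontr)
    assume "\<not> disjnt (mball (t j) (e j)) (mball (t k) (e k))"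
    then obtain u where u: "u \<in> mball (t j) (e j)" "u \<in> mball (t k) (e k)" by (auto simp: disjnt_iff)
    have ne: "t j \<noteq> t k" using t(1) that by (auto dest: injD)
    have "d (t j) (t k) \<le> d (t j) u + d (t k) u"
      using triangle[of "t j" u "t k"] u commute[of u] by auto
    also have "\<dots> < r j / 2 + r k / 2" using u by (auto simp: e_def)
    finally have "d (t j) (t k) < r j \<or> d (t k) (t j) < r k" using commute[of "t j" "t k"] by linarith
    moreover have "t j \<in> T" "t k \<in> T" using t(2) by blast+
    ultimately show False using r(2)[of "t k" j] r(2)[of "t j" k] ne by auto
  qed
  moreover have "\<exists>\<eta> > 0. finite {k. d a (t k) < \<eta>}" if a: "a \<in> M" for a
  proof -
    obtain s where s: "s > 0" "\<forall>u \<in> T. d a u < s \<longrightarrow> u = a" using iso[OF a] by blast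
    then have "{k. d a (t k) < s} \<subseteq> t -` {a}" using t(2) by blast
    moreover have "finite (t -` {a})" using t(1) by (intro finite_vimageI) auto
    ultimately show ?thesis using s(1) finite_subset by blast
  qed
  ultimately have "spread t e"
    using r(1) tM by (auto simp: spread_def e_def)
  then show thesis using that t(2) T(1) by blast
qed

text \<open>Only finitely many \<open>t k\<close> lie near a given point, and \<open>q k\<close> is
  within \<open>1 / Suc k\<close> of \<open>t k\<close>; hence the \<open>q k\<close> accumulate
  nowhere.\<close>

lemma spread_choice:
  assumes sp: "spread t e" and q: "\<And>k. k \<in> J \<Longrightarrow> q k \<in> mball (t k) (e k)"
  shows "inj_on q J" and "closedin mtopology (q ` J)"
proof -
  show "inj_on q J"
  proof (rule inj_onI, rule ccontr)
    fix j k assume jk: "j \<in> J" "k \<in> J" "q j = q k" "j \<noteq> k"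
    then have "disjnt (mball (t j) (e j)) (mball (t k) (e k))" using sp by (simp add: spread_def)
    then show False using q[OF jk(1)] q[OF jk(2)] jk(3) by (auto simp: disjnt_iff)
  qed
  have qM: "q k \<in> M" if "k \<in> J" for k using q[OF that] by auto
  show "closedin mtopology (q ` J)"
    unfolding closedin_metric
  proof (intro conjI allI impI)
    show "q ` J \<subseteq> M" using qM by blast
    fix a assume a: "a \<in> M - q ` J"
    then obtain \<eta> where \<eta>: "\<eta> > 0" "finite {k. d a (t k) < \<eta>}" using sp by (auto simp: spread_def)
    obtain m :: nat where m: "1 / Suc m < \<eta> / 2"
      using \<eta>(1) nat_approx_posE[of "\<eta> / 2"] by auto
    let ?I = "{k \<in> J. d a (q k) < \<eta> / 2}"
    have "?I \<subseteq> {k. d a (t k) < \<eta>} \<union> {..m}"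
    proof
      fix k assume k: "k \<in> ?I"
      show "k \<in> {k. d a (t k) < \<eta>} \<union> {..m}"
      proof (cases "k \<le> m")
        case False
        then have "1 / real (Suc k) \<le> 1 / real (Suc m)" by (intro divide_left_mono) auto
        moreover have "e k \<le> 1 / Suc k" "t k \<in> M" using sp by (auto simp: spread_def)
        moreover have "d a (t k) \<le> d a (q k) + d (t k) (q k)"
          using triangle[of a "q k" "t k"] a qM[of k] k \<open>t k \<in> M\<close> commute[of "q k"] by auto
        ultimately show ?thesis using q[of k] k m by auto
      qed simp
    qed
    then have fin: "finite ?I" using \<eta>(2) finite_subset by blast
    let ?r = "Min (insert (\<eta> / 2) ((\<lambda>k. d a (q k)) ` ?I))"
    have "0 < ?r" using fin \<eta>(1) a qM by (auto intro!: mdist_pos_less)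
    moreover have "disjnt (q ` J) (mball a ?r)"
    proof -
      have "\<not> d a (q k) < ?r" if "k \<in> J" for k
      proof
        assume *: "d a (q k) < ?r"
        have "?r \<le> \<eta> / 2" using fin by (intro Min_le) auto
        with * that have "k \<in> ?I" by auto
        then have "?r \<le> d a (q k)" using fin by (intro Min_le) auto
        with * show False by simp
      qed
      then show ?thesis by (auto simp: disjnt_iff)
    qed
    ultimately show "\<exists>r > 0. disjnt (q ` J) (mball a r)" by blast
  qed
qed

text \<open>By \<open>spread_choice\<close> every subset of the chosen points is closed, so
  prescribing \<open>k\<close> at \<open>q k\<close> and 0 on \<open>E\<close> is continuous on a
  closed set, and Tietze extends it. The unbounded extension serves to detect
  non-compactness.\<close>

lemma spread_interpolation:
  assumes sp: "spread t e" and q: "\<And>k. k \<in> J \<Longrightarrow> q k \<in> mball (t k) (e k)"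
    and E: "closedin mtopology E" "disjnt E (q ` J)"
  obtains \<phi> where "continuous_map mtopology euclideanreal \<phi>"
    "\<And>k. k \<in> J \<Longrightarrow> \<phi> (q k) = real k" "\<And>x. x \<in> E \<Longrightarrow> \<phi> x = 0"
proof -
  let ?S = "E \<union> q ` J"
  define g where "g x = (if x \<in> q ` J then real (inv_into J q x) else 0)" for x
  have clS: "closedin mtopology ?S" using E(1) spread_choice(2)[OF sp q] by blast
  have sub: "closedin mtopology Q" if "Q \<subseteq> q ` J" for Q
  proof -
    have "Q = q ` {k \<in> J. q k \<in> Q}" using that by blast
    then show ?thesis using spread_choice(2)[of t e "{k \<in> J. q k \<in> Q}" q] sp q by auto
  qed
  have "continuous_map (subtopology mtopology ?S) euclideanreal g"
    unfolding continuous_map_closedin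
  proof (intro conjI ballI allI impI)
    fix C :: "real set" assume "closedin euclidean C"
    let ?P = "{x \<in> topspace (subtopology mtopology ?S). g x \<in> C}"
    have top: "topspace (subtopology mtopology ?S) = ?S"
      using closedin_subset[OF clS] by auto
    have "?P = {x \<in> q ` J. g x \<in> C} \<union> (if 0 \<in> C then E else {})"
      unfolding top using E(2) by (auto simp: g_def disjnt_iff)
    moreover have "closedin mtopology ({x \<in> q ` J. g x \<in> C} \<union> (if 0 \<in> C then E else {}))"
      using sub[of "{x \<in> q ` J. g x \<in> C}"] E(1) by (auto intro: closedin_Un)
    ultimately have "closedin mtopology ?P" by simp
    then show "closedin (subtopology mtopology ?S) ?P"
      unfolding closedin_closed_subtopology[OF clS] using top by blast
  qed simp
  then obtain \<phi> where \<phi>: "continuous_map mtopology euclideanreal \<phi>" "\<And>x. x \<in> ?S \<Longrightarrow> \<phi> x = g x"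
    using Tietze_extension_realinterval[OF normal_space_mtopology clS, of UNIV g]
    by (auto simp: is_interval_univ)
  show thesis
  proof (rule that[OF \<phi>(1)])
    fix k assume "k \<in> J"
    then show "\<phi> (q k) = real k"
      using \<phi>(2)[of "q k"] inv_into_f_f[OF spread_choice(1)[OF sp q]] by (simp add: g_def)
  next
    fix x assume "x \<in> E"
    then show "\<phi> x = 0" using \<phi>(2)[of x] E(2) by (auto simp: g_def disjnt_iff)
  qed
qed

end


lemma (in Metric_space) spread_mono:
  assumes "spread t e" "\<And>k. 0 < e' k" "\<And>k. e' k \<le> e k"
  shows "spread t e'"
proof -
  have sub: "mball (t k) (e' k) \<subseteq> mball (t k) (e k)" for k
    using assms(3)[of k] by (rule mball_subset_concentric)
  have "e' k \<le> 1 / Suc k" for k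
    using assms(1) assms(3)[of k] by (auto simp: spread_def intro: order_trans)
  moreover have "disjnt (mball (t j) (e' j)) (mball (t k) (e' k))" if "j \<noteq> k" for j k
    using assms(1) that sub[of j] sub[of k] unfolding spread_def by (meson disjnt_subset1 disjnt_subset2)
  ultimately show ?thesis
    using assms(1,2) unfolding spread_def by simp
qed

lemma (in Metric_space) spread_shift:
  assumes "spread t e"
  shows "spread (\<lambda>k. t (k + m)) (\<lambda>k. e (k + m))"
proof -
  have "e (k + m) \<le> 1 / Suc k" for k
  proof -
    have "e (k + m) \<le> 1 / Suc (k + m)" using assms unfolding spread_def by blast
    also have "\<dots> \<le> 1 / Suc k" by (intro divide_left_mono) auto
    finally show ?thesis .
  qed
  moreover have "\<exists>\<eta> > 0. finite {k. d a (t (k + m)) < \<eta>}" if a: "a \<in> M" for a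
  proof -
    obtain \<eta> where \<eta>: "\<eta> > 0" "finite {k. d a (t k) < \<eta>}" using assms a by (auto simp: spread_def)
    have "finite ((\<lambda>k. k + m) -` {k. d a (t k) < \<eta>})" using \<eta>(2) by (rule finite_vimageI) simp
    then show ?thesis using \<eta>(1) by (intro exI[of _ \<eta>]) (auto simp: vimage_def)
  qed
  ultimately show ?thesis using assms by (simp add: spread_def)
qed


subsection \<open>A discontinuous function that is continuous on compact sets\<close>

text \<open>The multiples of \<open>\<rho>\<close> keep the first letters within
  \<open>2 * \<rho>\<close> of \<open>x0\<close> and the others at distance at least
  \<open>3 * \<rho>\<close>. For fixed \<open>k\<close> the \<open>x k n\<close> are discrete in
  \<open>n\<close> while \<open>z k n\<close> tends to \<open>y k\<close>; the bound
  \<open>\<epsilon> k / 2\<close> leaves room for a bump around \<open>z k n\<close> inside the ball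
  of \<open>y k\<close>.\<close>

locale double_sequence = Metric_space M d for M :: "'a set" and d +
  fixes x0 :: 'a and \<rho> :: real and y :: "nat \<Rightarrow> 'a" and \<epsilon> :: "nat \<Rightarrow> real"
    and x :: "nat \<Rightarrow> nat \<Rightarrow> 'a" and \<delta> :: "nat \<Rightarrow> nat \<Rightarrow> real" and z :: "nat \<Rightarrow> nat \<Rightarrow> 'a"
  assumes x0: "x0 \<in> M" and \<rho>: "0 < \<rho>"
    and y: "spread y \<epsilon>" and y_far: "u \<in> mball (y k) (\<epsilon> k) \<Longrightarrow> 3 * \<rho> \<le> d x0 u"
    and x: "spread (x k) (\<delta> k)" and x_near: "d x0 (x k n) \<le> \<rho> / Suc k" and \<delta>_le: "\<delta> k n \<le> \<rho>"
    and z: "z k n \<in> M" and z_neq: "z k n \<noteq> y k" and z_near: "d (y k) (z k n) < \<epsilon> k / 2"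
    and z_lim: "d (y k) (z k n) < 1 / Suc n"
begin

lemma xM: "x k n \<in> M" and yM: "y k \<in> M" and \<delta>_pos: "0 < \<delta> k n" and \<epsilon>_pos: "0 < \<epsilon> k"
  using x y by (auto simp: spread_def)

lemma yz_pos: "0 < d (y k) (z k n)"
  using mdist_pos_less[OF z_neq[symmetric] yM z] .

definition \<alpha> :: "nat \<times> nat \<Rightarrow> 'a \<Rightarrow> real" where
  "\<alpha> i = bump (x (fst i) (snd i)) (\<delta> (fst i) (snd i))"

text \<open>A third of the distance between \<open>y k\<close> and \<open>z k n\<close> is taken as
  the radius of both \<open>\<beta>\<close> and \<open>\<gamma>\<close>, so that their supports are
  disjoint.\<close>

definition \<beta> :: "nat \<times> nat \<Rightarrow> 'a \<Rightarrow> real" where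
  "\<beta> i = bump (y (fst i)) (d (y (fst i)) (z (fst i) (snd i)) / 3)"

definition \<gamma> :: "nat \<times> nat \<Rightarrow> 'a \<Rightarrow> real" where
  "\<gamma> i = bump (z (fst i) (snd i)) (d (y (fst i)) (z (fst i) (snd i)) / 3)"

lemma \<alpha>_supp:
  assumes "\<alpha> (k, n) p \<noteq> 0"
  shows "p \<in> mball (x k n) (\<delta> k n)" and "p \<in> mcball x0 (2 * \<rho>)"
proof -
  show p: "p \<in> mball (x k n) (\<delta> k n)"
    using bump_neq_0[OF xM \<delta>_pos] assms by (simp add: \<alpha>_def)
  have "d x0 p \<le> d x0 (x k n) + d (x k n) p"
    using triangle[OF x0 xM] p by auto
  moreover have "\<rho> / Suc k \<le> \<rho>" using \<rho> by (simp add: divide_le_eq)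
  ultimately show "p \<in> mcball x0 (2 * \<rho>)"
    using x_near[of k n] \<delta>_le[of k n] p x0 by auto
qed

lemma \<beta>_supp:
  assumes "\<beta> (k, n) q \<noteq> 0"
  shows "q \<in> mball (y k) (\<epsilon> k)" and "d (y k) q < d (y k) (z k n) / 3"
proof -
  have q: "q \<in> mball (y k) (d (y k) (z k n) / 3)"
    using bump_neq_0[OF yM, of "d (y k) (z k n) / 3" k q] yz_pos assms by (simp add: \<beta>_def)
  then show "d (y k) q < d (y k) (z k n) / 3" by simp
  then show "q \<in> mball (y k) (\<epsilon> k)" using q z_near[of k n] \<epsilon>_pos[of k] by auto
qed

lemma \<gamma>_supp:
  assumes "\<gamma> (k, n) s \<noteq> 0"
  shows "s \<in> mball (y k) (\<epsilon> k)" and "d (z k n) s < d (y k) (z k n) / 3"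
proof -
  have s: "s \<in> mball (z k n) (d (y k) (z k n) / 3)"
    using bump_neq_0[OF z, of "d (y k) (z k n) / 3" k n s] yz_pos assms by (simp add: \<gamma>_def)
  then show "d (z k n) s < d (y k) (z k n) / 3" by simp
  then show "s \<in> mball (y k) (\<epsilon> k)"
    using s z_near[of k n] \<epsilon>_pos[of k] triangle[of "y k" "z k n" s] yM[of k] by auto
qed

lemma \<beta>_\<gamma>: "\<beta> i u * \<gamma> i u = 0"
proof (rule ccontr)
  obtain k n where i: "i = (k, n)" by (cases i)
  assume "\<beta> i u * \<gamma> i u \<noteq> 0"
  then have "\<beta> (k, n) u \<noteq> 0" "\<gamma> (k, n) u \<noteq> 0" by (auto simp: i)
  then have "d (y k) u < d (y k) (z k n) / 3" "d (z k n) u < d (y k) (z k n) / 3" "u \<in> M"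
    using \<beta>_supp \<gamma>_supp by auto
  then show False
    using triangle[of "y k" u "z k n"] commute[of u "z k n"] yM z yz_pos[of k n] by auto
qed

lemma \<alpha>_\<beta>: "\<alpha> i u * \<beta> i u = 0"
proof (rule ccontr)
  obtain k n where i: "i = (k, n)" by (cases i)
  assume "\<alpha> i u * \<beta> i u \<noteq> 0"
  then have "\<alpha> (k, n) u \<noteq> 0" "\<beta> (k, n) u \<noteq> 0" by (auto simp: i)
  then show False
    using \<alpha>_supp(2)[of k n u] y_far[OF \<beta>_supp(1)[of k n u]] \<rho> by auto
qed

definition c :: "nat \<times> nat \<Rightarrow> ('a \<times> bool) list \<Rightarrow> real" where
  "c i = corner (\<alpha> i) (\<beta> i) (\<gamma> i)"

text \<open>At each word of \<open>F_3(X)\<close> the sum is finite, by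
  \<open>finite_support\<close> for a singleton; on a compact set one finite index set serves all
  words.\<close>

definition f :: "('a \<times> bool) list \<Rightarrow> real" where
  "f w = (\<Sum>i \<in> {i. c i w \<noteq> 0}. c i w)"

lemma continuous_map_c: "continuous_map (free_group_upto 3 mtopology) euclideanreal (c i)"
  unfolding c_def \<alpha>_def \<beta>_def \<gamma>_def
  by (intro continuous_map_corner continuous_map_bump xM yM z)

lemma c_triple:
  "c i [p, q, s] = sign (snd p) * sign (snd q) * sign (snd s) * (\<alpha> i (fst p) * \<beta> i (fst q) * \<gamma> i (fst s))"
  unfolding c_def by (rule corner_triple) (rule \<alpha>_\<beta> \<beta>_\<gamma>)+

lemma c_short: "length w \<le> 2 \<Longrightarrow> c i w = 0"
  unfolding c_def by (rule corner_short) (rule \<alpha>_\<beta> \<beta>_\<gamma>, assumption?)+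

lemma c_nonzero:
  assumes "w \<in> topspace (free_group_upto 3 mtopology)" "c (k, n) w \<noteq> 0"
  obtains p q s where "w = [p, q, s]" "\<alpha> (k, n) (fst p) \<noteq> 0" "\<beta> (k, n) (fst q) \<noteq> 0" "\<gamma> (k, n) (fst s) \<noteq> 0"
proof -
  have "length w \<le> 3" using assms(1) by (simp add: topspace_free_group_upto)
  then show thesis
  proof (cases w rule: list_length_le3_cases)
    case (4 p q s)
    then show thesis using that assms(2) by (auto simp: c_triple)
  qed (use assms(2) c_short[of w] in auto)
qed

text \<open>Infinitely many indices involve infinitely many \<open>k\<close>, or infinitely many
  \<open>n\<close> for one \<open>k\<close>. In the first case the middle letters are closed and
  discrete, in the second the first letters are; either way some continuous
  \<open>letter_sum\<close> is unbounded on \<open>K\<close>.\<close>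

lemma finite_support:
  assumes K: "compactin (free_group_upto 3 mtopology) K"
  shows "finite {i. \<exists>w \<in> K. c i w \<noteq> 0}" (is "finite ?I")
proof (rule ccontr)
  assume inf: "infinite ?I"
  have KF: "K \<subseteq> topspace (free_group_upto 3 mtopology)" using compactin_subset_topspace[OF K] .
  have "\<forall>i \<in> ?I. \<exists>p q s. [p, q, s] \<in> K \<and> \<alpha> i (fst p) \<noteq> 0 \<and> \<beta> i (fst q) \<noteq> 0 \<and> \<gamma> i (fst s) \<noteq> 0"
  proof
    fix i assume "i \<in> ?I"
    then obtain w where w: "w \<in> K" "c i w \<noteq> 0" by blast
    obtain k n where i: "i = (k, n)" by (cases i)
    have wF: "w \<in> topspace (free_group_upto 3 mtopology)" using w(1) KF by blast
    show "\<exists>p q s. [p, q, s] \<in> K \<and> \<alpha> i (fst p) \<noteq> 0 \<and> \<beta> i (fst q) \<noteq> 0 \<and> \<gamma> i (fst s) \<noteq> 0"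
      using c_nonzero[OF wF w(2)[unfolded i]] w(1) unfolding i by metis
  qed
  then obtain p q s where W: "\<forall>i \<in> ?I. [p i, q i, s i] \<in> K \<and> \<alpha> i (fst (p i)) \<noteq> 0 \<and>
      \<beta> i (fst (q i)) \<noteq> 0 \<and> \<gamma> i (fst (s i)) \<noteq> 0"
    unfolding bchoice_iff by blast
  define I where "I = ?I"
  have infI: "infinite I" using inf by (simp add: I_def)
  have WK: "[p i, q i, s i] \<in> K" and nz: "\<alpha> i (fst (p i)) \<noteq> 0" "\<beta> i (fst (q i)) \<noteq> 0" "\<gamma> i (fst (s i)) \<noteq> 0"
    if "i \<in> I" for i
    using W that unfolding I_def by blast+
  have px: "fst (p (k, n)) \<in> mball (x k n) (\<delta> k n)" and p0: "fst (p (k, n)) \<in> mcball x0 (2 * \<rho>)"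
    and qy: "fst (q (k, n)) \<in> mball (y k) (\<epsilon> k)" and sy: "fst (s (k, n)) \<in> mball (y k) (\<epsilon> k)"
    and qs: "fst (q (k, n)) \<noteq> fst (s (k, n))" if "(k, n) \<in> I" for k n
  proof -
    show "fst (p (k, n)) \<in> mball (x k n) (\<delta> k n)" "fst (p (k, n)) \<in> mcball x0 (2 * \<rho>)"
      using \<alpha>_supp[OF nz(1)[OF that]] .
    show "fst (q (k, n)) \<in> mball (y k) (\<epsilon> k)" "fst (s (k, n)) \<in> mball (y k) (\<epsilon> k)"
      using \<beta>_supp(1)[OF nz(2)[OF that]] \<gamma>_supp(1)[OF nz(3)[OF that]] .
    show "fst (q (k, n)) \<noteq> fst (s (k, n))"
      using \<beta>_\<gamma>[of "(k, n)" "fst (q (k, n))"] nz(2,3)[OF that] by auto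
  qed
  have "I \<subseteq> (SIGMA k : fst ` I. {n. (k, n) \<in> I})" by force
  then have "infinite (fst ` I) \<or> (\<exists>k. infinite {n. (k, n) \<in> I})"
    using infI finite_subset finite_SigmaI by (metis (no_types, lifting))
  then show False
  proof
    assume "infinite (fst ` I)"
    moreover define J where "J = fst ` I"
    ultimately have J: "infinite J" by simp
    have "\<forall>k \<in> J. \<exists>n. (k, n) \<in> I" unfolding J_def by force
    then obtain n where n: "\<And>k. k \<in> J \<Longrightarrow> (k, n k) \<in> I" by metis
    let ?q = "\<lambda>k. fst (q (k, n k))" and ?s = "\<lambda>k. fst (s (k, n k))"
    \<comment> \<open>The interpolating function must vanish at the first and third letters, so that
      the letter sum shows only the middle one. Distinct \<open>k\<close> have disjoint balls, and
      for equal \<open>k\<close> the letters differ by \<open>\<beta>_\<gamma>\<close>, so no middle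
      letter lies in \<open>?E\<close>.\<close>
    let ?E = "?s ` J \<union> mcball x0 (2 * \<rho>)"
    have q: "\<And>k. k \<in> J \<Longrightarrow> ?q k \<in> mball (y k) (\<epsilon> k)" using qy n by blast
    have s: "\<And>k. k \<in> J \<Longrightarrow> ?s k \<in> mball (y k) (\<epsilon> k)" using sy n by blast
    have E: "closedin mtopology ?E"
      using spread_choice(2)[OF y s] by (intro closedin_Un) auto
    have notin: "?q k \<notin> ?E" if k: "k \<in> J" for k
    proof
      assume "?q k \<in> ?E"
      then consider j where "j \<in> J" "?q k = ?s j" | "?q k \<in> mcball x0 (2 * \<rho>)" by blast
      then show False
      proof cases
        case 1
        then have "j = k"
          using y q[OF k] s[OF 1(1)] unfolding spread_def disjnt_iff by metis
        then show False using qs[OF n[OF k]] 1 by simp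
      next
        case 2
        then show False using y_far[OF q[OF k]] \<rho> by auto
      qed
    qed
    have disj: "disjnt ?E (?q ` J)"
      unfolding disjnt_iff
    proof (intro allI notI, elim conjE imageE)
      fix u k assume u: "u \<in> ?E" "k \<in> J" "u = ?q k"
      show False using notin[OF u(2)] u(1) unfolding u(3) by (rule notE)
    qed
    show False
    proof (rule spread_interpolation[OF y q E disj])
      fix \<phi> assume \<phi>: "continuous_map mtopology euclideanreal \<phi>"
        "\<And>k. k \<in> J \<Longrightarrow> \<phi> (?q k) = real k" "\<And>u. u \<in> ?E \<Longrightarrow> \<phi> u = 0"
      show False
      proof (rule compactin_imp_not_unbounded[OF K continuous_map_letter_sum[OF \<phi>(1)] J])
        fix k assume k: "k \<in> J"
        show "[p (k, n k), q (k, n k), s (k, n k)] \<in> K" using WK n k by blast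
        have "\<phi> (fst (p (k, n k))) = 0" using p0[OF n[OF k]] by (intro \<phi>(3)) blast
        moreover have "\<phi> (?s k) = 0" using k by (intro \<phi>(3)) blast
        ultimately show "\<bar>letter_sum \<phi> [p (k, n k), q (k, n k), s (k, n k)]\<bar> = real k"
          using \<phi>(2)[OF k] by (simp add: letter_sum_triple abs_mult)
      qed
    qed
  next
    assume "\<exists>k. infinite {n. (k, n) \<in> I}"
    then obtain k where "infinite {n. (k, n) \<in> I}" by blast
    moreover define J where "J = {n. (k, n) \<in> I}"
    ultimately have J: "infinite J" by simp
    have n: "(k, n) \<in> I" if "n \<in> J" for n using that by (simp add: J_def)
    let ?p = "\<lambda>n. fst (p (k, n))"
    \<comment> \<open>This set contains the second and third letters, and no first letter.\<close>
    let ?E = "M - mball x0 (3 * \<rho>)"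
    have pp: "\<And>n. n \<in> J \<Longrightarrow> ?p n \<in> mball (x k n) (\<delta> k n)" using px n by blast
    have E: "closedin mtopology ?E"
      using closedin_diff[OF closedin_topspace openin_mball, of x0 "3 * \<rho>"] by simp
    have disj: "disjnt ?E (?p ` J)"
      unfolding disjnt_iff
    proof (intro allI notI, elim conjE imageE)
      fix u m assume u: "u \<in> ?E" "m \<in> J" "u = ?p m"
      then show False using p0[OF n[OF u(2)]] \<rho> by auto
    qed
    show False
    proof (rule spread_interpolation[OF x pp E disj])
      fix \<phi> assume \<phi>: "continuous_map mtopology euclideanreal \<phi>"
        "\<And>n. n \<in> J \<Longrightarrow> \<phi> (?p n) = real n" "\<And>u. u \<in> ?E \<Longrightarrow> \<phi> u = 0"
      show False
      proof (rule compactin_imp_not_unbounded[OF K continuous_map_letter_sum[OF \<phi>(1)] J])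
        fix m assume m: "m \<in> J"
        show "[p (k, m), q (k, m), s (k, m)] \<in> K" using WK n m by blast
        have far: "\<phi> u = 0" if "u \<in> mball (y k) (\<epsilon> k)" for u
          using y_far[OF that] that by (intro \<phi>(3)) auto
        show "\<bar>letter_sum \<phi> [p (k, m), q (k, m), s (k, m)]\<bar> = real m"
          using \<phi>(2)[OF m] far[OF qy[OF n[OF m]]] far[OF sy[OF n[OF m]]]
          by (simp add: letter_sum_triple abs_mult)
      qed
    qed
  qed
qed

lemma continuous_map_f_compact:
  assumes K: "compactin (free_group_upto 3 mtopology) K"
  shows "continuous_map (subtopology (free_group_upto 3 mtopology) K) euclideanreal f"
proof -
  let ?I = "{i. \<exists>w \<in> K. c i w \<noteq> 0}"
  have "continuous_map (subtopology (free_group_upto 3 mtopology) K) euclideanreal (\<lambda>w. \<Sum>i \<in> ?I. c i w)"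
    using finite_support[OF K] continuous_map_c
    by (intro continuous_map_sum continuous_map_from_subtopology) auto
  then show ?thesis
  proof (rule continuous_map_eq)
    fix w assume "w \<in> topspace (subtopology (free_group_upto 3 mtopology) K)"
    then show "(\<Sum>i \<in> ?I. c i w) = f w"
      unfolding f_def using finite_support[OF K] by (intro sum.mono_neutral_right) auto
  qed
qed

abbreviation word :: "nat \<Rightarrow> nat \<Rightarrow> ('a \<times> bool) list" where
  "word k n \<equiv> [(x k n, True), (y k, False), (z k n, True)]"

lemma x_neq_y: "x k n \<noteq> y j"
proof
  assume "x k n = y j"
  moreover have "\<rho> / Suc k \<le> \<rho>" using \<rho> by (simp add: divide_le_eq)
  moreover have "y j \<in> mball (y j) (\<epsilon> j)" using yM \<epsilon>_pos by simp
  ultimately show False using x_near[of k n] y_far[of "y j" j] \<rho> by auto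
qed

lemma word_in: "word k n \<in> topspace (free_group_upto 3 mtopology)"
  using xM yM z z_neq[of k n] x_neq_y[of k n k]
  by (auto simp: topspace_free_group_upto free_group_def reduced_def opp_def)

text \<open>The sign pattern of the word makes every summand non-positive, as bumps are
  non-negative; so nothing offsets the value -1 of the summand at \<open>(k, n)\<close>.\<close>

lemma f_word: "f (word k n) \<le> - 1"
proof -
  let ?I = "{i. c i (word k n) \<noteq> 0}"
  have fin: "finite ?I"
    using finite_support[of "{word k n}"] word_in by simp
  have nonpos: "c i (word k n) \<le> 0" for i
    by (simp add: c_triple sign_def \<alpha>_def \<beta>_def \<gamma>_def bump_nonneg)
  have one: "c (k, n) (word k n) = - 1"
    by (simp add: c_triple sign_def \<alpha>_def \<beta>_def \<gamma>_def bump_centre xM yM z)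
  have "f (word k n) = c (k, n) (word k n) + (\<Sum>i \<in> ?I - {(k, n)}. c i (word k n))"
    unfolding f_def using fin one by (intro sum.remove) auto
  moreover have "(\<Sum>i \<in> ?I - {(k, n)}. c i (word k n)) \<le> 0"
    by (rule sum_nonpos) (rule nonpos)
  ultimately show ?thesis using one by simp
qed

text \<open>The words accumulate at the letter \<open>x0\<close>, where \<open>f\<close> is 0: they
  are products of \<open>x k n\<close>, which is close to \<open>x0\<close> for large
  \<open>k\<close>, and of the inverse of \<open>y k\<close> with \<open>z k n\<close>, which tends
  to the identity in \<open>n\<close>.\<close>

lemma not_continuous_map_f: "\<not> continuous_map (free_group_upto 3 mtopology) euclideanreal f"
proof
  let ?F = "free_group_topology mtopology" and ?G = "free_group M"
  assume cont: "continuous_map (free_group_upto 3 mtopology) euclideanreal f"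
  have "openin (free_group_upto 3 mtopology) {w \<in> topspace (free_group_upto 3 mtopology). f w \<in> {- 1<..}}"
    by (rule openin_continuous_map_preimage[OF cont]) simp
  then obtain O' where O': "openin ?F O'"
    "{w \<in> topspace (free_group_upto 3 mtopology). f w \<in> {- 1<..}} =
      O' \<inter> {w \<in> carrier (free_group (topspace mtopology)). length w \<le> 3}"
    unfolding free_group_upto_def openin_subtopology by blast
  have x0F: "[(x0, True)] \<in> topspace (free_group_upto 3 mtopology)"
    using x0 by (simp add: topspace_free_group_upto free_group_def reduced_def)
  moreover have "f [(x0, True)] = 0"
    by (simp add: f_def c_short)
  ultimately have "[(x0, True)] \<in> {w \<in> topspace (free_group_upto 3 mtopology). f w \<in> {- 1<..}}"
    by simp
  then have x0O: "[(x0, True)] \<in> O'"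
    unfolding O'(2) by blast
  let ?m = "\<lambda>(g, h). g \<otimes>\<^bsub>free_group (topspace mtopology)\<^esub> h"
  have "continuous_map (prod_topology ?F ?F) ?F ?m"
    using topological_group_free_group_topology[of mtopology] unfolding topological_group_def by blast
  from openin_continuous_map_preimage[OF this O'(1)]
  have op: "openin (prod_topology ?F ?F) {p \<in> topspace (prod_topology ?F ?F). ?m p \<in> O'}" .
  have "([(x0, True)], []) \<in> {p \<in> topspace (prod_topology ?F ?F). ?m p \<in> O'}"
    using x0O x0 by (auto simp: topspace_free_group_topology free_group_def reduced_def)
  from openin_prod_topology_alt[THEN iffD1, rule_format, OF op this]
  obtain U V where UV: "openin ?F U" "openin ?F V" "[(x0, True)] \<in> U" "[] \<in> V"
    "U \<times> V \<subseteq> {p \<in> topspace (prod_topology ?F ?F). ?m p \<in> O'}"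
    by (elim exE conjE) (rule that)
  have oU: "openin mtopology {u \<in> topspace mtopology. [(u, True)] \<in> U}"
    by (rule openin_continuous_map_preimage[OF continuous_map_letter UV(1)])
  have "x0 \<in> {u \<in> topspace mtopology. [(u, True)] \<in> U}" using x0 UV(3) by simp
  from openin_mball_subset[OF oU this]
  obtain r where r: "r > 0" "mball x0 r \<subseteq> {u \<in> topspace mtopology. [(u, True)] \<in> U}" .
  \<comment> \<open>First \<open>k\<close> is fixed so that \<open>x k n\<close> is close to
    \<open>x0\<close> for all \<open>n\<close> simultaneously; only then is \<open>n\<close> chosen,
    depending on \<open>k\<close>.\<close>
  obtain k :: nat where k: "1 / Suc k < r / \<rho>"
    using nat_approx_posE[of "r / \<rho>"] r(1) \<rho> by auto
  have xU: "[(x k n, True)] \<in> U" for n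
  proof -
    have "\<rho> / Suc k < r" using k \<rho> by (simp add: field_simps)
    then have "x k n \<in> mball x0 r" using x_near[of k n] x0 xM by auto
    then show ?thesis using r(2) by blast
  qed
  have oV: "openin (prod_topology mtopology mtopology)
      {p \<in> topspace (prod_topology mtopology mtopology). word2 False True p \<in> V}"
    by (rule openin_continuous_map_preimage[OF continuous_map_word2 UV(2)])
  have "(y k, y k) \<in> {p \<in> topspace (prod_topology mtopology mtopology). word2 False True p \<in> V}"
    using word2_cancel[of False "y k"] UV(4) yM by simp
  from openin_prod_mball_subset[OF oV this] obtain A e where A: "openin mtopology A" "y k \<in> A" "e > 0"
    "A \<times> mball (y k) e \<subseteq> {p \<in> topspace (prod_topology mtopology mtopology). word2 False True p \<in> V}" .
  obtain n :: nat where n: "1 / Suc n < e"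
    using nat_approx_posE[of e] A(3) by auto
  have "z k n \<in> mball (y k) e" using z_lim[of k n] n yM z by auto
  then have "word2 False True (y k, z k n) \<in> V" using A(2,4) by blast
  then have "[(y k, False), (z k n, True)] \<in> V"
    using z_neq[of k n] by (simp add: word2_def opp_def)
  then have "?m ([(x k n, True)], [(y k, False), (z k n, True)]) \<in> O'"
    using UV(5) xU[of n] by blast
  then have "word k n \<in> O'"
    using x_neq_y[of k n k] by (simp add: free_group_def opp_def)
  moreover have "word k n \<in> carrier (free_group (topspace mtopology))"
    using word_in by (simp add: topspace_free_group_upto)
  ultimately have "word k n \<in> {w \<in> topspace (free_group_upto 3 mtopology). f w \<in> {- 1<..}}"
    unfolding O'(2) by simp
  then have "f (word k n) > - 1" by simp
  then show False using f_word[of k n] by simp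
qed

end

section \<open>Choice of the sequences when both conditions fail\<close>

lemma (in Metric_space) double_sequence_exists:
  assumes nlc: "\<not> locally_compact_space mtopology"
    and nc: "\<not> compactin mtopology (non_isolated_points mtopology)"
  obtains x0 \<rho> y \<epsilon> x \<delta> z where "double_sequence M d x0 \<rho> y \<epsilon> x \<delta> z"
proof -
  obtain x0 where x0: "x0 \<in> M"
    "\<And>U K. openin mtopology U \<Longrightarrow> compactin mtopology K \<Longrightarrow> x0 \<in> U \<Longrightarrow> \<not> U \<subseteq> K"
    using nlc unfolding locally_compact_space_def by auto
  let ?NI = "non_isolated_points mtopology"
  have "closedin mtopology ?NI"
  proof -
    have "?NI = topspace mtopology - (\<Union>u \<in> {u. openin mtopology {u}}. {u})"
      by (auto simp: non_isolated_points_def)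
    moreover have "openin mtopology (\<Union>u \<in> {u. openin mtopology {u}}. {u})"
      by (rule openin_Union) blast
    ultimately show ?thesis by (metis closedin_diff closedin_topspace)
  qed
  then obtain t e where t: "spread t e" "range t \<subseteq> ?NI"
    using noncompact_imp_spread nc by metis
  obtain \<eta> where \<eta>: "\<eta> > 0" "finite {k. d x0 (t k) < \<eta>}" using t(1) x0(1) by (auto simp: spread_def)
  obtain m where m: "\<And>k. d x0 (t k) < \<eta> \<Longrightarrow> k < m"
    using finite_nat_bounded[OF \<eta>(2)] by auto
  \<comment> \<open>Dropping the first \<open>m\<close> terms keeps every \<open>y k\<close> at
    distance at least \<open>\<eta> = 4 * \<rho>\<close> from \<open>x0\<close>; radii of at most
    \<open>\<rho>\<close> then leave \<open>3 * \<rho>\<close>.\<close>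
  define \<rho> where "\<rho> = \<eta> / 4"
  define y where "y k = t (k + m)" for k
  define \<epsilon> where "\<epsilon> k = min (e (k + m)) \<rho>" for k
  have \<rho>: "0 < \<rho>" using \<eta>(1) by (simp add: \<rho>_def)
  have "spread y (\<lambda>k. e (k + m))" unfolding y_def by (rule spread_shift[OF t(1)])
  moreover have "0 < e k" for k using t(1) by (simp add: spread_def)
  ultimately have y: "spread y \<epsilon>"
    using \<rho> by (elim spread_mono) (auto simp: \<epsilon>_def)
  have yM: "y k \<in> M" and \<epsilon>_pos: "0 < \<epsilon> k" for k using y by (auto simp: spread_def)
  have y_far: "3 * \<rho> \<le> d x0 u" if u: "u \<in> mball (y k) (\<epsilon> k)" for u k
  proof -
    have "\<not> d x0 (y k) < \<eta>" using m[of "k + m"] by (auto simp: y_def)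
    moreover have "d x0 (y k) \<le> d x0 u + d (y k) u"
      using triangle[of x0 u "y k"] u x0(1) commute[of u] by auto
    moreover have "d (y k) u < \<rho>" using u by (simp add: \<epsilon>_def)
    ultimately show ?thesis by (simp add: \<rho>_def)
  qed
  have "\<exists>x \<delta>. spread x \<delta> \<and> (\<forall>n. d x0 (x n) \<le> \<rho> / Suc k \<and> \<delta> n \<le> \<rho>)" for k
  proof -
    \<comment> \<open>The point \<open>x0\<close> has no compact neighbourhood, so each of these
      closed balls contains a closed discrete sequence.\<close>
    have "\<not> compactin mtopology (mcball x0 (\<rho> / Suc k))"
      using x0(2)[OF openin_mball, of "mcball x0 (\<rho> / Suc k)" x0 "\<rho> / Suc k"] x0(1) \<rho>
        mball_subset_mcball[of x0 "\<rho> / Suc k"] by auto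
    then obtain x' \<delta>' where x': "spread x' \<delta>'" "range x' \<subseteq> mcball x0 (\<rho> / Suc k)"
      using noncompact_imp_spread[OF closedin_mcball] by metis
    then have "\<And>n. 0 < \<delta>' n" by (simp add: spread_def)
    then have "spread x' (\<lambda>n. min (\<delta>' n) \<rho>)"
      using x'(1) \<rho> by (elim spread_mono) auto
    moreover have "d x0 (x' n) \<le> \<rho> / Suc k" for n
      using x'(2) by (auto simp: image_subset_iff)
    ultimately show ?thesis by (intro exI conjI allI) auto
  qed
  then obtain x \<delta> where x: "\<And>k. spread (x k) (\<delta> k)" "\<And>k n. d x0 (x k n) \<le> \<rho> / Suc k"
    "\<And>k n. \<delta> k n \<le> \<rho>"
    by metis
  have "\<exists>u \<in> M. u \<noteq> y k \<and> d (y k) u < \<epsilon> k / 2 \<and> d (y k) u < 1 / Suc n" for k n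
  proof -
    let ?r = "min (\<epsilon> k / 2) (1 / Suc n)"
    \<comment> \<open>As \<open>y k\<close> is not isolated, every ball around it contains another
      point, which serves as \<open>z k n\<close>.\<close>
    have "\<not> openin mtopology {y k}" using t(2) by (auto simp: y_def non_isolated_points_def)
    moreover have "openin mtopology (mball (y k) ?r)" by (rule openin_mball)
    ultimately have "mball (y k) ?r \<noteq> {y k}" by metis
    moreover have "y k \<in> mball (y k) ?r" using yM \<epsilon>_pos by simp
    ultimately obtain u where "u \<in> mball (y k) ?r" "u \<noteq> y k" by blast
    then show ?thesis by auto
  qed
  then obtain z where z: "\<And>k n. z k n \<in> M" "\<And>k n. z k n \<noteq> y k"
    "\<And>k n. d (y k) (z k n) < \<epsilon> k / 2" "\<And>k n. d (y k) (z k n) < 1 / Suc n"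
    by metis
  have "double_sequence M d x0 \<rho> y \<epsilon> x \<delta> z"
    by unfold_locales (use x0(1) \<rho> y y_far x z in auto)
  then show thesis by (rule that)
qed

lemma kR_witness:
  assumes X: "metrizable_space X" and "\<not> locally_compact_space X"
    and "\<not> compactin X (non_isolated_points X)"
  obtains f :: "('a \<times> bool) list \<Rightarrow> real"
  where "\<And>K. compactin (free_group_upto 3 X) K \<Longrightarrow>
      continuous_map (subtopology (free_group_upto 3 X) K) euclideanreal f"
    and "\<not> continuous_map (free_group_upto 3 X) euclideanreal f"
proof -
  obtain M d where "Metric_space M d" and Xeq: "X = Metric_space.mtopology M d"
    using X unfolding metrizable_space_def by blast
  then interpret Metric_space M d by blast
  obtain x0 \<rho> y \<epsilon> x \<delta> z where "double_sequence M d x0 \<rho> y \<epsilon> x \<delta> z"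
    using double_sequence_exists assms(2,3) unfolding Xeq by metis
  then interpret double_sequence M d x0 \<rho> y \<epsilon> x \<delta> z .
  show thesis
    using that[of f] continuous_map_f_compact not_continuous_map_f unfolding Xeq by blast
qed

theorem theorem3p9:
  fixes X :: "'a topology"
  assumes "metrizable_space X" and "topspace X \<noteq> {}"
  shows "(k_space (free_group_upto 3 X) \<longleftrightarrow> kR_space (free_group_upto 3 X)) \<and>
         (kR_space (free_group_upto 3 X) \<longleftrightarrow>
            locally_compact_space X \<or> compactin X (non_isolated_points X))"
proof -
  let ?F = "free_group_upto 3 X"
  let ?cond = "locally_compact_space X \<or> compactin X (non_isolated_points X)"
  have k: "k_space ?F" if ?cond
    using k_space_free_group_upto_3[OF assms(1) that] .
  have kR: "kR_space ?F" if c: ?cond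
    unfolding kR_space_def
  proof (intro conjI allI impI)
    show "completely_regular_space ?F"
      using completely_regular_space_free_group_upto_3[OF assms(1) c] .
    show "Hausdorff_space ?F"
      unfolding free_group_upto_def
      by (rule Hausdorff_space_subtopology[OF Hausdorff_space_free_group_topology[OF assms(1)]])
    show "continuous_map ?F euclideanreal f"
      if "\<forall>K. compactin ?F K \<longrightarrow> continuous_map (subtopology ?F K) euclideanreal f" for f
      using k_space_imp_continuous_map[OF k[OF c]] that by blast
  qed
  \<comment> \<open>In a k-space, too, continuity on compact sets gives continuity of real
    functions, so one witness refutes both properties.\<close>
  have ?cond if "k_space ?F \<or> kR_space ?F"
  proof (rule ccontr)
    assume n: "\<not> ?cond"
    obtain f where f: "\<And>K. compactin ?F K \<Longrightarrow> continuous_map (subtopology ?F K) euclideanreal f"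
      "\<not> continuous_map ?F euclideanreal f"
      using kR_witness[OF assms(1)] n by blast
    moreover have "continuous_map ?F euclideanreal f"
      using that k_space_imp_continuous_map[OF _ f(1)] f(1) unfolding kR_space_def by blast
    ultimately show False by blast
  qed
  with k kR show ?thesis by blast
qed

end
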